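(* Let $n,k,a$ be integers with $0<k<n$. Then there exists a $0^+$-stable coherent system of type $(n,na,k)$ on $\mathbb P^1$ if and only if $$ka\ge n-k+\frac{k^2-1}{n}.$$
   Context: Work on $\mathbb P^1$ over an algebraically closed field. A coherent system of type $(n,d,k)$ is a pair $(E,V)$ with $E$ a vector bundle of rank $n$ and degree $d$ on $\mathbb P^1$ and $V\subset H^0(E)$ a linear subspace of dimension $k$. For a real number $\alpha$, the $\alpha$-slope is $\mu_\alpha(E,V)=\frac dn+\alpha\frac kn$. A coherent subsystem $(F,W)$ of $(E,V)$ consists of a subbundle $F\subset E$ and a subspace $W\subset V\cap H^0(F)$. $(E,V)$ is $\alpha$-stable if $\mu_\alpha(F,W)<\mu_\alpha(E,V)$ for every proper coherent subsystem $(F,W)$. A coherent system is $0^+$-stable if it is $\alpha$-stable for all sufficiently small $\alpha>0$. *)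

theory Defs
  imports "HOL-Computational_Algebra.Polynomial" "HOL-Computational_Algebra.Fraction_Field"
begin

text \<open>
Model of vector bundles on the projective line P1 over a field k.
K = k(t) is the function field ('k poly fract), t the affine coordinate,
0 = (t = 0) and infinity = (t = infinity).  A vector bundle E of rank n is
given by its generic fibre K^n (vectors: functions nat => K supported on
indices < n) together with the two lattices
  L0   = E(P1 - infinity), a free k[t]-module of rank n, spanned by K-linearly
         independent columns e0 0, ..., e0 (n-1);
  Linf = E(P1 - 0), a free k[1/t]-module of rank n, spanned by K-linearly
         independent columns einf 0, ..., einf (n-1).
Global sections of the twist E(m) = E tensor O(m * infinity) are
L0 intersected with t^m Linf.  Subbundles of E correspond to K-subspaces U of
K^n (F = E intersected with U, saturated), and H0(F(m)) = U \<inter> H0(E(m)).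
Degrees are defined through the Hilbert polynomial: h0(F(m)) = deg F + r (m+1)
for all large m (Riemann-Roch on P1).
\<close>

type_synonym 'k rf = "'k poly fract"
type_synonym 'k vecK = "nat \<Rightarrow> 'k rf"

definition const_rf :: "'k::field \<Rightarrow> 'k rf" where
  "const_rf c = Fract [:c:] 1"

definition tpow :: "nat \<Rightarrow> 'k::field rf" where
  "tpow m = Fract (monom 1 m) 1"

definition in_kt :: "'k::field rf \<Rightarrow> bool" where
  "in_kt x \<longleftrightarrow> (\<exists>p. x = Fract p 1)"

definition in_kinvt :: "'k::field rf \<Rightarrow> bool" where
  "in_kinvt x \<longleftrightarrow> (\<exists>p m. degree p \<le> m \<and> x = Fract p (monom 1 m))"

definition supp_lt :: "nat \<Rightarrow> 'k::field vecK \<Rightarrow> bool" where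
  "supp_lt n v \<longleftrightarrow> (\<forall>i\<ge>n. v i = 0)"

definition Kcomb :: "nat \<Rightarrow> (nat \<Rightarrow> 'k::field rf) \<Rightarrow> (nat \<Rightarrow> 'k vecK) \<Rightarrow> 'k vecK" where
  "Kcomb r c b = (\<lambda>i. \<Sum>j<r. c j * b j i)"

definition Klin_indep :: "nat \<Rightarrow> (nat \<Rightarrow> 'k::field vecK) \<Rightarrow> bool" where
  "Klin_indep r b \<longleftrightarrow> (\<forall>c. Kcomb r c b = (\<lambda>i. 0) \<longrightarrow> (\<forall>j<r. c j = 0))"

definition Kspan :: "nat \<Rightarrow> (nat \<Rightarrow> 'k::field vecK) \<Rightarrow> 'k vecK set" where
  "Kspan r b = {Kcomb r c b | c. True}"

definition frame :: "nat \<Rightarrow> nat \<Rightarrow> (nat \<Rightarrow> 'k::field vecK) \<Rightarrow> bool" where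
  "frame n r b \<longleftrightarrow> (\<forall>j<r. supp_lt n (b j)) \<and> Klin_indep r b"

definition lattice0 :: "nat \<Rightarrow> (nat \<Rightarrow> 'k::field vecK) \<Rightarrow> 'k vecK set" where
  "lattice0 n e0 = {Kcomb n c e0 | c. \<forall>j<n. in_kt (c j)}"

definition latticeInf :: "nat \<Rightarrow> (nat \<Rightarrow> 'k::field vecK) \<Rightarrow> nat \<Rightarrow> 'k vecK set" where
  "latticeInf n einf m = {(\<lambda>i. tpow m * v i) | v. v \<in> {Kcomb n c einf | c. \<forall>j<n. in_kinvt (c j)}}"

definition H0 :: "nat \<Rightarrow> (nat \<Rightarrow> 'k::field vecK) \<Rightarrow> (nat \<Rightarrow> 'k vecK) \<Rightarrow> 'k vecK set \<Rightarrow> nat \<Rightarrow> 'k vecK set" where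
  "H0 n e0 einf U m = U \<inter> lattice0 n e0 \<inter> latticeInf n einf m"

definition klin_indep :: "'k::field vecK list \<Rightarrow> bool" where
  "klin_indep vs \<longleftrightarrow> (\<forall>c. (\<forall>i. (\<Sum>j<length vs. const_rf (c j) * (vs ! j) i) = 0)
                          \<longrightarrow> (\<forall>j<length vs. c j = 0))"

definition ksubspace :: "'k::field vecK set \<Rightarrow> bool" where
  "ksubspace S \<longleftrightarrow> (\<lambda>i. 0) \<in> S \<and> (\<forall>v\<in>S. \<forall>w\<in>S. (\<lambda>i. v i + w i) \<in> S)
                   \<and> (\<forall>c. \<forall>v\<in>S. (\<lambda>i. const_rf c * v i) \<in> S)"

definition kdim :: "'k::field vecK set \<Rightarrow> nat" where
  "kdim S = Max {length vs | vs. set vs \<subseteq> S \<and> klin_indep vs}"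

definition has_degree :: "nat \<Rightarrow> (nat \<Rightarrow> 'k::field vecK) \<Rightarrow> (nat \<Rightarrow> 'k vecK) \<Rightarrow> nat \<Rightarrow> 'k vecK set \<Rightarrow> int \<Rightarrow> bool" where
  "has_degree n e0 einf r U d \<longleftrightarrow>
     (\<exists>M. \<forall>m\<ge>M. int (kdim (H0 n e0 einf U m)) = d + int r * (int m + 1))"

definition bdeg :: "nat \<Rightarrow> (nat \<Rightarrow> 'k::field vecK) \<Rightarrow> (nat \<Rightarrow> 'k vecK) \<Rightarrow> nat \<Rightarrow> 'k vecK set \<Rightarrow> int" where
  "bdeg n e0 einf r U = (THE d. has_degree n e0 einf r U d)"

definition fullspace :: "nat \<Rightarrow> 'k::field vecK set" where
  "fullspace n = {v. supp_lt n v}"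

definition coherent_system :: "nat \<Rightarrow> int \<Rightarrow> nat \<Rightarrow> (nat \<Rightarrow> 'k::field vecK) \<Rightarrow> (nat \<Rightarrow> 'k vecK) \<Rightarrow> 'k vecK set \<Rightarrow> bool" where
  "coherent_system n d kk e0 einf V \<longleftrightarrow>
     frame n n e0 \<and> frame n n einf \<and> bdeg n e0 einf n (fullspace n) = d \<and>
     ksubspace V \<and> V \<subseteq> H0 n e0 einf (fullspace n) 0 \<and> kdim V = kk"

definition alpha_slope :: "real \<Rightarrow> int \<Rightarrow> nat \<Rightarrow> nat \<Rightarrow> real" where
  "alpha_slope \<alpha> d r kk = real_of_int d / real r + \<alpha> * real kk / real r"

text \<open>alpha-stability: proper coherent subsystems (F,W), F a subbundle of rank r >= 1
  with generic fibre Kspan r u, W a k-subspace of V \<inter> H0(F), (F,W) \<noteq> (E,V)\<close>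
definition alpha_stable :: "real \<Rightarrow> nat \<Rightarrow> (nat \<Rightarrow> 'k::field vecK) \<Rightarrow> (nat \<Rightarrow> 'k vecK) \<Rightarrow> 'k vecK set \<Rightarrow> bool" where
  "alpha_stable \<alpha> n e0 einf V \<longleftrightarrow>
     (\<forall>r u W. 1 \<le> r \<and> r \<le> n \<and> frame n r u \<and> ksubspace W \<and> W \<subseteq> V \<inter> Kspan r u
        \<and> (r < n \<or> W \<noteq> V) \<longrightarrow>
        alpha_slope \<alpha> (bdeg n e0 einf r (Kspan r u)) r (kdim W)
          < alpha_slope \<alpha> (bdeg n e0 einf n (fullspace n)) n (kdim V))"

definition zero_plus_stable :: "nat \<Rightarrow> (nat \<Rightarrow> 'k::field vecK) \<Rightarrow> (nat \<Rightarrow> 'k vecK) \<Rightarrow> 'k vecK set \<Rightarrow> bool" where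
  "zero_plus_stable n e0 einf V \<longleftrightarrow>
     (\<exists>\<alpha>0>0. \<forall>\<alpha>. 0 < \<alpha> \<and> \<alpha> < \<alpha>0 \<longrightarrow> alpha_stable \<alpha> n e0 einf V)"

definition alg_closed :: "'k::field itself \<Rightarrow> bool" where
  "alg_closed _ \<longleftrightarrow> (\<forall>p::'k poly. 0 < degree p \<longrightarrow> (\<exists>x. poly p x = 0))"

end

theory Submission
  imports Defs "HOL-Library.Function_Algebras" "HOL-Computational_Algebra.Polynomial_Factorial"
begin

text \<open>
  A \<open>0\<^sup>+\<close>-stable system of degree \<open>na\<close> lives on a semistable bundle. For such a bundle Riemann--Roch
  gives \<open>n\<close> sections of \<open>E(-a)\<close>, none of which vanishes anywhere, so \<open>E = O(a)^n\<close>. The subspace \<open>V\<close>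
  of \<open>H\<^sup>0(O(a)) \<otimes> k^n\<close> is then a representation of the Kronecker quiver with \<open>a + 1\<close> arrows
  and dimension vector \<open>(k, n)\<close>, and \<open>0\<^sup>+\<close>-stability is slope stability of this representation. The
  numerical condition says that the Tits form \<open>k\<^sup>2 + n\<^sup>2 - (a + 1)kn\<close> is at most 1.

  Necessity: over an algebraically closed field a stable representation has only scalar endomorphisms,
  and these form the kernel of a linear map from a space of dimension \<open>k\<^sup>2 + n\<^sup>2\<close> to one
  of dimension \<open>(a + 1)kn\<close>.

  Sufficiency: if \<open>n < ak\<close>, let the arrows send the \<open>i\<close>-th basis vector to \<open>a + 1\<close> consecutive basis
  vectors, starting just below the \<open>i\<close>-th multiple of \<open>n/k\<close>. The arrows preserve the order of the bases,
  so passing to leading terms reduces stability to an expansion property of unions of intervals.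
  If \<open>n \<ge> ak\<close>, a reflection functor reduces \<open>(k, n)\<close> to the smaller vector \<open>((a + 1)k - n, k)\<close>.
\<close>

text \<open>For small \<open>\<alpha>\<close> a subsystem is compared first by its degree; the term
  in \<open>\<alpha>\<close> only decides ties. On O(a)^n the subbundles of maximal degree ra are U
  tensor O(a) with U a subspace of k^n, and a section lies in one exactly when all its coefficient
  vectors lie in U. The ties are therefore the inequalities n dim V' < k dim U of a Kronecker
  module, with V' the full preimage of U. One bound on \<open>\<alpha>\<close> serves all subsystems
  because degrees are integers.

  The model defines degrees through dimensions of spaces of sections, so the geometry goes through
  the Hilbert function of a subbundle F of rank r. Its increments are the dimensions of the images
  of evaluation at t = 0; they grow with the twist and never exceed r. This gives both the existence
  of the degree and Riemann's inequality deg F + r(m + 1) <= h^0(F(m)). Used at m = -a and m = -a -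
  1, it recognises O(a)^n and its subbundles of maximal degree.

  Nonzero scalar endomorphisms always exist, which is where the 1 in the bound on the Tits form
  comes from. The explicit interval module takes the place of a general position argument.\<close>

section \<open>Finite-dimensional subspaces\<close>

text \<open>A separate locale, because names added to \<open>vector_space\<close> itself are captured by its
  unqualified interpretation for real vector spaces.\<close>

locale vec_space = vector_space
begin

text \<open>An infinite-dimensional subspace has \<open>dim\<close> 0 by default, so comparisons of
  dimensions carry this predicate.\<close>

definition fin_dim :: "'b set \<Rightarrow> bool" where
  "fin_dim S \<longleftrightarrow> (\<exists>B. finite B \<and> S \<subseteq> span B)"

text \<open>Independence of an indexed family, as in \<open>Klin_indep\<close> and
  \<open>klin_indep\<close>, counts a repeated vector as a dependence, which
  \<open>independent\<close> on the set of values cannot see.\<close>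

definition indep_fam :: "nat \<Rightarrow> (nat \<Rightarrow> 'b) \<Rightarrow> bool" where
  "indep_fam r b \<longleftrightarrow> (\<forall>c. (\<Sum>j<r. c j *s b j) = 0 \<longrightarrow> (\<forall>j<r. c j = 0))"

lemma fin_dim_subset: "fin_dim T \<Longrightarrow> S \<subseteq> T \<Longrightarrow> fin_dim S"
  unfolding fin_dim_def by blast

lemma fin_dim_independent:
  assumes "fin_dim S" "B \<subseteq> S" "independent B"
  shows "finite B"
  using assms independent_span_bound unfolding fin_dim_def by (meson subset_trans)

lemma fin_dim_basis:
  assumes "fin_dim S"
  obtains B where "finite B" "B \<subseteq> S" "independent B" "S \<subseteq> span B" "card B = dim S"
  using assms basis_exists[of S] fin_dim_independent by metis

lemma independent_card_le:
  assumes "fin_dim S" "B \<subseteq> S" "independent B"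
  shows "card B \<le> dim S"
proof -
  obtain C where C: "finite C" "S \<subseteq> span C" "card C = dim S"
    using fin_dim_basis[OF assms(1)] by metis
  then show ?thesis using independent_span_bound[of C B] assms by auto
qed

lemma dim_subset_fin_dim:
  assumes "fin_dim T" "S \<subseteq> T"
  shows "dim S \<le> dim T"
proof -
  obtain B where "B \<subseteq> S" "independent B" "card B = dim S"
    using fin_dim_basis[OF fin_dim_subset[OF assms]] by metis
  then show ?thesis using independent_card_le[OF assms(1), of B] assms(2) by auto
qed

lemma subspace_eq_fin_dim:
  assumes "fin_dim T" "subspace S" "S \<subseteq> T" "dim T \<le> dim S"
  shows "S = T"
proof -
  obtain B where B: "finite B" "B \<subseteq> S" "independent B" "S \<subseteq> span B" "card B = dim S"
    using fin_dim_basis[OF fin_dim_subset[OF assms(1,3)]] by metis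
  have "x \<in> span B" if "x \<in> T" for x
  proof (rule ccontr)
    assume x: "x \<notin> span B"
    have "card (insert x B) \<le> dim T"
      using B x that assms independent_insertI by (intro independent_card_le) auto
    moreover have "x \<notin> B" using x span_base by auto
    ultimately show False using B assms by simp
  qed
  moreover have "span B \<subseteq> S" using B assms span_minimal by auto
  ultimately show ?thesis using assms by auto
qed

lemma fin_dim_zero: "fin_dim {0}"
  unfolding fin_dim_def by (rule exI[of _ "{}"]) simp

lemma dim_zero_set: "dim {0} = 0"
  using dim_span_eq_card_independent[of "{}"] independent_empty by simp

lemma fin_dim_dim_0:
  assumes "fin_dim S" "dim S = 0"
  shows "S \<subseteq> {0}"
proof -
  obtain B where B: "finite B" "S \<subseteq> span B" "card B = dim S"
    using fin_dim_basis[OF assms(1)] by metis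
  then have "B = {}" using assms by simp
  then show ?thesis using B by simp
qed

lemma indep_famD: "indep_fam r b \<Longrightarrow> (\<Sum>j<r. c j *s b j) = 0 \<Longrightarrow> j < r \<Longrightarrow> c j = 0"
  unfolding indep_fam_def by blast

lemma indep_fam_inj_on:
  assumes "indep_fam r b"
  shows "inj_on b {..<r}"
proof (rule inj_onI, rule ccontr)
  fix i j assume ij: "i \<in> {..<r}" "j \<in> {..<r}" "b i = b j" "i \<noteq> j"
  define c where "c = (\<lambda>l. if l = i then 1 else if l = j then -1 else (0::'a))"
  have "(\<Sum>l<r. c l *s b l) = (\<Sum>l\<in>{i,j}. c l *s b l)"
    using ij by (intro sum.mono_neutral_right) (auto simp: c_def)
  also have "\<dots> = 0" using ij by (simp add: c_def)
  finally have "c i = 0" using indep_famD[OF assms] ij by blast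
  then show False by (simp add: c_def)
qed

lemma indep_fam_independent:
  assumes "indep_fam r b"
  shows "independent (b ` {..<r})"
proof (rule independent_if_scalars_zero)
  fix f x assume s: "(\<Sum>x\<in>b ` {..<r}. f x *s x) = 0" and x: "x \<in> b ` {..<r}"
  from s have "(\<Sum>j<r. f (b j) *s b j) = 0"
    by (subst (asm) sum.reindex[OF indep_fam_inj_on[OF assms]]) simp
  then show "f x = 0" using indep_famD[OF assms, of "f \<circ> b"] x by auto
qed simp

lemma indep_fam_dim_le:
  assumes "fin_dim S" "\<And>j. j < r \<Longrightarrow> b j \<in> S" "indep_fam r b"
  shows "r \<le> dim S"
  using independent_card_le[OF assms(1) _ indep_fam_independent[OF assms(3)]]
    card_image[OF indep_fam_inj_on[OF assms(3)]] assms(2) by auto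

lemma basis_fam:
  assumes "fin_dim S"
  obtains b where "indep_fam (dim S) b" "\<And>j. j < dim S \<Longrightarrow> b j \<in> S"
    "\<And>v. v \<in> S \<Longrightarrow> \<exists>c. v = (\<Sum>j<dim S. c j *s b j)"
proof -
  obtain B where B: "finite B" "B \<subseteq> S" "independent B" "S \<subseteq> span B" "card B = dim S"
    using fin_dim_basis[OF assms] by metis
  obtain b where b: "bij_betw b {..<dim S} B"
    using B ex_bij_betw_nat_finite[of B] by (auto simp: atLeast0LessThan)
  have re: "(\<Sum>v\<in>B. f v *s v) = (\<Sum>j<dim S. f (b j) *s b j)" for f
    using sum.reindex_bij_betw[OF b, of "\<lambda>v. f v *s v"] by simp
  show thesis
  proof
    show "indep_fam (dim S) b"
      unfolding indep_fam_def
    proof (intro allI impI)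
      fix c j assume s: "(\<Sum>j<dim S. c j *s b j) = 0" and j: "j < dim S"
      define f where "f = (\<lambda>v. c (the_inv_into {..<dim S} b v))"
      have fb: "f (b i) = c i" if "i < dim S" for i
        unfolding f_def using b that by (subst the_inv_into_f_f) (auto simp: bij_betw_def)
      have "(\<Sum>v\<in>B. f v *s v) = 0" unfolding re using s fb by simp
      then have "f (b j) = 0"
        using independentD[OF B(3) B(1) subset_refl] b j by (auto simp: bij_betw_def)
      then show "c j = 0" using fb j by simp
    qed
    show "b j \<in> S" if "j < dim S" for j using b B that by (auto simp: bij_betw_def)
    show "\<exists>c. v = (\<Sum>j<dim S. c j *s b j)" if v: "v \<in> S" for v
    proof -
      have "v \<in> span B" using v B by auto
      then obtain f where "v = (\<Sum>v\<in>B. f v *s v)" using span_finite[OF B(1)] by auto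
      then show ?thesis unfolding re by (intro exI[of _ "f \<circ> b"]) simp
    qed
  qed
qed

lemma dim_fam:
  assumes "indep_fam r b" "\<And>j. j < r \<Longrightarrow> b j \<in> S" "\<And>v. v \<in> S \<Longrightarrow> \<exists>c. v = (\<Sum>j<r. c j *s b j)"
  shows "fin_dim S" "dim S = r"
proof -
  have sp: "S \<subseteq> span (b ` {..<r})"
  proof
    fix v assume "v \<in> S"
    then obtain c where "v = (\<Sum>j<r. c j *s b j)" using assms(3) by blast
    then show "v \<in> span (b ` {..<r})" by (simp, intro span_sum span_scale span_base) auto
  qed
  then show "fin_dim S" unfolding fin_dim_def by blast
  show "dim S = r"
    using sp assms(2) indep_fam_independent[OF assms(1)] card_image[OF indep_fam_inj_on[OF assms(1)]]
    by (subst basis_card_eq_dim[of "b ` {..<r}" S, symmetric]) auto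
qed

end

locale vec_space_pair = vs1: vec_space s1 + vs2: vec_space s2
  for s1 :: "'a::field \<Rightarrow> 'b::ab_group_add \<Rightarrow> 'b"
  and s2 :: "'a::field \<Rightarrow> 'c::ab_group_add \<Rightarrow> 'c"
begin

sublocale vector_space_pair s1 s2 ..


lemma linear_intro:
  "(\<And>x y. f (x + y) = f x + f y) \<Longrightarrow> (\<And>c x. f (s1 c x) = s2 c (f x)) \<Longrightarrow> Vector_Spaces.linear s1 s2 f"
  unfolding Vector_Spaces.linear_iff using vs1.vector_space_axioms vs2.vector_space_axioms by blast

lemma fin_dim_image:
  assumes "Vector_Spaces.linear s1 s2 f" "vs1.fin_dim S"
  shows "vs2.fin_dim (f ` S)"
proof -
  obtain B where "finite B" "S \<subseteq> vs1.span B" using assms unfolding vs1.fin_dim_def by blast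
  then show ?thesis unfolding vs2.fin_dim_def
    by (intro exI[of _ "f ` B"]) (auto simp: linear_span_image[OF assms(1)])
qed

text \<open>Relative to a subspace, since the ambient function types may be infinite-dimensional. A
  basis of the kernel is extended to one of \<open>S\<close>, and \<open>f\<close> is injective on
  the span of the added vectors.\<close>

lemma rank_nullity:
  assumes f: "Vector_Spaces.linear s1 s2 f" and S: "vs1.subspace S" "vs1.fin_dim S"
  shows "vs1.dim S = vs1.dim {x \<in> S. f x = 0} + vs2.dim (f ` S)"
proof -
  let ?K = "{x \<in> S. f x = 0}"
  have Kfd: "vs1.fin_dim ?K" using vs1.fin_dim_subset[OF S(2)] by auto
  obtain B where B: "finite B" "B \<subseteq> ?K" "vs1.independent B" "?K \<subseteq> vs1.span B" "card B = vs1.dim ?K"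
    by (rule vs1.fin_dim_basis[OF Kfd])
  obtain C where C: "B \<subseteq> C" "C \<subseteq> S" "vs1.independent C" "S \<subseteq> vs1.span C"
    using vs1.maximal_independent_subset_extend[of B S] B by auto
  have Cf: "finite C" using vs1.fin_dim_independent[OF S(2) C(2,3)] .
  have cC: "card C = vs1.dim S" using vs1.basis_card_eq_dim C by blast
  let ?D = "C - B"
  have Df: "finite ?D" using Cf by simp
  have inj: "inj_on f (vs1.span ?D)"
  proof (subst linear_inj_on_iff_eq_0[OF f vs1.subspace_span], intro ballI impI)
    fix x assume x: "x \<in> vs1.span ?D" and fx: "f x = 0"
    have "vs1.span ?D \<subseteq> S" using C(2) S(1) by (intro vs1.span_minimal) auto
    then have "x \<in> vs1.span B" using x fx B by auto
    then obtain u where u: "x = (\<Sum>v\<in>B. s1 (u v) v)" using vs1.span_finite[OF B(1)] by auto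
    obtain w where w: "x = (\<Sum>v\<in>?D. s1 (w v) v)" using x vs1.span_finite[OF Df] by auto
    \<comment> \<open>A vector in the spans of both \<open>B\<close> and \<open>?D\<close> has two
      expansions; their difference is a relation on the basis \<open>C\<close>.\<close>
    define z where "z = (\<lambda>v. if v \<in> B then - u v else w v)"
    have "(\<Sum>v\<in>C. s1 (z v) v) = (\<Sum>v\<in>?D. s1 (z v) v) + (\<Sum>v\<in>B. s1 (z v) v)"
      using C Cf by (intro sum.subset_diff) auto
    also have "(\<Sum>v\<in>?D. s1 (z v) v) = x" unfolding w by (rule sum.cong) (auto simp: z_def)
    also have "(\<Sum>v\<in>B. s1 (z v) v) = - x"
      unfolding u by (simp add: z_def sum_negf)
    finally have "(\<Sum>v\<in>C. s1 (z v) v) = 0" by simp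
    then have "z v = 0" if "v \<in> C" for v
      using vs1.independentD[OF C(3) Cf subset_refl] that by blast
    then have "w v = 0" if "v \<in> ?D" for v using that by (force simp: z_def)
    then show "x = 0" unfolding w by simp
  qed
  have ind: "vs2.independent (f ` ?D)"
    using linear_independent_injective_image[OF f _ inj] vs1.independent_mono[OF C(3)] by auto
  have fD: "card (f ` ?D) = card ?D"
    using inj vs1.span_superset by (intro card_image) (rule inj_on_subset)
  have "f ` S \<subseteq> vs2.span (f ` ?D)"
  proof -
    have "f ` S \<subseteq> vs2.span (f ` C)" using C linear_span_image[OF f] by auto
    moreover have "f ` C \<subseteq> vs2.span (f ` ?D)"
    proof
      fix y assume "y \<in> f ` C"
      then obtain x where x: "x \<in> C" "y = f x" by blast
      show "y \<in> vs2.span (f ` ?D)"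
      proof (cases "x \<in> B")
        case True
        then have "y = 0" using x B(2) by auto
        then show ?thesis by (simp add: vs2.span_zero)
      qed (use x in \<open>auto intro: vs2.span_base\<close>)
    qed
    ultimately show ?thesis using vs2.span_minimal[OF _ vs2.subspace_span] by blast
  qed
  moreover have "f ` ?D \<subseteq> f ` S" using C(2) by blast
  ultimately have "vs2.dim (f ` S) = card ?D"
    using vs2.basis_card_eq_dim[of "f ` ?D" "f ` S"] ind fD C by auto
  moreover have "card C = card B + card ?D"
    using C Cf B by (metis card_Diff_subset card_mono le_add_diff_inverse)
  ultimately show ?thesis using cC B by simp
qed

lemma dim_image_inj:
  assumes f: "Vector_Spaces.linear s1 s2 f" and S: "vs1.subspace S" "vs1.fin_dim S"
    and inj: "\<And>x. x \<in> S \<Longrightarrow> f x = 0 \<Longrightarrow> x = 0"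
  shows "vs2.dim (f ` S) = vs1.dim S"
proof -
  have "{x \<in> S. f x = 0} = {0}"
    using inj vs1.subspace_0[OF S(1)] linear_0[OF f] by auto
  then show ?thesis using rank_nullity[OF f S] vs1.dim_zero_set by simp
qed

lemma dim_image_le_fin_dim:
  assumes f: "Vector_Spaces.linear s1 s2 f" and S: "vs1.subspace S" "vs1.fin_dim S"
  shows "vs2.dim (f ` S) \<le> vs1.dim S"
  using rank_nullity[OF assms] by simp

end

section \<open>Coordinate spaces over the constants and over the function field\<close>

definition fscale :: "'k::field \<Rightarrow> ('i \<Rightarrow> 'k) \<Rightarrow> 'i \<Rightarrow> 'k" where
  "fscale c f = (\<lambda>i. c * f i)"

definition pscale :: "'k::field \<Rightarrow> (nat \<Rightarrow> 'k poly) \<Rightarrow> nat \<Rightarrow> 'k poly" where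
  "pscale c p = (\<lambda>i. smult c (p i))"

text \<open>Only constants act here. The K-linear structure on the same vectors is
  \<open>fscale\<close> with scalars in \<open>'k rf\<close>, so dimensions over k and over K belong
  to different interpretations.\<close>

definition kscale :: "'k::field \<Rightarrow> 'k vecK \<Rightarrow> 'k vecK" where
  "kscale c v = (\<lambda>i. const_rf c * v i)"

lemma fscale_apply: "fscale c f i = c * f i"
  by (simp add: fscale_def)

lemma pscale_apply: "pscale c p i = smult c (p i)"
  by (simp add: pscale_def)

lemma kscale_apply: "kscale c v i = const_rf c * v i"
  by (simp add: kscale_def)

text \<open>As default simp rules these would also rewrite eta-expanded occurrences such as the scalar
  multiplication argument of \<open>fs.dim\<close>.\<close>

lemmas vec_apply = plus_fun_apply zero_fun_apply fscale_apply pscale_apply kscale_apply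

declare plus_fun_apply [simp del] zero_fun_apply [simp del]

lemma const_rf_to_fract: "const_rf c = to_fract [:c:]"
  by (simp add: const_rf_def to_fract_def)

interpretation fs: vec_space "fscale :: 'k::field \<Rightarrow> ('i \<Rightarrow> 'k) \<Rightarrow> _"
  by unfold_locales (auto simp: vec_apply fun_eq_iff algebra_simps)

interpretation ps: vec_space "pscale :: 'k::field \<Rightarrow> _"
  by unfold_locales (auto simp: vec_apply fun_eq_iff algebra_simps smult_add_right smult_add_left)

interpretation ks: vec_space "kscale :: 'k::field \<Rightarrow> _"
proof unfold_locales
  have eq: "[:a + b:] = [:a:] + [:b:]" "[:a * b:] = [:a:] * [:b:]" "[:1:] = 1" for a b :: 'k
    by (auto simp: one_pCons)
  fix a b :: 'k and x y :: "'k vecK"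
  show "kscale a (x + y) = kscale a x + kscale a y" by (simp add: vec_apply fun_eq_iff algebra_simps)
  show "kscale (a + b) x = kscale a x + kscale b x"
    unfolding fun_eq_iff by (simp only: kscale_apply const_rf_to_fract eq to_fract_add plus_fun_apply algebra_simps) simp
  show "kscale a (kscale b x) = kscale (a * b) x"
    unfolding fun_eq_iff by (simp only: kscale_apply const_rf_to_fract eq to_fract_mult algebra_simps) simp
  show "kscale 1 x = x"
    unfolding fun_eq_iff by (simp only: kscale_apply const_rf_to_fract eq to_fract_1) simp
qed

interpretation ff: vec_space_pair "fscale :: 'k::field \<Rightarrow> ('i \<Rightarrow> 'k) \<Rightarrow> _" "fscale :: 'k::field \<Rightarrow> ('j \<Rightarrow> 'k) \<Rightarrow> _"
  by unfold_locales
interpretation pf: vec_space_pair "pscale :: 'k::field \<Rightarrow> _" "fscale :: 'k::field \<Rightarrow> ('j \<Rightarrow> 'k) \<Rightarrow> _"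
  by unfold_locales
interpretation fp: vec_space_pair "fscale :: 'k::field \<Rightarrow> ('j \<Rightarrow> 'k) \<Rightarrow> _" "pscale :: 'k::field \<Rightarrow> _"
  by unfold_locales
interpretation pp: vec_space_pair "pscale :: 'k::field \<Rightarrow> _" "pscale :: 'k::field \<Rightarrow> _"
  by unfold_locales
interpretation pk: vec_space_pair "pscale :: 'k::field \<Rightarrow> _" "kscale :: 'k::field \<Rightarrow> _"
  by unfold_locales

lemma sum_fun_apply: "(\<Sum>j\<in>A. f j) i = (\<Sum>j\<in>A. f j i)"
  for f :: "'a \<Rightarrow> 'b \<Rightarrow> 'c::comm_monoid_add"
  by (induction A rule: infinite_finite_induct) (auto simp: vec_apply)

text \<open>Ranks and dimensions occur as numbers, not as types; \<open>FS {..<n}\<close> is k^n or,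
  over the function field, K^n.\<close>

definition FS :: "'i set \<Rightarrow> ('i \<Rightarrow> 'k::field) set" where
  "FS T = {f. \<forall>i. i \<notin> T \<longrightarrow> f i = 0}"

definition unitv :: "'i \<Rightarrow> 'i \<Rightarrow> 'k::field" where
  "unitv i = (\<lambda>j. if j = i then 1 else 0)"

lemma subspace_FS: "fs.subspace (FS T)"
  by (rule fs.subspaceI) (auto simp: vec_apply FS_def)

lemma unitv_in_FS: "i \<in> T \<Longrightarrow> unitv i \<in> FS T"
  by (auto simp: FS_def unitv_def)

lemma FS_expand:
  assumes "finite T" "f \<in> FS T"
  shows "f = (\<Sum>i\<in>T. fscale (f i) (unitv i))"
proof
  fix j
  have "(\<Sum>i\<in>T. fscale (f i) (unitv i)) j = (\<Sum>i\<in>T. if j = i then f i else 0)"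
    unfolding sum_fun_apply by (rule sum.cong) (auto simp: vec_apply unitv_def)
  then show "f j = (\<Sum>i\<in>T. fscale (f i) (unitv i)) j"
    using assms by (simp add: FS_def)
qed

lemma dim_FS:
  assumes "finite T"
  shows "fs.fin_dim (FS T :: ('i \<Rightarrow> 'k::field) set)" "fs.dim (FS T :: ('i \<Rightarrow> 'k) set) = card T"
proof -
  obtain g where g: "bij_betw g {..<card T} T"
    using assms ex_bij_betw_nat_finite[of T] by (auto simp: atLeast0LessThan)
  let ?b = "\<lambda>j. unitv (g j) :: 'i \<Rightarrow> 'k"
  have re: "(\<Sum>i\<in>T. fscale (f i) (unitv i)) = (\<Sum>j<card T. fscale (f (g j)) (?b j))" for f
    using sum.reindex_bij_betw[OF g, of "\<lambda>i. fscale (f i) (unitv i)"] by simp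
  have ind: "fs.indep_fam (card T) ?b"
    unfolding fs.indep_fam_def
  proof (intro allI impI)
    fix c :: "nat \<Rightarrow> 'k" and j
    assume s: "(\<Sum>j<card T. fscale (c j) (?b j)) = 0" and j: "j < card T"
    have "(\<Sum>i<card T. fscale (c i) (?b i)) (g j) = (\<Sum>i<card T. if i = j then c i else 0)"
      unfolding sum_fun_apply using g j
      by (intro sum.cong) (auto simp: vec_apply unitv_def bij_betw_def dest: inj_onD)
    then show "c j = 0" using s j by (simp add: vec_apply)
  qed
  have mem: "?b j \<in> FS T" if "j < card T" for j
    using g that by (intro unitv_in_FS) (auto simp: bij_betw_def)
  have sp: "\<exists>c. v = (\<Sum>j<card T. fscale (c j) (?b j))" if "v \<in> FS T" for v
    using FS_expand[OF assms that] unfolding re by (intro exI[of _ "v \<circ> g"]) simp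
  show "fs.fin_dim (FS T :: ('i \<Rightarrow> 'k::field) set)" "fs.dim (FS T :: ('i \<Rightarrow> 'k) set) = card T"
    using fs.dim_fam[OF ind mem sp] by auto
qed

lemma ksubspace_iff: "ksubspace S \<longleftrightarrow> ks.subspace S"
  unfolding ksubspace_def ks.subspace_def by (auto simp: plus_fun_def zero_fun_def kscale_def)

lemma klin_indep_iff: "klin_indep vs \<longleftrightarrow> ks.indep_fam (length vs) (\<lambda>j. vs ! j)"
  unfolding klin_indep_def ks.indep_fam_def by (simp add: vec_apply fun_eq_iff sum_fun_apply)

text \<open>\<open>kdim\<close> is a \<open>Max\<close> over lengths and meaningful only if these
  are bounded; finite-dimensionality bounds them by \<open>ks.dim S\<close>, and a basis attains the
  bound.\<close>

lemma kdim_eq_dim: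
  assumes "ks.fin_dim S"
  shows "kdim S = ks.dim S"
  unfolding kdim_def
proof (rule Max_eqI)
  have le: "length vs \<le> ks.dim S" if "set vs \<subseteq> S" "klin_indep vs" for vs
    using ks.indep_fam_dim_le[OF assms, of "length vs" "\<lambda>j. vs ! j"] that
    by (simp add: klin_indep_iff subset_iff)
  then have "{length vs |vs. set vs \<subseteq> S \<and> klin_indep vs} \<subseteq> {..ks.dim S}" by auto
  then show "finite {length vs |vs. set vs \<subseteq> S \<and> klin_indep vs}" using finite_subset by blast
  show "y \<le> ks.dim S" if "y \<in> {length vs |vs. set vs \<subseteq> S \<and> klin_indep vs}" for y
    using le that by auto
  obtain b where b: "ks.indep_fam (ks.dim S) b" "\<And>j. j < ks.dim S \<Longrightarrow> b j \<in> S"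
    using ks.basis_fam[OF assms] by metis
  have "klin_indep (map b [0..<ks.dim S])"
    using b(1) unfolding klin_indep_iff ks.indep_fam_def by simp
  then show "ks.dim S \<in> {length vs |vs. set vs \<subseteq> S \<and> klin_indep vs}"
    using b(2) by (intro CollectI exI[of _ "map b [0..<ks.dim S]"]) auto
qed

section \<open>Stable Kronecker modules\<close>

text \<open>These are the pivot positions of an echelon form of \<open>S\<close>. They replace
  \<open>S\<close> by a subspace spanned by basis vectors, on which stability becomes a statement
  about sets of indices.\<close>

definition lead_set :: "(nat \<Rightarrow> 'k::field) set \<Rightarrow> nat set" where
  "lead_set S = {i. \<exists>v\<in>S. v i \<noteq> 0 \<and> (\<forall>j<i. v j = 0)}"

lemma lead_set_subset: "S \<subseteq> FS {..<n} \<Longrightarrow> lead_set S \<subseteq> {..<n}"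
  unfolding lead_set_def FS_def by auto

text \<open>Filter \<open>S\<close> by the vanishing of the first m coordinates. Each step is the
  kernel of one coordinate on the preceding one, so it drops the dimension by one exactly at the
  pivots.\<close>

lemma dim_lead_set:
  assumes S: "fs.subspace S" "S \<subseteq> FS {..<n}"
  shows "fs.dim S = card (lead_set S)"
proof -
  define T where "T m = {v \<in> S. \<forall>j<m. v j = 0}" for m
  have T_sub: "fs.subspace (T m)" for m
    using S(1) unfolding T_def fs.subspace_def by (auto simp: vec_apply)
  have T_fd: "fs.fin_dim (T m)" for m
    using S(2) by (intro fs.fin_dim_subset[OF dim_FS(1)[of "{..<n}"]]) (auto simp: T_def)
  have "fs.dim (T m) = card (lead_set S \<inter> {m..<n})" if "m \<le> n" for m
    using that
  proof (induction m rule: inc_induct)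
    case base
    have "v = 0" if "v \<in> T n" for v
    proof
      fix i show "v i = 0 i" using that S(2) by (cases "i < n") (auto simp: vec_apply T_def FS_def)
    qed
    then have "T n = {0}" using fs.subspace_0[OF T_sub] by blast
    then show ?case by (simp add: fs.dim_zero_set)
  next
    case (step m)
    define f :: "(nat \<Rightarrow> 'a) \<Rightarrow> nat \<Rightarrow> 'a" where "f v = fscale (v m) (unitv m)" for v
    have lin: "Vector_Spaces.linear fscale fscale f"
      by (rule ff.linear_intro) (auto simp: f_def vec_apply fun_eq_iff algebra_simps)
    have f0: "f v = 0 \<longleftrightarrow> v m = 0" for v
      by (auto simp: f_def vec_apply fun_eq_iff unitv_def)
    have "{x \<in> T m. f x = 0} = T (Suc m)"
      unfolding f0 by (auto simp: T_def less_Suc_eq)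
    then have rn: "fs.dim (T m) = fs.dim (T (Suc m)) + fs.dim (f ` T m)"
      using ff.rank_nullity[OF lin T_sub T_fd] by simp
    show ?case
    proof (cases "m \<in> lead_set S")
      case True
      then obtain v where v: "v \<in> T m" "v m \<noteq> 0" by (auto simp: lead_set_def T_def)
      have "f ` T m = FS {m}"
      proof
        show "f ` T m \<subseteq> FS {m}" by (auto simp: f_def vec_apply FS_def unitv_def)
        show "FS {m} \<subseteq> f ` T m"
        proof
          fix w :: "nat \<Rightarrow> 'a" assume w: "w \<in> FS {m}"
          have "fscale (w m / v m) v \<in> T m" using fs.subspace_scale[OF T_sub v(1)] .
          moreover have "f (fscale (w m / v m) v) = w"
            using w v by (auto simp: f_def vec_apply FS_def unitv_def vec_apply fun_eq_iff)
          ultimately show "w \<in> f ` T m" by (metis imageI)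
        qed
      qed
      then have "fs.dim (f ` T m) = 1" by (simp add: dim_FS)
      moreover have "lead_set S \<inter> {m..<n} = insert m (lead_set S \<inter> {Suc m..<n})"
        using True step by auto
      ultimately show ?thesis using rn step by simp
    next
      case False
      then have "v m = 0" if "v \<in> T m" for v using that by (auto simp: lead_set_def T_def)
      then have "f ` T m \<subseteq> {0}" using f0 by auto
      moreover have "0 \<in> f ` T m"
        using fs.subspace_0[OF T_sub, of m] ff.linear_0[OF lin] by force
      ultimately have "f ` T m = {0}" by blast
      then have "fs.dim (f ` T m) = 0" by (simp add: fs.dim_zero_set)
      moreover have "lead_set S \<inter> {m..<n} = lead_set S \<inter> {Suc m..<n}"
        using False Suc_le_eq by (auto simp: le_less)
      ultimately show ?thesis using rn step by simp
    qed
  qed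
  from this[of 0] have "fs.dim S = card (lead_set S \<inter> {..<n})"
    by (simp add: T_def atLeast0LessThan)
  then show ?thesis using lead_set_subset[OF S(2)] by (simp add: Int_absorb2)
qed

text \<open>The third clause is stability against \<open>U = {0}\<close>; without it the zero maps would qualify
  for \<open>k = n = 1\<close>.\<close>

definition kron_stable :: "nat \<Rightarrow> nat \<Rightarrow> nat \<Rightarrow> (nat \<Rightarrow> (nat \<Rightarrow> 'k::field) \<Rightarrow> nat \<Rightarrow> 'k) \<Rightarrow> bool" where
  "kron_stable N k n A \<longleftrightarrow>
     (\<forall>s. Vector_Spaces.linear fscale fscale (A s)) \<and>
     (\<forall>s<N. \<forall>c\<in>FS {..<k}. A s c \<in> FS {..<n}) \<and>
     (\<forall>c\<in>FS {..<k}. (\<forall>s<N. A s c = 0) \<longrightarrow> c = 0) \<and>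
     (\<forall>U. fs.subspace U \<and> U \<subseteq> FS {..<n} \<and> U \<noteq> {0} \<and> U \<noteq> FS {..<n} \<longrightarrow>
        n * fs.dim {c \<in> FS {..<k}. \<forall>s<N. A s c \<in> U} < k * fs.dim U)"

lemma subspace_kron_preimage:
  assumes "\<And>s. Vector_Spaces.linear fscale fscale (A s)" "fs.subspace U"
  shows "fs.subspace {c \<in> FS {..<k}. \<forall>s<(N::nat). A s c \<in> U}"
  using subspace_FS[of "{..<k}"] assms
  by (auto simp: fs.subspace_def ff.linear_0 ff.linear_add ff.linear_scale)

text \<open>The sharper bound for sets \<open>I\<close> with a gap is what makes the expansion strict for
  every proper subset, even when \<open>x\<close> times an index is an integer.\<close>

lemma interval_union_card:
  fixes x :: real and N :: nat and I :: "nat set"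
  defines "C \<equiv> \<lambda>i::nat. \<lceil>x * real i\<rceil>"
  defines "J \<equiv> \<lambda>I. {l::int. 0 \<le> l \<and> (\<exists>i\<in>I. C i - 1 \<le> l \<and> l < C i - 1 + int N)}"
  assumes x: "1 \<le> x" "x \<le> real N - 1" and I: "finite I" "I \<noteq> {}"
  shows "(if I = {..Max I} then C (Max I) + int N - 1
     else C (Max I) + int N - C (Max I + 1 - card I)) \<le> int (card (J I))"
  using I
\<comment> \<open>The bound is the size of the union if \<open>I\<close> is replaced by the
  consecutive indices with the same maximum and the same cardinality. The block of 0 would start at
  -1 and is clipped at 0, which costs an initial segment one point.\<close>
proof (induction rule: finite_linorder_max_induct)
  case (insert m' I)
  have C_ge: "x * real i \<le> real_of_int (C i)" and C_lt: "real_of_int (C i) < x * real i + 1" for i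
    unfolding C_def by linarith+
  have C_mono: "C i + 1 \<le> C j" if "i < j" for i j
  proof -
    have "x * real i + 1 \<le> x * real i + x * (real j - real i)"
      using that x mult_mono[of 1 x 1 "real j - real i"] by auto
    then have "x * real i + 1 \<le> x * real j" by (simp add: algebra_simps)
    then have "\<lceil>x * real i + 1\<rceil> \<le> \<lceil>x * real j\<rceil>" by (rule ceiling_mono)
    then show ?thesis by (simp add: C_def)
  qed
  have C0: "C 0 = 0" by (simp add: C_def)
  have Jfin: "finite (J I)" if "finite I" for I
  proof -
    have "J I \<subseteq> (\<Union>i\<in>I. {C i - 1..<C i - 1 + int N})" by (auto simp: J_def)
    then show ?thesis using that finite_subset by blast
  qed
  have N1: "N \<ge> 2" using x by linarith
  show ?case
  proof (cases "I = {}")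
    case True
    show ?thesis
    proof (cases "m' = 0")
      case True
      have "J {0} = {0..<int N - 1}" using N1 by (auto simp: J_def C0)
      then show ?thesis using True \<open>I = {}\<close> N1 by (simp add: C0)
    next
      case False
      then have "C m' \<ge> 1" using C_mono[of 0 m'] C0 by simp
      then have "J {m'} = {C m' - 1..<C m' - 1 + int N}" by (auto simp: J_def)
      moreover have "{m'} \<noteq> {..m'}" using False by auto
      ultimately show ?thesis using \<open>I = {}\<close> by simp
    qed
  next
    case False
    define m where "m = Max I"
    define c where "c = card I"
    have mI: "m \<in> I" using insert False by (simp add: m_def)
    have mm': "m < m'" using insert mI by auto
    have Im: "I \<subseteq> {..m}" using insert by (auto simp: m_def)
    have c: "c \<le> m + 1" using card_mono[OF _ Im] by (simp add: c_def)
    have Max': "Max (insert m' I) = m'" using insert by (intro Max_eqI) auto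
    have notin: "m' \<notin> I" using insert by auto
    have card': "card (insert m' I) = c + 1" using insert notin by (simp add: c_def)
    have IH: "(if I = {..m} then C m + int N - 1 else C m + int N - C (m + 1 - c)) \<le> int (card (J I))"
      using insert.IH False unfolding m_def c_def by blast
    \<comment> \<open>All points covered so far lie below \<open>C m - 1 + int N\<close>, so this
      part of the block of \<open>m'\<close> is new; its size is
      \<open>min (int N) (C m' - C m)\<close>.\<close>
    let ?E = "{max (C m - 1 + int N) (C m' - 1)..<C m' - 1 + int N}"
    have Cm': "C m' \<ge> 1" using C_mono[of 0 m'] C0 mm' by simp
    have lt: "l < C m - 1 + int N" if l: "l \<in> J I" for l
    proof -
      obtain i where i: "i \<in> I" "l < C i - 1 + int N" using l by (auto simp: J_def)
      have "C i \<le> C m" using C_mono[of i m] i Im by (cases "i = m") (auto simp: less_le)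
      then show ?thesis using i by simp
    qed
    have Jsub: "J I \<union> ?E \<subseteq> J (insert m' I)" using Cm' by (auto simp: J_def)
    have "card (J I) + card ?E = card (J I \<union> ?E)"
      using Jfin[OF insert.hyps(1)] by (intro card_Un_disjoint[symmetric]) (auto dest: lt)
    also have "\<dots> \<le> card (J (insert m' I))"
      using Jsub Jfin insert by (intro card_mono) auto
    finally have step: "int (card (J I)) + min (int N) (C m' - C m) \<le> int (card (J (insert m' I)))"
      using C_mono[OF mm'] by auto
    show ?thesis
    proof (cases "insert m' I = {..m'}")
      case True
      have Ieq: "I = {..<m'}"
      proof (intro equalityI subsetI)
        fix i assume "i \<in> {..<m'}"
        then have "i \<in> insert m' I" "i \<noteq> m'" unfolding True by auto
        then show "i \<in> I" by simp
      qed (use insert.hyps in auto)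
      then have "m' - 1 \<in> I" using mm' by auto
      then have "m' - 1 \<le> m" using Im by auto
      then have m: "m' = m + 1" using mm' by simp
      have "real_of_int (C m') - real_of_int (C m) < real N"
        using C_lt[of m'] C_ge[of m] x m by (simp add: algebra_simps)
      then have "C m' - C m < int N" by linarith
      moreover have "I = {..m}" using Ieq m by auto
      ultimately show ?thesis using step IH True unfolding Max' by auto
    next
      case F: False
      have ge: "C m' + int N - C (m' - c) \<le> int (card (J I)) + min (int N) (C m' - C m)"
      proof (cases "C m' - C m \<le> int N")
        case True
        show ?thesis
        proof (cases "I = {..m}")
          case eq: True
          then have "c = m + 1" by (simp add: c_def)
          moreover have "m' \<noteq> m + 1" using F eq by auto
          ultimately have "m' - c > 0" using mm' by auto
          then have "C (m' - c) \<ge> 1" using C_mono[of 0 "m' - c"] C0 by simp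
          then show ?thesis using IH True eq by simp
        next
          case ne: False
          have "C (m + 1 - c) \<le> C (m' - c)"
          proof (cases "m + 1 = m'")
            case False
            then have "m + 1 - c < m' - c" using mm' c by auto
            then show ?thesis using C_mono by fastforce
          qed simp
          then show ?thesis using IH True ne by simp
        qed
      next
        \<comment> \<open>The new block is now disjoint from the old ones and contributes all of
          \<open>N\<close>. What remains compares two differences of ceilings whose arguments differ
          by one step of \<open>x\<close>; the rounding errors are absorbed by
          \<open>x \<le> real N - 1\<close>.\<close>
        case big: False
        have cm': "c \<le> m'" using c mm' by simp
        have r1: "real (m' - c) = real m' - real c" using cm' by simp
        have r2: "real (m + 1 - c) = real m + 1 - real c" using c by simp
        have u: "real_of_int (C m') - real_of_int (C (m' - c)) < x * real c + 1"
          using C_lt[of m'] C_ge[of "m' - c"] unfolding r1 by (simp add: algebra_simps)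
        have "C m' + int N - C (m' - c) \<le> int (card (J I)) + int N"
        proof (cases "I = {..m}")
          case eq: True
          then have "real c = real m + 1" by (simp add: c_def)
          then have "real_of_int (C m') - real_of_int (C (m' - c)) < real_of_int (C m) + real N"
            using u C_ge[of m] x by (simp add: algebra_simps)
          then have "C m' - C (m' - c) \<le> C m + int N - 1" by linarith
          then show ?thesis using IH eq by simp
        next
          case ne: False
          have "real_of_int (C m) - real_of_int (C (m + 1 - c)) > x * (real c - 1) - 1"
            using C_ge[of m] C_lt[of "m + 1 - c"] unfolding r2 by (simp add: algebra_simps)
          then have "real_of_int (C m') - real_of_int (C (m' - c))
              < real_of_int (C m) - real_of_int (C (m + 1 - c)) + real N + 1"
            using u x by (simp add: algebra_simps)
          then have "C m' - C (m' - c) \<le> C m - C (m + 1 - c) + int N" by linarith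
          then show ?thesis using IH ne by simp
        qed
        then show ?thesis using big by simp
      qed
      have "C (m' + 1 - (c + 1)) = C (m' - c)" by simp
      then show ?thesis using ge step F unfolding Max' card' by simp
    qed
  qed
qed simp

text \<open>With x = n/k the claim is that the union has more than x * \<open>card I\<close> points
  below \<open>n\<close>. At most \<open>C m - 1 + int N - int n\<close> points are cut off at the
  top. If none are, the surplus comes from x < N - 1, which is the third assumption. Otherwise n =
  xk >= x(m + 1) supplies the bound, strict because \<open>C i\<close> is less than x i + 1 or, for
  an initial segment, because \<open>card I < k\<close>.\<close>

lemma interval_expansion:
  fixes N k n :: nat
  defines "b \<equiv> \<lambda>i::nat. \<lceil>real n / real k * real i\<rceil> - 1"
  assumes k: "0 < k" "k \<le> n" "n + k < N * k" and I: "I \<subseteq> {..<k}" "I \<noteq> {}" "I \<noteq> {..<k}"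
  shows "n * card I < k * card {l. l < n \<and> (\<exists>i\<in>I. b i \<le> int l \<and> int l < b i + int N)}"
proof -
  define x where "x = real n / real k"
  define C where "C i = \<lceil>x * real i\<rceil>" for i :: nat
  define J where "J = {l::int. 0 \<le> l \<and> (\<exists>i\<in>I. C i - 1 \<le> l \<and> l < C i - 1 + int N)}"
  define L where "L = {l. l < n \<and> (\<exists>i\<in>I. b i \<le> int l \<and> int l < b i + int N)}"
  have xk: "x * real k = real n" using k by (simp add: x_def)
  have x1: "1 \<le> x" using k by (simp add: x_def)
  have "real (n + k) < real (N * k)" using k(3) by (simp only: of_nat_less_iff)
  then have xN: "x < real N - 1" using k by (simp add: x_def field_simps)
  have Ifin: "finite I" using I finite_subset by blast
  define m where "m = Max I"
  define c where "c = card I"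
  have mk: "m < k" using I Ifin by (auto simp: m_def)
  have main: "(if I = {..m} then C m + int N - 1 else C m + int N - C (m + 1 - c)) \<le> int (card J)"
    using interval_union_card[OF x1 _ Ifin I(2)] xN unfolding m_def c_def J_def C_def by simp
  have C_ge: "x * real i \<le> real_of_int (C i)" and C_lt: "real_of_int (C i) < x * real i + 1" for i
    unfolding C_def by linarith+
  have C_mono: "C i \<le> C j" if "i \<le> j" for i j
    unfolding C_def using that x1 by (intro ceiling_mono mult_left_mono) auto
  have Im: "I \<subseteq> {..m}" using Ifin by (auto simp: m_def)
  have cm: "c \<le> m + 1" using card_mono[OF _ Im] by (simp add: c_def)
  have ck: "c < k" using psubset_card_mono[of "{..<k}" I] I by (auto simp: c_def)
  have bC: "b i = C i - 1" for i by (simp add: b_def C_def x_def)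
  have L_fin: "finite L" by (simp add: L_def)
  have L_im: "int ` L = J \<inter> {..<int n}"
  proof
    show "int ` L \<subseteq> J \<inter> {..<int n}" by (auto simp: L_def J_def bC)
    show "J \<inter> {..<int n} \<subseteq> int ` L"
    proof
      fix l assume "l \<in> J \<inter> {..<int n}"
      then have "nat l \<in> L" "l = int (nat l)" by (auto simp: L_def J_def bC)
      then show "l \<in> int ` L" by blast
    qed
  qed
  have cardL: "card L = card (J \<inter> {..<int n})"
    unfolding L_im[symmetric] by (simp add: card_image)
  let ?E = "{int n..<C m - 1 + int N}"
  have "J \<subseteq> (J \<inter> {..<int n}) \<union> ?E"
  proof
    fix l assume l: "l \<in> J"
    then obtain i where i: "i \<in> I" "l < C i - 1 + int N" by (auto simp: J_def)
    then have "C i \<le> C m" using C_mono Im by auto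
    then show "l \<in> (J \<inter> {..<int n}) \<union> ?E" using l i by auto
  qed
  moreover have "finite (J \<inter> {..<int n})" unfolding L_im[symmetric] using L_fin by simp
  ultimately have "card J \<le> card ((J \<inter> {..<int n}) \<union> ?E)" by (intro card_mono) auto
  also have "\<dots> \<le> card L + card ?E" unfolding cardL by (rule card_Un_le)
  finally have cL: "int (card J) \<le> int (card L) + max 0 (C m - 1 + int N - int n)"
    by (auto simp: max_def)
  have "x * real c < real (card L)"
  proof (cases "I = {..m}")
    case True
    then have c: "real c = real m + 1" by (simp add: c_def)
    have "x * real c < x * real k" using ck x1 by (intro mult_strict_left_mono) auto
    then have 1: "x * real c < real n" using xk by simp
    have 2: "x * real c < real_of_int (C m + int N - 1)"
      using C_ge[of m] xN by (simp add: c algebra_simps)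
    have "C m + int N - 1 \<le> int (card L) \<or> int n \<le> int (card L)"
      using main cL True by (auto simp: max_def split: if_splits)
    then show ?thesis using 1 2 by auto
  next
    case False
    have r: "real (m + 1 - c) = real m + 1 - real c" using cm by simp
    have 1: "x * real c < real_of_int (C m + int N - C (m + 1 - c))"
      using C_ge[of m] C_lt[of "m + 1 - c"] xN unfolding r by (simp add: algebra_simps)
    have "x * real (m + 1) \<le> x * real k" using mk x1 by (intro mult_left_mono) auto
    then have 2: "x * real c < real_of_int (int n + 1 - C (m + 1 - c))"
      using C_lt[of "m + 1 - c"] xk unfolding r by (simp add: algebra_simps)
    have "C m + int N - C (m + 1 - c) \<le> int (card L) \<or> int n + 1 - C (m + 1 - c) \<le> int (card L)"
      using main cL False by (auto simp: max_def split: if_splits)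
    then show ?thesis using 1 2 by linarith
  qed
  then have "real n * real c < real k * real (card L)"
    using k by (simp add: x_def field_simps)
  then have "n * c < k * card L" by (simp flip: of_nat_mult)
  then show ?thesis by (simp add: c_def L_def)
qed

text \<open>The index i = floor(l/x) works, because x i <= l < x i + x and x < N - 1. It ensures
  that a submodule with all pivots on the source side has all pivots on the target side.\<close>

lemma interval_cover:
  fixes N k n :: nat
  defines "b \<equiv> \<lambda>i::nat. \<lceil>real n / real k * real i\<rceil> - 1"
  assumes k: "0 < k" "k \<le> n" "n + k < N * k" and l: "l < n"
  shows "\<exists>i<k. b i \<le> int l \<and> int l < b i + int N"
proof -
  define x where "x = real n / real k"
  have x1: "1 \<le> x" using k by (simp add: x_def)
  have "real (n + k) < real (N * k)" using k(3) by (simp only: of_nat_less_iff)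
  then have xN: "x < real N - 1" using k by (simp add: x_def field_simps)
  define i where "i = nat \<lfloor>real l / x\<rfloor>"
  have i1: "x * real i \<le> real l" and i2: "real l < x * real i + x"
  proof -
    have "real i = of_int \<lfloor>real l / x\<rfloor>" using x1 by (simp add: i_def)
    then have "real i \<le> real l / x" "real l / x < real i + 1" by linarith+
    then show "x * real i \<le> real l" "real l < x * real i + x"
      using x1 by (auto simp: field_simps)
  qed
  have "x * real i < x * real k" using i1 l k by (simp add: x_def)
  then have "i < k" using x1 by simp
  moreover have "b i \<le> int l" "int l < b i + int N"
    using i1 i2 x1 xN unfolding b_def x_def[symmetric] by linarith+
  ultimately show ?thesis by blast
qed

text \<open>The arrow \<open>A s\<close> sends the basis vector i to the basis vector
  \<open>b i + s\<close>. As \<open>b\<close> is strictly increasing, it sends a vector with pivot i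
  to one with pivot \<open>b i + s\<close> whenever this index is in range. The pivots of
  \<open>U\<close> thus contain all blocks of the pivots of its preimage, and
  \<open>interval_expansion\<close> applies.\<close>

lemma kron_stable_intervals:
  assumes k: "0 < k" "k \<le> n" "n + k < N * k"
  shows "\<exists>A :: nat \<Rightarrow> (nat \<Rightarrow> 'k::field) \<Rightarrow> nat \<Rightarrow> 'k. kron_stable N k n A"
proof -
  define b where "b i = \<lceil>real n / real k * real i\<rceil> - 1" for i :: nat
  \<comment> \<open>Indices outside \<open>0..<n\<close> are dropped. At the lower end this concerns
    only \<open>b 0 = -1\<close>, so \<open>A 0\<close> kills the first basis vector.\<close>
  define A :: "nat \<Rightarrow> (nat \<Rightarrow> 'k) \<Rightarrow> nat \<Rightarrow> 'k" where
    "A s c = (\<lambda>l. \<Sum>i<k. if l < n \<and> int l = b i + int s then c i else 0)" for s c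
  define L where "L I = {l. l < n \<and> (\<exists>i\<in>I. b i \<le> int l \<and> int l < b i + int N)}" for I
  have b_mono: "b i < b j" if "i < j" for i j
  proof -
    define x where "x = real n / real k"
    have x1: "1 \<le> x" using k by (simp add: x_def)
    have "x * real i + 1 \<le> x * real i + x * (real j - real i)"
      using that x1 mult_mono[of 1 x 1 "real j - real i"] by auto
    then have "x * real i + 1 \<le> x * real j" by (simp add: algebra_simps)
    then have "\<lceil>x * real i + 1\<rceil> \<le> \<lceil>x * real j\<rceil>" by (rule ceiling_mono)
    then show ?thesis unfolding b_def x_def[symmetric] by simp
  qed
  have lin: "Vector_Spaces.linear fscale fscale (A s)" for s
    by (rule ff.linear_intro)
      (auto simp: A_def vec_apply fun_eq_iff sum_distrib_left simp flip: sum.distrib intro!: sum.cong)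
  have mem: "A s c \<in> FS {..<n}" for s c by (auto simp: FS_def A_def)
  have lead: "L (lead_set V) \<subseteq> lead_set U"
    if V: "V = {c \<in> FS {..<k}. \<forall>s<N. A s c \<in> U}" for U V
  proof
    fix l assume "l \<in> L (lead_set V)"
    then obtain i where l: "l < n" "i \<in> lead_set V" "b i \<le> int l" "int l < b i + int N"
      by (auto simp: L_def)
    then obtain v where v: "v \<in> V" "v i \<noteq> 0" "\<And>j. j < i \<Longrightarrow> v j = 0"
      by (auto simp: lead_set_def)
    define s where "s = nat (int l - b i)"
    have s: "s < N" "int l = b i + int s" using l by (auto simp: s_def)
    have ik: "i < k" using v(1,2) V by (cases "i < k") (auto simp: FS_def)
    have "A s v l = (\<Sum>j<k. if j = i then v i else 0)"
      unfolding A_def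
    proof (rule sum.cong)
      fix j
      have "int l = b j + int s \<longleftrightarrow> j = i"
        using s b_mono[of i j] b_mono[of j i] by (cases i j rule: linorder_cases) auto
      then show "(if l < n \<and> int l = b j + int s then v j else 0) = (if j = i then v i else 0)"
        using l by auto
    qed simp
    then have "A s v l \<noteq> 0" using v ik by simp
    moreover have "A s v l' = 0" if "l' < l" for l'
      unfolding A_def
    proof (rule sum.neutral, intro ballI)
      fix j
      have "v j = 0" if "int l' = b j + int s"
      proof -
        have "b j < b i" using that \<open>l' < l\<close> s by auto
        then have "j < i" using b_mono[of i j] by (cases i j rule: linorder_cases) auto
        then show ?thesis using v by blast
      qed
      then show "(if l' < n \<and> int l' = b j + int s then v j else 0) = 0" by auto
    qed
    moreover have "A s v \<in> U" using v V s by blast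
    ultimately show "l \<in> lead_set U" unfolding lead_set_def by blast
  qed
  have expand: "n * card I < k * card (L I)" if "I \<subseteq> {..<k}" "I \<noteq> {}" "I \<noteq> {..<k}" for I
    using interval_expansion[OF k that] unfolding L_def b_def .
  have cover: "L {..<k} = {..<n}"
    using interval_cover[OF k] unfolding L_def b_def by auto
  have Vsub: "fs.subspace {c \<in> FS {..<k}. \<forall>s<N. A s c \<in> U}" if "fs.subspace U" for U
    by (rule subspace_kron_preimage[OF lin that])
  have inj: "c = 0" if c: "c \<in> FS {..<k}" "\<forall>s<N. A s c = 0" for c
  proof (rule ccontr)
    assume "c \<noteq> 0"
    \<comment> \<open>The common kernel is the preimage of zero. The blocks of its pivots must be
      empty, which contradicts expansion for a proper nonempty set of pivots and the covering
      property for the full set.\<close>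
    define V where "V = {c \<in> FS {..<k}. \<forall>s<N. A s c \<in> {0}}"
    have cV: "c \<in> V" using c by (simp add: V_def)
    have "L (lead_set V) = {}"
      using lead[OF V_def] by (auto simp: lead_set_def vec_apply)
    moreover have lk: "lead_set V \<subseteq> {..<k}" by (rule lead_set_subset) (auto simp: V_def)
    moreover have "0 < n" using k by simp
    ultimately have "lead_set V = {}" using expand[of "lead_set V"] cover by force
    then have "fs.dim V = 0"
      using dim_lead_set[of V k] Vsub[of "{0}"] by (auto simp: V_def fs.subspace_single_0)
    then have "V \<subseteq> {0}"
      using fs.fin_dim_dim_0[OF fs.fin_dim_subset[OF dim_FS(1)[of "{..<k}"]], of V] by (auto simp: V_def)
    then show False using cV \<open>c \<noteq> 0\<close> by blast
  qed
  have st: "n * fs.dim {c \<in> FS {..<k}. \<forall>s<N. A s c \<in> U} < k * fs.dim U"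
    if U: "fs.subspace U" "U \<subseteq> FS {..<n}" "U \<noteq> {0}" "U \<noteq> FS {..<n}" for U
  proof -
    define V where "V = {c \<in> FS {..<k}. \<forall>s<N. A s c \<in> U}"
    have VF: "V \<subseteq> FS {..<k}" by (auto simp: V_def)
    have dV: "fs.dim V = card (lead_set V)"
      using dim_lead_set[OF Vsub[OF U(1)]] VF by (auto simp: V_def)
    have dU: "fs.dim U = card (lead_set U)" by (rule dim_lead_set[OF U(1,2)])
    have Ufd: "fs.fin_dim U" using fs.fin_dim_subset[OF dim_FS(1)[of "{..<n}"] U(2)] by simp
    have "finite (lead_set U)" using lead_set_subset[OF U(2)] finite_subset by blast
    then have le: "card (L (lead_set V)) \<le> fs.dim U"
      unfolding dU using lead[OF V_def] by (rule card_mono)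
    have "n * fs.dim V < k * fs.dim U"
    proof (cases "lead_set V = {}")
      case True
      have "fs.dim U \<noteq> 0"
        using fs.fin_dim_dim_0[OF Ufd] U(3) fs.subspace_0[OF U(1)] by blast
      then show ?thesis using True dV k by simp
    next
      case False
      have "lead_set V \<noteq> {..<k}"
      proof
        assume "lead_set V = {..<k}"
        then have "n \<le> fs.dim U" using le cover by simp
        then show False using fs.subspace_eq_fin_dim[OF dim_FS(1)[of "{..<n}"] U(1,2)] U(4)
          by (simp add: dim_FS)
      qed
      then have "n * card (lead_set V) < k * card (L (lead_set V))"
        using expand lead_set_subset[OF VF] False by blast
      also have "\<dots> \<le> k * fs.dim U" using le by simp
      finally show ?thesis using dV by simp
    qed
    then show ?thesis by (simp add: V_def)
  qed
  show ?thesis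
    unfolding kron_stable_def using lin mem inj st by (intro exI[of _ A]) blast
qed

section \<open>Reflection of Kronecker modules\<close>

definition tens :: "nat \<Rightarrow> (nat \<Rightarrow> 'k::field) set \<Rightarrow> (nat \<times> nat \<Rightarrow> 'k) set" where
  "tens N U = {w. (\<forall>s<N. (\<lambda>i. w (s, i)) \<in> U) \<and> (\<forall>s\<ge>N. \<forall>i. w (s, i) = 0)}"

lemma subspace_tens:
  assumes "fs.subspace U"
  shows "fs.subspace (tens N U)"
proof (rule fs.subspaceI)
  show "0 \<in> tens N U" using fs.subspace_0[OF assms] by (auto simp: tens_def zero_fun_def)
  show "x + y \<in> tens N U" if "x \<in> tens N U" "y \<in> tens N U" for x y
    using that fs.subspace_add[OF assms] by (auto simp: tens_def plus_fun_def)
  show "fscale c x \<in> tens N U" if "x \<in> tens N U" for c x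
    using that fs.subspace_scale[OF assms] by (auto simp: tens_def fscale_def)
qed

lemma tens_FS:
  assumes "U \<subseteq> FS {..<k}"
  shows "tens N U \<subseteq> FS ({..<N} \<times> {..<k})"
proof
  fix w assume w: "w \<in> tens N U"
  have "w (s, i) = 0" if "(s, i) \<notin> {..<N} \<times> {..<k}" for s i
  proof (cases "s < N")
    case True
    then have "(\<lambda>i. w (s, i)) \<in> FS {..<k}" using w assms by (auto simp: tens_def)
    then show ?thesis using True that by (auto simp: FS_def)
  next
    case False
    then show ?thesis using w by (simp add: tens_def)
  qed
  then show "w \<in> FS ({..<N} \<times> {..<k})" unfolding FS_def by auto
qed

lemma dim_tens:
  assumes U: "fs.subspace U" "U \<subseteq> FS {..<k}"
  shows "fs.dim (tens N U) = N * fs.dim U"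
proof (induction N)
  case 0
  have "tens 0 U = {0}" by (auto simp: tens_def fun_eq_iff vec_apply)
  then show ?case by (simp add: fs.dim_zero_set)
next
  case (Suc N)
  define f :: "(nat \<times> nat \<Rightarrow> 'a) \<Rightarrow> nat \<Rightarrow> 'a" where "f w = (\<lambda>i. w (N, i))" for w
  have lin: "Vector_Spaces.linear fscale fscale f"
    by (rule ff.linear_intro) (auto simp: f_def fun_eq_iff vec_apply)
  have fd: "fs.fin_dim (tens (Suc N) U)"
    using fs.fin_dim_subset[OF dim_FS(1) tens_FS[OF U(2)]] by simp
  have ker: "{w \<in> tens (Suc N) U. f w = 0} = tens N U"
  proof (intro equalityI subsetI)
    fix w assume "w \<in> {w \<in> tens (Suc N) U. f w = 0}"
    then have w: "w \<in> tens (Suc N) U" "\<And>i. w (N, i) = 0"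
      by (auto simp: f_def fun_eq_iff vec_apply)
    then show "w \<in> tens N U" by (auto simp: tens_def) (metis le_neq_implies_less Suc_leI)
  next
    fix w assume w: "w \<in> tens N U"
    then have "f w = 0" by (auto simp: f_def tens_def fun_eq_iff vec_apply)
    moreover have "(\<lambda>i. w (N, i)) = 0" using w by (auto simp: tens_def fun_eq_iff vec_apply)
    then have "w \<in> tens (Suc N) U"
      using w fs.subspace_0[OF U(1)] by (auto simp: tens_def less_Suc_eq)
    ultimately show "w \<in> {w \<in> tens (Suc N) U. f w = 0}" by simp
  qed
  have im: "f ` tens (Suc N) U = U"
  proof (intro equalityI subsetI)
    show "u \<in> U" if "u \<in> f ` tens (Suc N) U" for u using that by (auto simp: f_def tens_def)
  next
    fix u assume u: "u \<in> U"
    define w where "w = (\<lambda>(s::nat, i). if s = N then u i else 0)"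
    have "(\<lambda>i. w (s, i)) = (if s = N then u else 0)" for s
      by (auto simp: w_def fun_eq_iff vec_apply)
    then have "w \<in> tens (Suc N) U"
      using u fs.subspace_0[OF U(1)] by (auto simp: tens_def w_def vec_apply)
    moreover have "f w = u" by (simp add: f_def w_def)
    ultimately show "u \<in> f ` tens (Suc N) U" by (metis imageI)
  qed
  show ?case
    using ff.rank_nullity[OF lin subspace_tens[OF U(1)] fd] Suc unfolding ker im by simp
qed

text \<open>Realises the quotient by \<open>R\<close> on the coordinate space k^n, so that the
  reflected module again has the standard form: complete a basis of \<open>R\<close> and send the
  added vectors to the unit vectors.\<close>

lemma exists_quotient_map:
  fixes R :: "('i \<Rightarrow> 'k::field) set"
  assumes T: "finite T" and R: "fs.subspace R" "R \<subseteq> FS T" "fs.dim R + n = card T"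
  obtains Q :: "('i \<Rightarrow> 'k) \<Rightarrow> nat \<Rightarrow> 'k" where "Vector_Spaces.linear fscale fscale Q"
    "Q ` FS T = FS {..<n}" "{w \<in> FS T. Q w = 0} = R"
proof -
  have fdT: "fs.fin_dim (FS T :: ('i \<Rightarrow> 'k) set)" by (rule dim_FS(1)[OF T])
  have Rfd: "fs.fin_dim R" by (rule fs.fin_dim_subset[OF fdT R(2)])
  obtain B where B: "finite B" "B \<subseteq> R" "fs.independent B" "R \<subseteq> fs.span B" "card B = fs.dim R"
    by (rule fs.fin_dim_basis[OF Rfd])
  have "B \<subseteq> FS T" using B R by blast
  then obtain C where C: "B \<subseteq> C" "C \<subseteq> FS T" "fs.independent C" "FS T \<subseteq> fs.span C"
    by (rule fs.maximal_independent_subset_extend[OF _ B(3)])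
  have Cfin: "finite C" by (rule fs.fin_dim_independent[OF fdT C(2,3)])
  have spC: "fs.span C = FS T" using C fs.span_minimal[OF C(2) subspace_FS] by blast
  have "card C = card T" using fs.basis_card_eq_dim[OF C(2,4,3)] dim_FS(2)[OF T] by simp
  then have "card (C - B) = n" using B C R(3) card_Diff_subset[OF B(1) C(1)] by simp
  then obtain g where g: "bij_betw g (C - B) {..<n}"
    using Cfin ex_bij_betw_finite_nat[of "C - B"] by (auto simp: atLeast0LessThan)
  define f where "f v = (if v \<in> C - B then unitv (g v) else (0 :: nat \<Rightarrow> 'k))" for v
  obtain Q where Q: "Vector_Spaces.linear fscale fscale Q" "\<And>v. v \<in> C \<Longrightarrow> Q v = f v"
    using ff.linear_independent_extend[OF C(3), of f] by blast
  have im: "Q ` FS T = FS {..<n}"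
  proof -
    have "Q ` FS T = fs.span (Q ` C)" using spC ff.linear_span_image[OF Q(1)] by metis
    moreover have "Q ` C \<subseteq> FS {..<n}"
    proof
      fix y assume "y \<in> Q ` C"
      then obtain v where v: "v \<in> C" "y = Q v" by blast
      show "y \<in> FS {..<n}"
        using v Q(2)[OF v(1)] g fs.subspace_0[OF subspace_FS]
        by (auto simp: f_def bij_betw_def intro!: unitv_in_FS)
    qed
    then have "fs.span (Q ` C) \<subseteq> FS {..<n}" by (rule fs.span_minimal[OF _ subspace_FS])
    moreover have "FS {..<n} \<subseteq> fs.span (Q ` C)"
    proof
      fix w :: "nat \<Rightarrow> 'k" assume w: "w \<in> FS {..<n}"
      have "unitv i \<in> fs.span (Q ` C)" if "i < n" for i
      proof -
        obtain v where v: "v \<in> C - B" "g v = i" using g \<open>i < n\<close> by (metis bij_betw_iff_bijections lessThan_iff)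
        then have "Q v = unitv i" using Q(2) by (auto simp: f_def)
        then show ?thesis using v fs.span_base by (metis DiffD1 imageI)
      qed
      then show "w \<in> fs.span (Q ` C)"
        by (subst FS_expand[OF _ w]) (auto intro!: fs.span_sum fs.span_scale)
    qed
    ultimately show ?thesis by blast
  qed
  have RQ: "R \<subseteq> {w \<in> FS T. Q w = 0}"
  proof
    fix w assume w: "w \<in> R"
    have "Q v = 0" if "v \<in> B" for v using Q(2)[of v] that C by (auto simp: f_def)
    then have "Q w = 0" using ff.linear_eq_0_on_span[OF Q(1)] w B(4) by blast
    then show "w \<in> {w \<in> FS T. Q w = 0}" using w R by blast
  qed
  have "fs.dim (FS T :: ('i \<Rightarrow> 'k) set) = fs.dim {w \<in> FS T. Q w = 0} + fs.dim (Q ` FS T)"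
    by (rule ff.rank_nullity[OF Q(1) subspace_FS fdT])
  then have "fs.dim {w \<in> FS T. Q w = 0} \<le> fs.dim R"
    using im R(3) T by (simp add: dim_FS)
  then have "R = {w \<in> FS T. Q w = 0}"
    using RQ by (intro fs.subspace_eq_fin_dim[OF fs.fin_dim_subset[OF fdT] R(1)]) auto
  then show thesis using that[OF Q(1) im] by simp
qed

text \<open>The arrows \<open>A s\<close> combine into an injection \<open>T\<close> of k^k1 into
  k^N tensor k^k, and the new arrows are the components of its cokernel map \<open>Q\<close>. For
  \<open>U\<close> with preimage V under the new arrows, let Z be the preimage of V under the old
  ones. Then \<open>key\<close> gives N dim V <= dim U + dim Z, stability of \<open>A\<close> gives
  k dim Z < k1 dim V, and k1 + n = Nk turns these into n dim V < k dim U.\<close>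

lemma kron_stable_reflect:
  fixes A :: "nat \<Rightarrow> (nat \<Rightarrow> 'k::field) \<Rightarrow> nat \<Rightarrow> 'k"
  assumes A: "kron_stable N k1 k A" and k: "0 < k" "0 < n" "k1 + n = N * k"
  shows "\<exists>B :: nat \<Rightarrow> (nat \<Rightarrow> 'k) \<Rightarrow> nat \<Rightarrow> 'k. kron_stable N k n B"
proof -
  have linA: "Vector_Spaces.linear fscale fscale (A s)" for s
    using A by (simp add: kron_stable_def)
  have memA: "A s c \<in> FS {..<k}" if "s < N" "c \<in> FS {..<k1}" for s c
    using A that by (simp add: kron_stable_def)
  have injA: "c = 0" if "c \<in> FS {..<k1}" "\<forall>s<N. A s c = 0" for c
    using A that by (simp add: kron_stable_def)
  have stA: "k * fs.dim {c \<in> FS {..<k1}. \<forall>s<N. A s c \<in> U} < k1 * fs.dim U"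
    if "fs.subspace U" "U \<subseteq> FS {..<k}" "U \<noteq> {0}" "U \<noteq> FS {..<k}" for U
    using A that unfolding kron_stable_def by blast
  define T where "T c = (\<lambda>(s, i). if s < N then A s c i else 0)" for c
  have linT: "Vector_Spaces.linear fscale fscale T"
    by (rule ff.linear_intro)
      (auto simp: T_def fun_eq_iff ff.linear_add[OF linA] ff.linear_scale[OF linA] vec_apply)
  have Ts: "(\<lambda>i. T c (s, i)) = A s c" if "s < N" for c s using that by (auto simp: T_def)
  have Ttens: "T c \<in> tens N U \<longleftrightarrow> (\<forall>s<N. A s c \<in> U)" for c U
    using Ts by (auto simp: tens_def) (auto simp: T_def)
  let ?TI = "{..<N} \<times> {..<k}"
  have fd1: "fs.fin_dim (FS {..<k1} :: (nat \<Rightarrow> 'k) set)" by (simp add: dim_FS)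
  have fdk: "fs.fin_dim (FS {..<k} :: (nat \<Rightarrow> 'k) set)" by (simp add: dim_FS)
  have fdn: "fs.fin_dim (FS {..<n} :: (nat \<Rightarrow> 'k) set)" by (simp add: dim_FS)
  have fdT: "fs.fin_dim (FS ?TI :: (nat \<times> nat \<Rightarrow> 'k) set)" by (simp add: dim_FS)
  define R where "R = T ` FS {..<k1}"
  have Tinj: "c = 0" if "c \<in> FS {..<k1}" "T c = 0" for c
  proof (rule injA[OF that(1)], intro allI impI)
    fix s assume "s < N"
    then show "A s c = 0" using Ts[of s c] that(2) by (simp add: zero_fun_def)
  qed
  have dimR: "fs.dim R = k1"
    unfolding R_def using ff.dim_image_inj[OF linT subspace_FS fd1 Tinj] by (simp add: dim_FS)
  have R: "fs.subspace R" "R \<subseteq> FS ?TI"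
  proof -
    show "fs.subspace R" unfolding R_def by (rule ff.linear_subspace_image[OF linT subspace_FS])
    show "R \<subseteq> FS ?TI" unfolding R_def using tens_FS[of "FS {..<k}" k N] Ttens memA by blast
  qed
  obtain Q where Q: "Vector_Spaces.linear fscale fscale Q" "Q ` FS ?TI = FS {..<n}"
      "{w \<in> FS ?TI. Q w = 0} = R"
    using exists_quotient_map[OF _ R, of n] dimR k by auto
  define emb where "emb s v = (\<lambda>(s', i). if s' = s then v i else 0)" for s :: nat and v :: "nat \<Rightarrow> 'k"
  define B where "B s v = Q (emb s v)" for s v
  have lin_emb: "Vector_Spaces.linear fscale fscale (emb s)" for s
    by (rule ff.linear_intro) (auto simp: emb_def fun_eq_iff vec_apply)
  have linB: "Vector_Spaces.linear fscale fscale (B s)" for s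
    unfolding B_def
    by (rule ff.linear_intro)
      (simp_all add: ff.linear_add[OF lin_emb] ff.linear_add[OF Q(1)] ff.linear_scale[OF lin_emb] ff.linear_scale[OF Q(1)])
  have memB: "B s v \<in> FS {..<n}" if "s < N" "v \<in> FS {..<k}" for s v
  proof -
    have "emb s v \<in> FS ?TI" using that by (auto simp: emb_def FS_def)
    then show ?thesis using Q(2) by (auto simp: B_def)
  qed
  define V where "V U = {v \<in> FS {..<k}. \<forall>s<N. B s v \<in> U}" for U
  \<comment> \<open>\<open>Q\<close> maps k^N tensor V into \<open>U\<close>, and an element of its
    kernel is \<open>T c\<close> with all \<open>A s c\<close> in V; rank-nullity on k^N tensor V
    gives the estimate.\<close>
  have key: "N * fs.dim (V U) \<le> fs.dim U + fs.dim {c \<in> FS {..<k1}. \<forall>s<N. A s c \<in> V U}"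
    if U: "fs.subspace U" "U \<subseteq> FS {..<n}" for U
  proof -
    have Vs: "fs.subspace (V U)" unfolding V_def by (rule subspace_kron_preimage[OF linB U(1)])
    have VF: "V U \<subseteq> FS {..<k}" by (auto simp: V_def)
    have fdV: "fs.fin_dim (tens N (V U))" by (rule fs.fin_dim_subset[OF fdT tens_FS[OF VF]])
    have "Q w \<in> U" if w: "w \<in> tens N (V U)" for w
    proof -
      have "w = (\<Sum>s<N. emb s (\<lambda>i. w (s, i)))"
      proof
        fix p :: "nat \<times> nat"
        obtain s i where p: "p = (s, i)" by force
        have "(\<Sum>s'<N. emb s' (\<lambda>i. w (s', i))) p = (\<Sum>s'<N. if s = s' then w (s', i) else 0)"
          unfolding sum_fun_apply p by (rule sum.cong) (auto simp: emb_def)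
        also have "\<dots> = w p" using w by (auto simp: p tens_def)
        finally show "w p = (\<Sum>s<N. emb s (\<lambda>i. w (s, i))) p" by simp
      qed
      then have "Q w = (\<Sum>s<N. B s (\<lambda>i. w (s, i)))"
        unfolding B_def using ff.linear_sum[OF Q(1)] by metis
      moreover have "B s (\<lambda>i. w (s, i)) \<in> U" if "s < N" for s
        using w that by (auto simp: tens_def V_def)
      ultimately show ?thesis using fs.subspace_sum[OF U(1), of "{..<N}"] by simp
    qed
    then have "Q ` tens N (V U) \<subseteq> U" by blast
    then have 1: "fs.dim (Q ` tens N (V U)) \<le> fs.dim U"
      by (rule fs.dim_subset_fin_dim[OF fs.fin_dim_subset[OF fdn U(2)]])
    let ?Z = "{c \<in> FS {..<k1}. \<forall>s<N. A s c \<in> V U}"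
    have Zs: "fs.subspace ?Z" by (rule subspace_kron_preimage[OF linA Vs])
    have Zfd: "fs.fin_dim ?Z" by (rule fs.fin_dim_subset[OF fd1]) auto
    have "{w \<in> tens N (V U). Q w = 0} \<subseteq> T ` ?Z"
    proof
      fix w assume w: "w \<in> {w \<in> tens N (V U). Q w = 0}"
      then have "w \<in> R" using Q(3) tens_FS[OF VF] by blast
      then obtain c where c: "c \<in> FS {..<k1}" "w = T c" by (auto simp: R_def)
      then have "c \<in> ?Z" using w Ttens by auto
      then show "w \<in> T ` ?Z" using c by blast
    qed
    then have "fs.dim {w \<in> tens N (V U). Q w = 0} \<le> fs.dim (T ` ?Z)"
      by (rule fs.dim_subset_fin_dim[OF ff.fin_dim_image[OF linT Zfd]])
    also have "\<dots> \<le> fs.dim ?Z" by (rule ff.dim_image_le_fin_dim[OF linT Zs Zfd])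
    finally show ?thesis
      using 1 ff.rank_nullity[OF Q(1) subspace_tens[OF Vs] fdV] dim_tens[OF Vs VF, of N] by simp
  qed
  \<comment> \<open>Stability of \<open>A\<close> can only be tested on proper subspaces, so a
    proper \<open>U\<close> must be shown to have a proper preimage.\<close>
  have full: "U = FS {..<n}" if U: "fs.subspace U" "U \<subseteq> FS {..<n}" "V U = FS {..<k}" for U
  proof -
    have "{c \<in> FS {..<k1}. \<forall>s<N. A s c \<in> V U} = FS {..<k1}" using memA U(3) by auto
    then have "N * k \<le> fs.dim U + k1" using key[OF U(1,2)] U(3) by (simp add: dim_FS)
    then have "n \<le> fs.dim U" using k by simp
    then show ?thesis by (intro fs.subspace_eq_fin_dim[OF fdn U(1,2)]) (simp add: dim_FS)
  qed
  have st: "n * fs.dim (V U) < k * fs.dim U"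
    if U: "fs.subspace U" "U \<subseteq> FS {..<n}" "U \<noteq> FS {..<n}" "V U \<noteq> {0}" for U
  proof -
    have Vs: "fs.subspace (V U)" unfolding V_def by (rule subspace_kron_preimage[OF linB U(1)])
    have VF: "V U \<subseteq> FS {..<k}" by (auto simp: V_def)
    have "k * fs.dim {c \<in> FS {..<k1}. \<forall>s<N. A s c \<in> V U} < k1 * fs.dim (V U)"
      using stA[OF Vs VF U(4)] full[OF U(1,2)] U(3) by blast
    moreover have "k * (N * fs.dim (V U)) \<le> k * fs.dim U + k * fs.dim {c \<in> FS {..<k1}. \<forall>s<N. A s c \<in> V U}"
      using mult_le_mono2[OF key[OF U(1,2)], of k] by (simp add: algebra_simps)
    moreover have "k * (N * fs.dim (V U)) = k1 * fs.dim (V U) + n * fs.dim (V U)"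
      using k(3) by (metis add_mult_distrib mult.assoc mult.commute)
    ultimately show ?thesis by linarith
  qed
  have injB: "c = 0" if c: "c \<in> FS {..<k}" "\<forall>s<N. B s c = 0" for c
  proof (rule ccontr)
    assume "c \<noteq> 0"
    moreover have "c \<in> V {0}" using c by (auto simp: V_def)
    ultimately have V0: "V {0} \<noteq> {0}" by blast
    have ne: "{0} \<noteq> (FS {..<n} :: (nat \<Rightarrow> 'k) set)"
    proof
      assume "{0} = (FS {..<n} :: (nat \<Rightarrow> 'k) set)"
      then have "fs.dim (FS {..<n} :: (nat \<Rightarrow> 'k) set) = 0" using fs.dim_zero_set by metis
      then show False using k(2) by (simp add: dim_FS)
    qed
    have "{0} \<subseteq> (FS {..<n} :: (nat \<Rightarrow> 'k) set)"
      using fs.subspace_0[OF subspace_FS] by blast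
    then have "n * fs.dim (V {0}) < k * fs.dim {0 :: nat \<Rightarrow> 'k}"
      by (rule st[OF fs.subspace_single_0 _ ne V0])
    then show False by (simp add: fs.dim_zero_set)
  qed
  have st': "n * fs.dim {c \<in> FS {..<k}. \<forall>s<N. B s c \<in> U} < k * fs.dim U"
    if U: "fs.subspace U" "U \<subseteq> FS {..<n}" "U \<noteq> {0}" "U \<noteq> FS {..<n}" for U
  proof (cases "V U = {0}")
    case True
    have "fs.dim U \<noteq> 0"
      using fs.fin_dim_dim_0[OF fs.fin_dim_subset[OF fdn U(2)]] U(3) fs.subspace_0[OF U(1)] by blast
    then show ?thesis using True k by (simp add: V_def fs.dim_zero_set)
  next
    case False
    then show ?thesis using st[OF U(1,2,4)] by (simp add: V_def)
  qed
  show ?thesis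
    unfolding kron_stable_def using linB memB injB st' by (intro exI[of _ B]) blast
qed

text \<open>The substitution of ((a + 1)k - n, k) for (k, n) preserves the Tits form, so the
  induction on \<open>n\<close> keeps the numerical hypothesis and ends at k = 0, n = 1 or in the
  range of the interval modules. The last hypothesis excludes the vectors (k, k) for a = 1, which
  the reflection fixes and on which the descent would stall.\<close>

lemma kron_stable_exists:
  assumes "1 \<le> a" "k \<le> n" "0 < n" "k\<^sup>2 + n\<^sup>2 \<le> (a + 1) * k * n + 1" "k = n \<Longrightarrow> 2 \<le> a"
  shows "\<exists>A :: nat \<Rightarrow> (nat \<Rightarrow> 'k::field) \<Rightarrow> nat \<Rightarrow> 'k. kron_stable (a + 1) k n A"
  using assms(2-5)
proof (induction n arbitrary: k rule: less_induct)
  case (less n)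
  consider "k = 0" | "0 < k" "n < a * k" | "0 < k" "a * k \<le> n" by linarith
  then show ?case
  proof cases
    case 1
    then have "n\<^sup>2 \<le> 1" using less by simp
    then have n: "n = 1" using power2_nat_le_imp_le[of n 1] less.prems by simp
    let ?A = "\<lambda>_ _. 0 :: nat \<Rightarrow> 'k"
    have fd: "fs.fin_dim (FS {..<1::nat} :: (nat \<Rightarrow> 'k) set)" by (simp add: dim_FS)
    have "U = {0} \<or> U = FS {..<1}" if U: "fs.subspace U" "U \<subseteq> FS {..<1}" for U :: "(nat \<Rightarrow> 'k) set"
    proof (cases "fs.dim U = 0")
      case True
      then show ?thesis
        using fs.fin_dim_dim_0[OF fs.fin_dim_subset[OF fd U(2)]] fs.subspace_0[OF U(1)] by blast
    next
      case False
      have "fs.dim (FS {..<1::nat} :: (nat \<Rightarrow> 'k) set) = 1" by (simp add: dim_FS)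
      then show ?thesis using False fs.subspace_eq_fin_dim[OF fd U] by simp
    qed
    moreover have "Vector_Spaces.linear fscale fscale (?A s)" for s
      by (rule ff.linear_intro) (auto simp: fun_eq_iff vec_apply)
    moreover have "c = 0" if "c \<in> FS {..<0}" for c :: "nat \<Rightarrow> 'k"
      using that by (auto simp: FS_def fun_eq_iff vec_apply)
    moreover have "0 \<in> (FS {..<1::nat} :: (nat \<Rightarrow> 'k) set)" by (rule fs.subspace_0[OF subspace_FS])
    ultimately have "kron_stable (a + 1) k n ?A"
      unfolding kron_stable_def 1 n by blast
    then show ?thesis by blast
  next
    case 2
    then show ?thesis using kron_stable_intervals[of k n "a + 1"] less.prems by simp
  next
    case 3
    have kn: "k < n"
    proof (rule ccontr)
      assume "\<not> k < n"
      then have eq: "k = n" using less.prems by simp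
      then have "2 * k \<le> a * k" using less.prems(4) by simp
      then show False using 3 eq by simp
    qed
    have nle: "n \<le> (a + 1) * k"
    proof (rule ccontr)
      assume "\<not> n \<le> (a + 1) * k"
      then have "(a + 1) * k * n + n \<le> n * n" using mult_le_mono1[of "(a + 1) * k + 1" n n] by simp
      then have "k\<^sup>2 + n \<le> 1" using less.prems(3) by (simp add: power2_eq_square)
      then show False using 3 kn by simp
    qed
    define k1 where "k1 = (a + 1) * k - n"
    have k1: "k1 + n = (a + 1) * k" using nle by (simp add: k1_def)
    have k1k: "k1 \<le> k" using 3 by (simp add: k1_def)
    have "k1\<^sup>2 + k\<^sup>2 \<le> (a + 1) * k1 * k + 1"
    proof -
      \<comment> \<open>Substituting this expression for n shows the invariance of the Tits form; it
        is done over the integers because of the subtraction.\<close>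
      have e: "int n = (int a + 1) * int k - int k1" using k1 by (metis add_diff_cancel_left' add.commute of_nat_add of_nat_mult of_nat_1)
      have "(int k)\<^sup>2 + (int n)\<^sup>2 \<le> (int a + 1) * int k * int n + 1"
        using less.prems(3) by (metis (mono_tags) of_nat_1 of_nat_add of_nat_le_iff of_nat_mult of_nat_power)
      then have "(int k1)\<^sup>2 + (int k)\<^sup>2 \<le> (int a + 1) * int k1 * int k + 1"
        unfolding e by (simp add: power2_eq_square algebra_simps)
      then show ?thesis
        by (metis (mono_tags) of_nat_1 of_nat_add of_nat_le_iff of_nat_mult of_nat_power)
    qed
    moreover have "2 \<le> a" if "k1 = k"
    proof -
      have "n = a * k" using k1 that by simp
      then show ?thesis using kn by (cases a) (auto simp: Suc_le_eq)
    qed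
    ultimately obtain A :: "nat \<Rightarrow> (nat \<Rightarrow> 'k) \<Rightarrow> nat \<Rightarrow> 'k" where "kron_stable (a + 1) k1 k A"
      using less.IH[OF kn k1k] 3 by blast
    then show ?thesis using kron_stable_reflect[OF _ _ _ k1] 3 less.prems by blast
  qed
qed

section \<open>Endomorphisms of a stable module and the bound on the Tits form\<close>

lemma exists_kernel_vector:
  assumes f: "Vector_Spaces.linear fscale fscale (f :: ('i \<Rightarrow> 'k::field) \<Rightarrow> ('j \<Rightarrow> 'k))"
    and T: "finite T" "finite T'" "card T' < card T" and im: "f ` FS T \<subseteq> FS T'"
  obtains w where "w \<in> FS T" "w \<noteq> 0" "f w = 0"
proof -
  have "fs.dim (f ` FS T) \<le> card T'"
    using fs.dim_subset_fin_dim[OF dim_FS(1)[OF T(2)] im] by (simp add: dim_FS T)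
  moreover have "card T = fs.dim {x \<in> FS T. f x = 0} + fs.dim (f ` FS T)"
    using ff.rank_nullity[OF f subspace_FS dim_FS(1)[OF T(1)]] by (simp add: dim_FS T)
  ultimately have "fs.dim {x \<in> FS T. f x = 0} \<noteq> 0" using T by linarith
  then have "{x \<in> FS T. f x = 0} \<noteq> {0}" using fs.dim_zero_set by metis
  moreover have "0 \<in> {x \<in> FS T. f x = 0}"
    using fs.subspace_0[OF subspace_FS] ff.linear_0[OF f] by blast
  ultimately show thesis using that by blast
qed

text \<open>Take a nonzero polynomial p of least degree such that p(f) kills some nonzero v. A root
  l gives p = (X - l)q, and w = q(f)v is nonzero by minimality and satisfies f w = l w.\<close>

lemma exists_eigenvector:
  fixes f :: "(nat \<Rightarrow> 'k::field) \<Rightarrow> nat \<Rightarrow> 'k"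
  assumes ac: "alg_closed TYPE('k)" and f: "Vector_Spaces.linear fscale fscale f"
    and im: "\<And>c. c \<in> FS {..<k} \<Longrightarrow> f c \<in> FS {..<k}" and k: "0 < k"
  obtains l c where "c \<in> FS {..<k}" "c \<noteq> 0" "f c = fscale l c"
proof -
  \<comment> \<open>This is p(f)v with an explicit bound \<open>M\<close> on the degree, so that
    sums for polynomials of different degrees can be compared termwise.\<close>
  define ev where "ev M p v = (\<Sum>i\<le>M. fscale (coeff p i) ((f ^^ i) v))" for M :: nat and p v
  have pow_mem: "(f ^^ i) v \<in> FS {..<k}" if "v \<in> FS {..<k}" for i v
    using that im by (induction i) auto
  have ev_mem: "ev M p v \<in> FS {..<k}" if "v \<in> FS {..<k}" for M p v
    unfolding ev_def using pow_mem[OF that]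
    by (auto intro!: fs.subspace_sum[OF subspace_FS] fs.subspace_scale[OF subspace_FS])
  have ev_mult: "ev (Suc M) ([:-l, 1:] * q) v = f (ev M q v) - fscale l (ev M q v)"
    if q: "degree q \<le> M" for M l q v
  proof -
    have "ev (Suc M) ([:-l, 1:] * q) v
        = ev (Suc M) (pCons 0 q) v - fscale l (ev (Suc M) q v)"
      unfolding ev_def fs.scale_sum_right
      by (simp add: fs.scale_left_diff_distrib sum_subtractf mult.commute[of l] del: sum.atMost_Suc)
    also have "ev (Suc M) (pCons 0 q) v = f (ev M q v)"
      unfolding ev_def by (subst sum.atMost_Suc_shift)
        (simp add: ff.linear_sum[OF f] ff.linear_scale[OF f])
    also have "ev (Suc M) q v = ev M q v"
      using q by (simp add: ev_def coeff_eq_0)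
    finally show ?thesis .
  qed
  \<comment> \<open>Polynomial and vector vary together in the minimisation. Some degree is good
    because v, f v, ..., f^k v are k + 1 vectors in k^k.\<close>
  define good where "good d \<longleftrightarrow> (\<exists>p v. p \<noteq> 0 \<and> degree p = d \<and> v \<in> FS {..<k} \<and> v \<noteq> 0 \<and> ev d p v = 0)" for d
  have "\<exists>d. good d"
  proof -
    define v :: "nat \<Rightarrow> 'k" where "v = unitv 0"
    have v: "v \<in> FS {..<k}" "v \<noteq> 0"
      using k unitv_in_FS[of 0 "{..<k}"] by (auto simp: v_def unitv_def fun_eq_iff vec_apply)
    define g where "g c = (\<Sum>i\<le>k. fscale (c i) ((f ^^ i) v))" for c :: "nat \<Rightarrow> 'k"
    have ling: "Vector_Spaces.linear fscale fscale g"
      by (rule ff.linear_intro)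
        (simp_all add: g_def vec_apply fs.scale_left_distrib sum.distrib fs.scale_sum_right del: sum.atMost_Suc)
    have img: "g ` FS {..k} \<subseteq> FS {..<k}"
      unfolding g_def using pow_mem[OF v(1)]
      by (auto intro!: fs.subspace_sum[OF subspace_FS] fs.subspace_scale[OF subspace_FS])
    obtain c where c: "c \<in> FS {..k}" "c \<noteq> 0" "g c = 0"
      by (rule exists_kernel_vector[OF ling _ _ _ img]) auto
    define p where "p = (\<Sum>i\<le>k. monom (c i) i)"
    have cp: "coeff p i = c i" for i
    proof -
      have "coeff p i = (\<Sum>j\<le>k. if i = j then c j else 0)"
        unfolding p_def coeff_sum by (rule sum.cong) auto
      then show ?thesis using c(1) by (auto simp: FS_def)
    qed
    have "p \<noteq> 0" using c(2) cp by (auto simp: fun_eq_iff vec_apply)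
    have dp: "degree p \<le> k" by (rule degree_le) (use c(1) cp in \<open>auto simp: FS_def\<close>)
    have "ev (degree p) p v = ev k p v"
      unfolding ev_def using dp by (intro sum.mono_neutral_left) (auto simp: coeff_eq_0)
    also have "\<dots> = 0" using c(3) by (simp add: ev_def cp g_def)
    finally have "good (degree p)" unfolding good_def using v \<open>p \<noteq> 0\<close> by blast
    then show ?thesis by blast
  qed
  then obtain d where d: "good d" "\<And>d'. good d' \<Longrightarrow> d \<le> d'"
    using LeastI_ex[of good] Least_le[of good] by blast
  obtain p v where p: "p \<noteq> 0" "degree p = d" "v \<in> FS {..<k}" "v \<noteq> 0" "ev d p v = 0"
    using d(1) unfolding good_def by auto
  have "d > 0"
  proof (rule ccontr)
    assume "\<not> d > 0"
    then have "fscale (coeff p 0) v = 0" "coeff p 0 \<noteq> 0"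
      using p by (auto simp: ev_def) (metis leading_coeff_neq_0)
    then show False using p by simp
  qed
  then obtain l where "poly p l = 0" using ac p(2) unfolding alg_closed_def by blast
  then obtain q where q: "p = [:-l, 1:] * q" by (metis dvdE poly_eq_0_iff_dvd)
  have q0: "q \<noteq> 0" using q p by auto
  have dq: "d = Suc (degree q)" using p(2) q0 unfolding q by (subst (asm) degree_mult_eq) auto
  define w where "w = ev (degree q) q v"
  have w0: "w \<noteq> 0"
  proof
    assume "w = 0"
    then have "good (degree q)" unfolding good_def w_def using p q0 by blast
    then have "d \<le> degree q" by (rule d(2))
    then show False using dq by simp
  qed
  have "f w = fscale l w"
    using p(5) ev_mult[of q "degree q" l v] unfolding dq q w_def by simp
  moreover have "w \<in> FS {..<k}" unfolding w_def by (rule ev_mem[OF p(3)])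
  ultimately show thesis using that w0 by blast
qed

text \<open>Schur's lemma. Subtracting an eigenvalue of \<open>X\<close> gives an endomorphism with
  nonzero kernel. Were that kernel proper on the target, the kernel and the image would both satisfy
  the strict inequality; the sum contradicts rank-nullity.\<close>

lemma kron_stable_endomorphism_scalar:
  fixes A :: "nat \<Rightarrow> (nat \<Rightarrow> 'k::field) \<Rightarrow> nat \<Rightarrow> 'k"
  assumes ac: "alg_closed TYPE('k)" and A: "kron_stable N k n A" and k: "0 < k"
    and X: "Vector_Spaces.linear fscale fscale X" "\<And>c. c \<in> FS {..<k} \<Longrightarrow> X c \<in> FS {..<k}"
    and Y: "Vector_Spaces.linear fscale fscale Y" "\<And>u. u \<in> FS {..<n} \<Longrightarrow> Y u \<in> FS {..<n}"
    and XY: "\<And>s c. s < N \<Longrightarrow> c \<in> FS {..<k} \<Longrightarrow> Y (A s c) = A s (X c)"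
  obtains l where "\<And>c. c \<in> FS {..<k} \<Longrightarrow> X c = fscale l c" "\<And>u. u \<in> FS {..<n} \<Longrightarrow> Y u = fscale l u"
proof -
  have linA: "Vector_Spaces.linear fscale fscale (A s)" for s
    using A by (simp add: kron_stable_def)
  have memA: "A s c \<in> FS {..<n}" if "s < N" "c \<in> FS {..<k}" for s c
    using A that by (simp add: kron_stable_def)
  have injA: "c = 0" if "c \<in> FS {..<k}" "\<And>s. s < N \<Longrightarrow> A s c = 0" for c
    using A that by (simp add: kron_stable_def)
  have stA: "n * fs.dim {c \<in> FS {..<k}. \<forall>s<N. A s c \<in> U} < k * fs.dim U"
    if "fs.subspace U" "U \<subseteq> FS {..<n}" "U \<noteq> {0}" "U \<noteq> FS {..<n}" for U
    using A that unfolding kron_stable_def by blast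
  obtain l c0 where c0: "c0 \<in> FS {..<k}" "c0 \<noteq> 0" "X c0 = fscale l c0"
    using exists_eigenvector[OF ac X k] by metis
  define X' where "X' c = X c - fscale l c" for c
  define Y' where "Y' u = Y u - fscale l u" for u
  have linX': "Vector_Spaces.linear fscale fscale X'"
    by (rule ff.linear_intro)
      (simp_all add: X'_def ff.linear_add[OF X(1)] ff.linear_scale[OF X(1)]
        fs.scale_right_distrib fs.scale_right_diff_distrib mult.commute)
  have linY': "Vector_Spaces.linear fscale fscale Y'"
    by (rule ff.linear_intro)
      (simp_all add: Y'_def ff.linear_add[OF Y(1)] ff.linear_scale[OF Y(1)]
        fs.scale_right_distrib fs.scale_right_diff_distrib mult.commute)
  have memX': "X' c \<in> FS {..<k}" if "c \<in> FS {..<k}" for c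
    unfolding X'_def using that X(2)
    by (intro fs.subspace_diff[OF subspace_FS] fs.subspace_scale[OF subspace_FS])
  have memY': "Y' c \<in> FS {..<n}" if "c \<in> FS {..<n}" for c
    unfolding Y'_def using that Y(2)
    by (intro fs.subspace_diff[OF subspace_FS] fs.subspace_scale[OF subspace_FS])
  have XY': "Y' (A s c) = A s (X' c)" if "s < N" "c \<in> FS {..<k}" for s c
    unfolding X'_def Y'_def using XY[OF that]
    by (simp add: ff.linear_diff[OF linA] ff.linear_scale[OF linA])
  have fdk: "fs.fin_dim (FS {..<k} :: (nat \<Rightarrow> 'k) set)" by (simp add: dim_FS)
  have fdn: "fs.fin_dim (FS {..<n} :: (nat \<Rightarrow> 'k) set)" by (simp add: dim_FS)
  define KX where "KX = {c \<in> FS {..<k}. X' c = 0}"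
  define KY where "KY = {c \<in> FS {..<n}. Y' c = 0}"
  have rX: "k = fs.dim KX + fs.dim (X' ` FS {..<k})"
    using ff.rank_nullity[OF linX' subspace_FS fdk] by (simp add: dim_FS KX_def)
  have rY: "n = fs.dim KY + fs.dim (Y' ` FS {..<n})"
    using ff.rank_nullity[OF linY' subspace_FS fdn] by (simp add: dim_FS KY_def)
  have c0K: "c0 \<in> KX" using c0 by (simp add: KX_def X'_def)
  have AK: "A s c \<in> KY" if "s < N" "c \<in> KX" for s c
    using that memA XY' ff.linear_0[OF linA] by (auto simp: KX_def KY_def)
  have le: "n * fs.dim S < k * fs.dim U"
    if "S \<subseteq> FS {..<k}" "\<And>s c. s < N \<Longrightarrow> c \<in> S \<Longrightarrow> A s c \<in> U"
      "fs.subspace U" "U \<subseteq> FS {..<n}" "U \<noteq> {0}" "U \<noteq> FS {..<n}" for S U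
  proof -
    have "S \<subseteq> {c \<in> FS {..<k}. \<forall>s<N. A s c \<in> U}" using that by auto
    then have "fs.dim S \<le> fs.dim {c \<in> FS {..<k}. \<forall>s<N. A s c \<in> U}"
      by (rule fs.dim_subset_fin_dim[rotated]) (rule fs.fin_dim_subset[OF fdk], auto)
    then have "n * fs.dim S \<le> n * fs.dim {c \<in> FS {..<k}. \<forall>s<N. A s c \<in> U}" by simp
    also have "\<dots> < k * fs.dim U" by (rule stA[OF that(3-6)])
    finally show ?thesis .
  qed
  have KY0: "KY \<noteq> {0}"
  proof
    assume "KY = {0}"
    then have "A s c0 = 0" if "s < N" for s using AK[OF that c0K] by simp
    then show False using injA[OF c0(1)] c0(2) by simp
  qed
  \<comment> \<open>Both \<open>KY\<close> and the image of \<open>Y'\<close> would be proper and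
    nonzero. The two strict inequalities add up to n k < k n.\<close>
  have KY: "KY = FS {..<n}"
  proof (rule ccontr)
    assume neq: "KY \<noteq> FS {..<n}"
    have sK: "fs.subspace KY"
      using fs.subspace_inter[OF subspace_FS ff.linear_subspace_kernel[OF linY']]
      by (simp add: KY_def Collect_conj_eq)
    have KYF: "KY \<subseteq> FS {..<n}" by (auto simp: KY_def)
    have 1: "n * fs.dim KX < k * fs.dim KY"
      by (rule le[OF _ AK sK KYF KY0 neq]) (auto simp: KX_def)
    let ?I = "Y' ` FS {..<n}"
    have "fs.dim (FS {..<n} :: (nat \<Rightarrow> 'k) set) = n" by (simp add: dim_FS)
    then have dK: "fs.dim KY < n"
      using fs.subspace_eq_fin_dim[OF fdn sK KYF] neq by linarith
    have dK0: "fs.dim KY \<noteq> 0"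
      using fs.fin_dim_dim_0[OF fs.fin_dim_subset[OF fdn KYF]] KY0 fs.subspace_0[OF sK] by blast
    have I0: "?I \<noteq> {0}"
    proof
      assume "?I = {0}"
      then have "fs.dim ?I = 0" by (simp add: fs.dim_zero_set)
      then show False using rY dK by simp
    qed
    have In: "?I \<noteq> FS {..<n}"
    proof
      assume "?I = FS {..<n}"
      then have "fs.dim ?I = n" by (simp add: dim_FS)
      then show False using rY dK0 by simp
    qed
    have "n * fs.dim (X' ` FS {..<k}) < k * fs.dim ?I"
    proof (rule le[OF _ _ ff.linear_subspace_image[OF linY' subspace_FS] _ I0 In])
      show "X' ` FS {..<k} \<subseteq> FS {..<k}" using memX' by blast
      show "?I \<subseteq> FS {..<n}" using memY' by blast
      show "A s c \<in> ?I" if h: "s < N" "c \<in> X' ` FS {..<k}" for s c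
      proof -
        obtain c' where c': "c = X' c'" "c' \<in> FS {..<k}" using h(2) by blast
        then have "A s c = Y' (A s c')" using XY'[OF h(1)] by simp
        then show ?thesis using memA[OF h(1) c'(2)] by blast
      qed
    qed
    then have "n * (fs.dim KX + fs.dim (X' ` FS {..<k})) < k * (fs.dim KY + fs.dim ?I)"
      using 1 by (simp add: distrib_left)
    then show False using rX rY by simp
  qed
  have X0: "X' c = 0" if c: "c \<in> FS {..<k}" for c
  proof (rule injA[OF memX'[OF c]])
    fix s assume s: "s < N"
    have "A s c \<in> KY" using memA[OF s c] KY by simp
    then show "A s (X' c) = 0" using XY'[OF s c] by (simp add: KY_def)
  qed
  show thesis
  proof
    show "X c = fscale l c" if "c \<in> FS {..<k}" for c using X0[OF that] by (simp add: X'_def)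
    show "Y u = fscale l u" if "u \<in> FS {..<n}" for u
    proof -
      have "u \<in> KY" using that KY by simp
      then show ?thesis by (simp add: KY_def Y'_def)
    qed
  qed
qed

text \<open>A pair of matrices has k^2 + n^2 entries; commuting with all arrows imposes Nkn linear
  equations, and one more equation makes the corner entry of \<open>X\<close> vanish. With too few
  equations there would be a nonzero solution, but it is a scalar whose corner entry is 0.\<close>

lemma kron_stable_dimension_bound:
  fixes A :: "nat \<Rightarrow> (nat \<Rightarrow> 'k::field) \<Rightarrow> nat \<Rightarrow> 'k"
  assumes ac: "alg_closed TYPE('k)" and A: "kron_stable N k n A" and k: "0 < k"
  shows "k\<^sup>2 + n\<^sup>2 \<le> N * k * n + 1"
proof (rule ccontr)
  assume "\<not> ?thesis"
  then have big: "N * k * n + 1 < k\<^sup>2 + n\<^sup>2" by simp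
  have linA: "Vector_Spaces.linear fscale fscale (A s)" for s
    using A by (simp add: kron_stable_def)
  have memA: "A s c \<in> FS {..<n}" if "s < N" "c \<in> FS {..<k}" for s c
    using A that by (simp add: kron_stable_def)
  define X where "X z c = (\<lambda>i. \<Sum>j<k. c j * z (Inl (j, i)))"
    for z :: "nat \<times> nat + nat \<times> nat \<Rightarrow> 'k" and c
  define Y where "Y z u = (\<lambda>i. \<Sum>j<n. u j * z (Inr (j, i)))"
    for z :: "nat \<times> nat + nat \<times> nat \<Rightarrow> 'k" and u
  define T :: "(nat \<times> nat + nat \<times> nat) set"
    where "T = ({..<k} \<times> {..<k}) <+> ({..<n} \<times> {..<n})"
  \<comment> \<open>The index \<open>None\<close> carries the normalising equation that rules out
    nonzero scalars.\<close>
  define T' :: "(nat \<times> nat \<times> nat) option set"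
    where "T' = insert None (Some ` ({..<N} \<times> {..<k} \<times> {..<n}))"
  define L :: "(nat \<times> nat + nat \<times> nat \<Rightarrow> 'k) \<Rightarrow> (nat \<times> nat \<times> nat) option \<Rightarrow> 'k" where
    "L z = (\<lambda>t. case t of None \<Rightarrow> z (Inl (0, 0)) | Some (s, j, i) \<Rightarrow>
      if s < N \<and> j < k \<and> i < n then Y z (A s (unitv j)) i - A s (X z (unitv j)) i else 0)" for z
  have Xz: "X (z + z') c = X z c + X z' c" "X (fscale a z) c = fscale a (X z c)" for a z z' c
    by (auto simp: X_def fun_eq_iff vec_apply algebra_simps sum.distrib sum_distrib_left)
  have Yz: "Y (z + z') c = Y z c + Y z' c" "Y (fscale a z) c = fscale a (Y z c)" for a z z' c
    by (auto simp: Y_def fun_eq_iff vec_apply algebra_simps sum.distrib sum_distrib_left)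
  have linX: "Vector_Spaces.linear fscale fscale (X z)" for z
    by (rule ff.linear_intro)
      (auto simp: X_def fun_eq_iff vec_apply algebra_simps sum.distrib sum_distrib_left)
  have linY: "Vector_Spaces.linear fscale fscale (Y z)" for z
    by (rule ff.linear_intro)
      (auto simp: Y_def fun_eq_iff vec_apply algebra_simps sum.distrib sum_distrib_left)
  have linL: "Vector_Spaces.linear fscale fscale L"
    by (rule ff.linear_intro)
      (auto simp: L_def fun_eq_iff vec_apply Xz Yz ff.linear_add[OF linA] ff.linear_scale[OF linA]
        algebra_simps split: option.splits)
  have cT: "card T = k\<^sup>2 + n\<^sup>2"
    by (simp add: T_def card_Plus card_cartesian_product power2_eq_square)
  have cT': "card T' = N * k * n + 1"
    by (simp add: T'_def card_image card_cartesian_product)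
  have "L ` FS T \<subseteq> FS T'"
    by (auto simp: L_def FS_def T'_def split: option.splits)
  then obtain z where z: "z \<in> FS T" "z \<noteq> 0" "L z = 0"
    using exists_kernel_vector[OF linL, of T T'] big cT cT' by (auto simp: T_def T'_def)
  have z0: "z (Inl (j, i)) = 0" if "j \<ge> k \<or> i \<ge> k" for i j
  proof -
    have "Inl (j, i) \<notin> T" using that by (auto simp: T_def)
    then show ?thesis using z(1) by (simp add: FS_def)
  qed
  have z1: "z (Inr (j, i)) = 0" if "j \<ge> n \<or> i \<ge> n" for i j
  proof -
    have "Inr (j, i) \<notin> T" using that by (auto simp: T_def)
    then show ?thesis using z(1) by (simp add: FS_def)
  qed
  have memX: "X z c \<in> FS {..<k}" for c by (auto simp: X_def FS_def z0)
  have memY: "Y z c \<in> FS {..<n}" for c by (auto simp: Y_def FS_def z1)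
  have unit: "Y z (A s (unitv j)) = A s (X z (unitv j))" if "s < N" "j < k" for s j
  proof
    fix i
    show "Y z (A s (unitv j)) i = A s (X z (unitv j)) i"
    proof (cases "i < n")
      case True
      have "L z (Some (s, j, i)) = 0" using z(3) by (simp add: vec_apply)
      then show ?thesis using True that by (simp add: L_def)
    next
      case False
      then show ?thesis using memY memA[OF that(1) memX] by (auto simp: FS_def)
    qed
  qed
  have XY: "Y z (A s c) = A s (X z c)" if "s < N" "c \<in> FS {..<k}" for s c
  proof -
    have e: "c = (\<Sum>i<k. fscale (c i) (unitv i))" by (rule FS_expand[OF _ that(2)]) simp
    show ?thesis
      by (subst (1 2) e) (simp add: ff.linear_sum[OF linA] ff.linear_scale[OF linA] ff.linear_sum[OF linX]
        ff.linear_scale[OF linX] ff.linear_sum[OF linY] ff.linear_scale[OF linY] unit that(1))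
  qed
  obtain l where l: "\<And>c. c \<in> FS {..<k} \<Longrightarrow> X z c = fscale l c" "\<And>u. u \<in> FS {..<n} \<Longrightarrow> Y z u = fscale l u"
    using kron_stable_endomorphism_scalar[OF ac A k linX memX linY memY XY] by metis
  have Xu: "X z (unitv j) i = z (Inl (j, i))" if "j < k" for i j
  proof -
    have "X z (unitv j) i = (\<Sum>j'<k. if j' = j then z (Inl (j', i)) else 0)"
      unfolding X_def unitv_def by (rule sum.cong) auto
    then show ?thesis using that by simp
  qed
  have Yu: "Y z (unitv j) i = z (Inr (j, i))" if "j < n" for i j
  proof -
    have "Y z (unitv j) i = (\<Sum>j'<n. if j' = j then z (Inr (j', i)) else 0)"
      unfolding Y_def unitv_def by (rule sum.cong) auto
    then show ?thesis using that by simp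
  qed
  have "L z None = 0" using z(3) by (simp add: vec_apply)
  then have "z (Inl (0, 0)) = 0" by (simp add: L_def)
  moreover have "X z (unitv 0) 0 = l"
  proof -
    have "X z (unitv 0) = fscale l (unitv 0)" using l(1) k unitv_in_FS[of 0 "{..<k}"] by simp
    then show ?thesis by (simp add: vec_apply) (simp add: unitv_def)
  qed
  ultimately have l0: "l = 0" using Xu[of 0 0] k by simp
  have "z t = 0" for t
  proof (cases t)
    case (Inl p)
    obtain j i where p: "p = (j, i)" by force
    show ?thesis
    proof (cases "j < k")
      case True
      then have "X z (unitv j) = 0" using l(1) l0 unitv_in_FS[of j "{..<k}"] by simp
      then show ?thesis using Xu[OF True, of i] Inl p by (simp add: vec_apply)
    qed (simp add: Inl p z0)
  next
    case (Inr p)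
    obtain j i where p: "p = (j, i)" by force
    show ?thesis
    proof (cases "j < n")
      case True
      then have "Y z (unitv j) = 0" using l(2) l0 unitv_in_FS[of j "{..<n}"] by simp
      then show ?thesis using Yu[OF True, of i] Inr p by (simp add: vec_apply)
    qed (simp add: Inr p z1)
  qed
  then show False using z(2) by (auto simp: fun_eq_iff vec_apply)
qed

section \<open>The two lattices of a bundle\<close>

definition tt :: "'k::field rf" where "tt = to_fract (monom 1 1)"

lemma tt_neq_0 [simp]: "tt \<noteq> 0"
  by (simp add: tt_def monom_eq_0_iff)

lemma to_fract_monom: "to_fract (monom 1 m) = tt ^ m"
proof (induction m)
  case (Suc m)
  have "monom (1::'a) (Suc m) = monom 1 1 * monom 1 m" by (simp add: mult_monom)
  then show ?case using Suc by (simp add: tt_def del: One_nat_def)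
qed (simp add: monom_eq_1)

lemma tpow_eq: "tpow m = tt ^ m"
  by (simp add: tpow_def to_fract_monom[symmetric] to_fract_def)

lemma in_kt_iff: "in_kt x \<longleftrightarrow> (\<exists>p. x = to_fract p)"
  by (simp add: in_kt_def to_fract_def)

lemma in_kinvt_iff: "in_kinvt x \<longleftrightarrow> (\<exists>p m. degree p \<le> m \<and> x * tt ^ m = to_fract p)"
  unfolding in_kinvt_def Fract_conv_to_fract to_fract_monom
  by (simp add: eq_divide_eq)

lemma in_kinvt_add:
  assumes "in_kinvt x" "in_kinvt y"
  shows "in_kinvt (x + y)"
proof -
  obtain p l where p: "degree p \<le> l" "x * tt ^ l = to_fract p" using assms by (auto simp: in_kinvt_iff)
  obtain q m where q: "degree q \<le> m" "y * tt ^ m = to_fract q" using assms by (auto simp: in_kinvt_iff)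
  have "(x + y) * tt ^ (l + m) = (x * tt ^ l) * tt ^ m + (y * tt ^ m) * tt ^ l"
    by (simp add: power_add algebra_simps)
  also have "\<dots> = to_fract (p * monom 1 m + q * monom 1 l)"
    by (simp add: p q to_fract_monom)
  finally have "(x + y) * tt ^ (l + m) = to_fract (p * monom 1 m + q * monom 1 l)" .
  moreover have "degree (p * monom 1 m) \<le> l + m" "degree (q * monom 1 l) \<le> l + m"
    using degree_mult_le[of p "monom 1 m"] degree_mult_le[of q "monom 1 l"]
      degree_monom_le[of "1::'a" m] degree_monom_le[of "1::'a" l] p q by linarith+
  then have "degree (p * monom 1 m + q * monom 1 l) \<le> l + m" by (rule degree_add_le)
  ultimately show ?thesis unfolding in_kinvt_iff by blast
qed

lemma in_kinvt_mult:
  assumes "in_kinvt x" "in_kinvt y"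
  shows "in_kinvt (x * y)"
proof -
  obtain p l where p: "degree p \<le> l" "x * tt ^ l = to_fract p" using assms by (auto simp: in_kinvt_iff)
  obtain q m where q: "degree q \<le> m" "y * tt ^ m = to_fract q" using assms by (auto simp: in_kinvt_iff)
  have "(x * y) * tt ^ (l + m) = (x * tt ^ l) * (y * tt ^ m)"
    by (simp add: power_add algebra_simps)
  then have "(x * y) * tt ^ (l + m) = to_fract (p * q)" by (simp add: p q)
  moreover have "degree (p * q) \<le> l + m" using degree_mult_le[of p q] p q by linarith
  ultimately show ?thesis unfolding in_kinvt_iff by blast
qed

lemma in_kinvt_const: "in_kinvt (const_rf c)"
  unfolding in_kinvt_iff const_rf_to_fract by (intro exI[of _ "[:c:]"] exI[of _ 0]) simp

lemma in_kinvt_inverse_tt: "in_kinvt (inverse tt)"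
  unfolding in_kinvt_iff by (intro exI[of _ 1] exI[of _ 1]) simp

lemma in_kinvt_0: "in_kinvt 0"
  unfolding in_kinvt_iff by (intro exI[of _ 0] exI[of _ 0]) simp

text \<open>\<open>Om m x\<close> says that \<open>x\<close> lies in \<open>t^m k[1/t]\<close>.\<close>

definition Om :: "int \<Rightarrow> 'k::field rf \<Rightarrow> bool" where
  "Om m x \<longleftrightarrow> in_kinvt (x / tt powi m)"

lemma Om_0: "Om m 0"
  by (simp add: Om_def in_kinvt_0)

lemma Om_add: "Om m x \<Longrightarrow> Om m y \<Longrightarrow> Om m (x + y)"
  by (simp add: Om_def in_kinvt_add add_divide_distrib)

lemma Om_const_mult:
  assumes "Om m x"
  shows "Om m (const_rf c * x)"
proof -
  have "in_kinvt (const_rf c * (x / tt powi m))"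
    using assms in_kinvt_mult[OF in_kinvt_const] unfolding Om_def by blast
  then show ?thesis by (simp add: Om_def)
qed

lemma Om_tt: "Om (m + 1) (tt * x) \<longleftrightarrow> Om m x"
  by (simp add: Om_def power_int_add)

lemma Om_step: "Om m x \<Longrightarrow> Om (m + 1) x"
  using in_kinvt_mult[OF in_kinvt_inverse_tt, of "x / tt powi m"]
  by (simp add: Om_def power_int_add field_simps)

lemma Om_mono:
  assumes "Om m x" "m \<le> m'"
  shows "Om m' x"
proof -
  have "Om (m + int l) x" for l
  proof (induction l)
    case (Suc l)
    then show ?case using Om_step[of "m + int l" x] by (simp add: algebra_simps)
  qed (simp add: assms)
  from this[of "nat (m' - m)"] show ?thesis using assms(2) by simp
qed

lemma Om_power: "Om (m + int l) (tt ^ l * x) \<longleftrightarrow> Om m x"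
  by (simp add: Om_def power_int_add)

lemma Om_poly_mult:
  assumes "Om m x" "degree p \<le> l"
  shows "Om (m + int l) (to_fract p * x)"
proof -
  have 1: "in_kinvt (to_fract p * inverse tt ^ l)"
    unfolding in_kinvt_iff using assms(2)
    by (intro exI[of _ p] exI[of _ l]) (simp add: mult.assoc flip: power_mult_distrib)
  have "in_kinvt ((to_fract p * inverse tt ^ l) * (x / tt powi m))"
    using assms(1) in_kinvt_mult[OF 1] unfolding Om_def by blast
  then show ?thesis
    by (simp add: Om_def power_int_add field_simps)
qed

lemma Om_poly:
  assumes "degree p \<le> l"
  shows "Om (int l) (to_fract p)"
proof -
  have "Om 0 (1 :: 'a rf)" using in_kinvt_const[of 1] by (simp add: Om_def const_rf_to_fract flip: one_pCons)
  from Om_poly_mult[OF this assms] show ?thesis by simp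
qed

text \<open>A bound on the order of the pole at infinity alone. Unlike \<open>Om\<close> it allows
  poles anywhere else, as it must for the entries of the change of basis between the two
  frames.\<close>

definition degle :: "'k::field rf \<Rightarrow> int \<Rightarrow> bool" where
  "degle x d \<longleftrightarrow> (\<exists>p q. q \<noteq> 0 \<and> x * to_fract q = to_fract p \<and> (p = 0 \<or> int (degree p) \<le> int (degree q) + d))"

lemma rf_cases:
  obtains p q where "q \<noteq> 0" "x * to_fract q = to_fract p"
proof -
  obtain p q where "x = Fract p q" "q \<noteq> 0" by (cases x) auto
  then show thesis using that[of q p] by (simp add: Fract_conv_to_fract)
qed

lemma degle_exists: "\<exists>d. degle x d"
proof -
  obtain p q where "q \<noteq> 0" "x * to_fract q = to_fract p" by (rule rf_cases)
  then show ?thesis unfolding degle_def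
    by (intro exI[of _ "int (degree p)"] exI[of _ p] exI[of _ q]) auto
qed

lemma degle_mono:
  assumes "degle x d" "d \<le> d'"
  shows "degle x d'"
proof -
  obtain p q where "q \<noteq> 0" "x * to_fract q = to_fract p" "p = 0 \<or> int (degree p) \<le> int (degree q) + d"
    using assms by (auto simp: degle_def)
  then show ?thesis unfolding degle_def using assms(2) by (intro exI[of _ p] exI[of _ q]) auto
qed

lemma degle_0: "degle 0 d"
  unfolding degle_def by (intro exI[of _ 0] exI[of _ 1]) auto

lemma degle_add:
  assumes "degle x d" "degle y d"
  shows "degle (x + y) d"
proof -
  obtain p q where p: "q \<noteq> 0" "x * to_fract q = to_fract p" "p = 0 \<or> int (degree p) \<le> int (degree q) + d"
    using assms by (auto simp: degle_def)
  obtain p' q' where p': "q' \<noteq> 0" "y * to_fract q' = to_fract p'" "p' = 0 \<or> int (degree p') \<le> int (degree q') + d"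
    using assms by (auto simp: degle_def)
  have "(x + y) * to_fract (q * q') = (x * to_fract q) * to_fract q' + (y * to_fract q') * to_fract q"
    by (simp add: algebra_simps)
  then have e: "(x + y) * to_fract (q * q') = to_fract (p * q' + p' * q)" by (simp add: p p')
  have 1: "p * q' = 0 \<or> int (degree (p * q')) \<le> int (degree (q * q')) + d"
    using p p' by (cases "p = 0") (auto simp: degree_mult_eq)
  have 2: "p' * q = 0 \<or> int (degree (p' * q)) \<le> int (degree (q * q')) + d"
    using p p' by (cases "p' = 0") (auto simp: degree_mult_eq)
  have "p * q' + p' * q = 0 \<or> int (degree (p * q' + p' * q)) \<le> int (degree (q * q')) + d"
    using 1 2 degree_add_le_max[of "p * q'" "p' * q"] by (cases "p * q' = 0"; cases "p' * q = 0") auto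
  moreover have "q * q' \<noteq> 0" using p(1) p'(1) by simp
  ultimately show ?thesis unfolding degle_def using e by blast
qed

lemma degle_mult:
  assumes "degle x d" "degle y d'"
  shows "degle (x * y) (d + d')"
proof -
  obtain p q where p: "q \<noteq> 0" "x * to_fract q = to_fract p" "p = 0 \<or> int (degree p) \<le> int (degree q) + d"
    using assms by (auto simp: degle_def)
  obtain p' q' where p': "q' \<noteq> 0" "y * to_fract q' = to_fract p'" "p' = 0 \<or> int (degree p') \<le> int (degree q') + d'"
    using assms by (auto simp: degle_def)
  have "(x * y) * to_fract (q * q') = (x * to_fract q) * (y * to_fract q')"
    by (simp add: algebra_simps)
  then have e: "(x * y) * to_fract (q * q') = to_fract (p * p')" by (simp add: p p')
  have "p * p' = 0 \<or> int (degree (p * p')) \<le> int (degree (q * q')) + (d + d')"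
    using p p' by (cases "p = 0"; cases "p' = 0") (auto simp: degree_mult_eq)
  moreover have "q * q' \<noteq> 0" using p(1) p'(1) by simp
  ultimately show ?thesis unfolding degle_def using e by blast
qed

lemma degle_sum: "(\<And>j. j \<in> A \<Longrightarrow> degle (f j) d) \<Longrightarrow> degle (\<Sum>j\<in>A. f j) d"
  by (induction A rule: infinite_finite_induct) (auto simp: degle_0 degle_add)

lemma degle_to_fract:
  assumes "degle (to_fract p) d"
  shows "p = 0 \<or> int (degree p) \<le> d"
proof -
  obtain g q where g: "q \<noteq> 0" "to_fract p * to_fract q = to_fract g" "g = 0 \<or> int (degree g) \<le> int (degree q) + d"
    using assms by (auto simp: degle_def)
  then have "p * q = g" by (metis to_fract_eq_iff to_fract_mult)
  then show ?thesis using g by (cases "p = 0") (auto simp: degree_mult_eq)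
qed

lemma Om_degle:
  assumes "Om m x"
  shows "degle x m"
proof -
  have tp: "degle (tt powi m) m"
  proof (cases "m \<ge> 0")
    case True
    then show ?thesis
      unfolding degle_def
      by (intro exI[of _ "monom 1 (nat m)"] exI[of _ 1])
        (auto simp: to_fract_monom power_int_def degree_monom_eq)
  next
    case False
    then show ?thesis
      unfolding degle_def
      by (intro exI[of _ 1] exI[of _ "monom 1 (nat (- m))"])
        (auto simp: to_fract_monom power_int_def degree_monom_eq monom_eq_0_iff simp flip: power_mult_distrib)
  qed
  have "degle (x / tt powi m) 0"
  proof -
    obtain p l where "degree p \<le> l" "x / tt powi m * tt ^ l = to_fract p"
      using assms by (auto simp: in_kinvt_iff Om_def)
    then show ?thesis unfolding degle_def
      by (intro exI[of _ p] exI[of _ "monom 1 l"])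
        (auto simp: to_fract_monom degree_monom_eq monom_eq_0_iff)
  qed
  from degle_mult[OF tp this] show ?thesis by simp
qed

lemma Om_to_fract: "Om m (to_fract p) \<Longrightarrow> p = 0 \<or> int (degree p) \<le> m"
  using Om_degle degle_to_fract by blast

lemma common_denominator:
  fixes f :: "nat \<Rightarrow> 'k::field rf"
  obtains q g where "q \<noteq> 0" "\<And>j. j < r \<Longrightarrow> f j * to_fract q = to_fract (g j)"
proof -
  have "\<exists>q g. q \<noteq> 0 \<and> (\<forall>j<r. f j * to_fract q = to_fract (g j))"
  proof (induction r)
    case 0
    show ?case by (intro exI[of _ 1]) auto
  next
    case (Suc r)
    then obtain q g where q: "q \<noteq> 0" "\<And>j. j < r \<Longrightarrow> f j * to_fract q = to_fract (g j)" by blast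
    obtain p q' where p: "q' \<noteq> 0" "f r * to_fract q' = to_fract p" by (rule rf_cases)
    define g' where "g' j = (if j = r then p * q else g j * q')" for j
    have "f j * to_fract (q * q') = to_fract (g' j)" if "j < Suc r" for j
    proof (cases "j = r")
      case True
      have "f r * to_fract (q * q') = (f r * to_fract q') * to_fract q" by (simp add: algebra_simps)
      then show ?thesis using True p by (simp add: g'_def)
    next
      case False
      have "f j * to_fract (q * q') = (f j * to_fract q) * to_fract q'" by (simp add: algebra_simps)
      then show ?thesis using False that q by (simp add: g'_def)
    qed
    then show ?case using q(1) p(1) by (intro exI[of _ "q * q'"] exI[of _ g']) auto
  qed
  then show thesis using that by blast
qed

lemma Kcomb_eq: "Kcomb r c b = (\<Sum>j<r. fscale (c j) (b j))"
  by (simp add: Kcomb_def fun_eq_iff sum_fun_apply vec_apply)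

lemma fullspace_eq: "fullspace n = FS {..<n}"
  by (auto simp: fullspace_def supp_lt_def FS_def)

lemma frame_iff: "frame n r b \<longleftrightarrow> (\<forall>j<r. b j \<in> FS {..<n}) \<and> fs.indep_fam r b"
  unfolding frame_def Klin_indep_def fs.indep_fam_def Kcomb_eq supp_lt_def FS_def
  by (auto simp: zero_fun_def)

lemma subspace_Kspan: "fs.subspace (Kspan r b)"
proof (rule fs.subspaceI)
  show "0 \<in> Kspan r b" unfolding Kspan_def Kcomb_eq
    by (auto intro!: exI[of _ "\<lambda>_. 0"])
  show "x + y \<in> Kspan r b" if xy: "x \<in> Kspan r b" "y \<in> Kspan r b" for x y
  proof -
    obtain c d where "x = Kcomb r c b" "y = Kcomb r d b" using xy by (auto simp: Kspan_def)
    then have "x + y = Kcomb r (\<lambda>j. c j + d j) b"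
      by (simp add: Kcomb_eq fs.scale_left_distrib sum.distrib)
    then show ?thesis by (auto simp: Kspan_def)
  qed
  show "fscale a x \<in> Kspan r b" if x: "x \<in> Kspan r b" for a x
  proof -
    obtain c where "x = Kcomb r c b" using x by (auto simp: Kspan_def)
    then have "fscale a x = Kcomb r (\<lambda>j. a * c j) b" by (simp add: Kcomb_eq fs.scale_sum_right)
    then show ?thesis by (auto simp: Kspan_def)
  qed
qed

lemma in_Kspan: "j < r \<Longrightarrow> b j \<in> Kspan r b"
proof -
  assume j: "j < r"
  have "b j = Kcomb r (unitv j) b"
  proof -
    have "(\<Sum>i<r. fscale (unitv j i) (b i)) = (\<Sum>i<r. if i = j then b i else 0)"
      by (rule sum.cong) (auto simp: unitv_def)
    then show ?thesis using j by (simp add: Kcomb_eq)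
  qed
  then show ?thesis by (auto simp: Kspan_def)
qed

lemma frame_Kspan:
  assumes "frame n r b"
  shows "Kspan r b \<subseteq> FS {..<n}" "fs.dim (Kspan r b) = r" "fs.subspace (Kspan r b)"
proof -
  have b: "\<And>j. j < r \<Longrightarrow> b j \<in> FS {..<n}" "fs.indep_fam r b" using assms by (auto simp: frame_iff)
  show "Kspan r b \<subseteq> FS {..<n}"
    using b(1) unfolding Kspan_def Kcomb_eq
    by (auto intro!: fs.subspace_sum[OF subspace_FS] fs.subspace_scale[OF subspace_FS])
  show "fs.dim (Kspan r b) = r"
    by (rule fs.dim_fam(2)[OF b(2) in_Kspan]) (auto simp: Kspan_def Kcomb_eq)
  show "fs.subspace (Kspan r b)" by (rule subspace_Kspan)
qed

lemma frame_expand: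
  assumes "frame n n b" "v \<in> FS {..<n}"
  obtains c where "v = (\<Sum>j<n. fscale (c j) (b j))"
proof -
  have "Kspan n b = FS {..<n}"
    by (rule fs.subspace_eq_fin_dim[OF dim_FS(1) frame_Kspan(3,1)[OF assms(1)]])
      (simp_all add: dim_FS frame_Kspan(2)[OF assms(1)])
  then show thesis using assms(2) that by (auto simp: Kspan_def Kcomb_eq)
qed

section \<open>Twists and degrees of subbundles\<close>

lemma smult_sum_right: "smult c (\<Sum>j\<in>A. f j) = (\<Sum>j\<in>A. smult c (f j))"
  by (induction A rule: infinite_finite_induct) (auto simp: smult_add_right)

text \<open>These are the global sections of O(l)^n.\<close>

definition PV :: "nat \<Rightarrow> nat \<Rightarrow> (nat \<Rightarrow> 'k::field poly) set" where
  "PV n l = {p. (\<forall>i\<ge>n. p i = 0) \<and> (\<forall>i. degree (p i) \<le> l)}"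

lemma subspace_PV: "ps.subspace (PV n l)"
  by (rule ps.subspaceI) (auto simp: PV_def vec_apply intro: degree_add_le order.trans[OF degree_smult_le])

lemma dim_PV:
  shows "ps.fin_dim (PV n l :: (nat \<Rightarrow> 'k::field poly) set)"
    and "ps.dim (PV n l :: (nat \<Rightarrow> 'k poly) set) = n * (l + 1)"
proof -
  define G :: "(nat \<times> nat \<Rightarrow> 'k) \<Rightarrow> nat \<Rightarrow> 'k poly" where
    "G w = (\<lambda>i. \<Sum>s\<le>l. monom (w (i, s)) s)" for w
  let ?T = "{..<n} \<times> {..l}"
  have cG: "coeff (G w i) s = (if s \<le> l then w (i, s) else 0)" for w i s
  proof -
    have "coeff (G w i) s = (\<Sum>s'\<le>l. if s = s' then w (i, s') else 0)"
      unfolding G_def coeff_sum by (rule sum.cong) auto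
    then show ?thesis by simp
  qed
  have lin: "Vector_Spaces.linear fscale pscale G"
    by (rule fp.linear_intro) (auto simp: fun_eq_iff vec_apply poly_eq_iff cG)
  have im: "G ` FS ?T = PV n l"
  proof (intro equalityI subsetI)
    fix p assume "p \<in> G ` FS ?T"
    then obtain w where w: "w \<in> FS ?T" "p = G w" by blast
    have "p i = 0" if "i \<ge> n" for i
      using w that by (auto simp: poly_eq_iff cG FS_def)
    moreover have "degree (p i) \<le> l" for i
      by (rule degree_le) (auto simp: w cG)
    ultimately show "p \<in> PV n l" by (simp add: PV_def)
  next
    fix p :: "nat \<Rightarrow> 'k poly" assume p: "p \<in> PV n l"
    define w where "w = (\<lambda>(i, s). coeff (p i) s)"
    have cs: "coeff (p i) s = 0" if "\<not> s \<le> l" for i s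
    proof -
      have "degree (p i) \<le> l" using p by (simp add: PV_def)
      then show ?thesis using that by (intro coeff_eq_0) simp
    qed
    have ci: "p i = 0" if "\<not> i < n" for i using p that by (simp add: PV_def)
    have "w \<in> FS ?T" unfolding FS_def w_def using cs ci by auto
    moreover have "G w = p" by (auto simp: fun_eq_iff poly_eq_iff cG w_def cs)
    ultimately show "p \<in> G ` FS ?T" by (metis imageI)
  qed
  have inj: "w = 0" if w: "w \<in> FS ?T" "G w = 0" for w
  proof
    fix t :: "nat \<times> nat"
    obtain i s where t: "t = (i, s)" by force
    have "coeff (G w i) s = 0" by (simp add: w(2) vec_apply)
    then show "w t = 0 t" using w(1) by (auto simp: t cG FS_def vec_apply split: if_splits)
  qed
  have fd: "fs.fin_dim (FS ?T :: (nat \<times> nat \<Rightarrow> 'k) set)" by (simp add: dim_FS)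
  show "ps.fin_dim (PV n l :: (nat \<Rightarrow> 'k poly) set)"
    using fp.fin_dim_image[OF lin fd] by (simp add: im)
  show "ps.dim (PV n l :: (nat \<Rightarrow> 'k poly) set) = n * (l + 1)"
    using fp.dim_image_inj[OF lin subspace_FS fd inj] by (simp add: im dim_FS card_cartesian_product)
qed

text \<open>The value at t = 0 of a section, in the basis of the fibre induced by
  \<open>e0\<close>.\<close>

definition ev0 :: "(nat \<Rightarrow> 'k::field poly) \<Rightarrow> nat \<Rightarrow> 'k" where
  "ev0 p = (\<lambda>i. coeff (p i) 0)"

lemma linear_ev0: "Vector_Spaces.linear pscale fscale ev0"
  by (rule pf.linear_intro) (auto simp: ev0_def fun_eq_iff vec_apply)

text \<open>A relation has vanishing constant terms, so it can be divided by the coordinate \<open>t\<close>;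
  repeating this shows that all its coefficients vanish.\<close>

lemma indep_constant_terms:
  fixes p :: "nat \<Rightarrow> nat \<Rightarrow> 'k::field poly"
  assumes ind: "fs.indep_fam r (\<lambda>j. ev0 (p j))" and rel: "\<And>i. (\<Sum>j<r. g j * p j i) = 0" and j: "j < r"
  shows "g j = 0"
proof -
  have const: "coeff (g j) 0 = 0" if g: "\<forall>i. (\<Sum>j<r. g j * p j i) = 0" and j: "j < r" for g j
  proof -
    have "(\<Sum>j<r. fscale (coeff (g j) 0) (ev0 (p j))) = 0"
    proof
      fix i
      have "coeff (\<Sum>j<r. g j * p j i) 0 = 0" using g by simp
      then show "(\<Sum>j<r. fscale (coeff (g j) 0) (ev0 (p j))) i = 0 i"
        by (simp add: sum_fun_apply vec_apply ev0_def coeff_sum coeff_mult_0)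
    qed
    then show ?thesis using fs.indep_famD[OF ind, of "\<lambda>j. coeff (g j) 0"] j by simp
  qed
  have "\<forall>g. (\<forall>i. (\<Sum>j<r. g j * p j i) = 0) \<longrightarrow> (\<forall>j<r. coeff (g j) l = 0)" for l
  proof (induction l)
    case 0
    show ?case using const by blast
  next
    case (Suc l)
    show ?case
    proof (intro allI impI)
      fix g j assume g: "\<forall>i. (\<Sum>j<r. g j * p j i) = 0" and j: "j < r"
      have c0: "coeff (g j) 0 = 0" if "j < r" for j by (rule const[OF g that])
      define h where "h j = poly_shift 1 (g j)" for j
      have gh: "g j = pCons 0 (h j)" if "j < r" for j
        by (rule poly_eqI) (auto simp: h_def coeff_pCons coeff_poly_shift c0[OF that] split: nat.splits)
      have "(\<Sum>j<r. h j * p j i) = 0" for i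
      proof -
        have "(\<Sum>j<r. g j * p j i) = pCons 0 (\<Sum>j<r. h j * p j i)"
        proof -
          have "(\<Sum>j<r. g j * p j i) = (\<Sum>j<r. [:0, 1:] * (h j * p j i))"
            by (rule sum.cong) (auto simp: gh)
          also have "\<dots> = [:0, 1:] * (\<Sum>j<r. h j * p j i)" by (rule sum_distrib_left[symmetric])
          finally show ?thesis by simp
        qed
        then show ?thesis using g by simp
      qed
      then have "coeff (h j) l = 0" using Suc j by blast
      then show "coeff (g j) (Suc l) = 0" using gh[OF j] by simp
    qed
  qed
  then show ?thesis using rel j by (intro poly_eqI) simp
qed

section \<open>Sections of twists, evaluation at t = 0 and the Hilbert function\<close>

locale vec_bundle =
  fixes n :: nat and e0 einf :: "nat \<Rightarrow> 'k::field vecK"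
  assumes frame0: "frame n n e0" and frame_inf: "frame n n einf"
begin

definition Psi :: "(nat \<Rightarrow> 'k poly) \<Rightarrow> 'k vecK" where
  "Psi p = (\<Sum>i<n. fscale (to_fract (p i)) (e0 i))"

text \<open>Extends \<open>latticeInf\<close> to negative twists, since the argument depends on the
  sections of E(-a) and E(-a - 1).\<close>

definition Lz :: "int \<Rightarrow> 'k vecK set" where
  "Lz m = {(\<Sum>j<n. fscale (c j) (einf j)) | c. \<forall>j<n. Om m (c j)}"

text \<open>The space H^0(F(m)) for the subbundle F with generic fibre \<open>U\<close>, in
  polynomial coordinates with respect to \<open>e0\<close>; here m is any integer.\<close>

definition PP :: "'k vecK set \<Rightarrow> int \<Rightarrow> (nat \<Rightarrow> 'k poly) set" where
  "PP U m = {p. (\<forall>i\<ge>n. p i = 0) \<and> Psi p \<in> U \<and> Psi p \<in> Lz m}"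

lemma e0_mem: "j < n \<Longrightarrow> e0 j \<in> FS {..<n}" and einf_mem: "j < n \<Longrightarrow> einf j \<in> FS {..<n}"
  using frame0 frame_inf by (auto simp: frame_iff)

lemma e0_indep: "fs.indep_fam n e0" and einf_indep: "fs.indep_fam n einf"
  using frame0 frame_inf by (auto simp: frame_iff)

lemma Psi_mem: "Psi p \<in> FS {..<n}"
  unfolding Psi_def using e0_mem
  by (auto intro!: fs.subspace_sum[OF subspace_FS] fs.subspace_scale[OF subspace_FS])

lemma kscale_fscale: "kscale c v = fscale (to_fract [:c:]) v"
  by (simp add: fun_eq_iff vec_apply const_rf_to_fract)

lemma linear_Psi: "Vector_Spaces.linear pscale kscale Psi"
proof (rule pk.linear_intro)
  show "Psi (x + y) = Psi x + Psi y" for x y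
    by (simp add: Psi_def vec_apply fs.scale_left_distrib sum.distrib)
  show "Psi (pscale c x) = kscale c (Psi x)" for c x
  proof -
    have "to_fract (smult c q) = to_fract [:c:] * to_fract q" for q :: "'k poly"
      by (simp flip: to_fract_mult)
    then show ?thesis
      by (simp add: Psi_def kscale_fscale vec_apply fs.scale_sum_right)
  qed
qed

lemma Psi_mult: "Psi (\<lambda>i. g * p i) = fscale (to_fract g) (Psi p)"
  by (simp add: Psi_def fs.scale_sum_right)

lemma Psi_add: "Psi (\<lambda>i. p i + q i) = Psi p + Psi q"
  by (simp add: Psi_def fs.scale_left_distrib sum.distrib)

lemma Psi_0: "Psi (\<lambda>i. 0) = 0"
  by (simp add: Psi_def)

lemma Psi_comb: "Psi (\<lambda>i. \<Sum>j<(r::nat). g j * p j i) = (\<Sum>j<r. fscale (to_fract (g j)) (Psi (p j)))"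
proof (induction r)
  case (Suc r)
  then show ?case by (simp add: Psi_add Psi_mult)
qed (simp add: Psi_0)

lemma Psi_eq_0:
  assumes "\<And>i. i \<ge> n \<Longrightarrow> p i = 0" "Psi p = 0"
  shows "p = 0"
proof
  fix i show "p i = 0 i"
    using fs.indep_famD[OF e0_indep, of "\<lambda>i. to_fract (p i)" i] assms
    by (cases "i < n") (auto simp: Psi_def vec_apply)
qed

lemma Lz_add: "v \<in> Lz m \<Longrightarrow> w \<in> Lz m \<Longrightarrow> v + w \<in> Lz m"
proof -
  assume "v \<in> Lz m" "w \<in> Lz m"
  then obtain c d where "v = (\<Sum>j<n. fscale (c j) (einf j))" "\<forall>j<n. Om m (c j)"
    "w = (\<Sum>j<n. fscale (d j) (einf j))" "\<forall>j<n. Om m (d j)" by (auto simp: Lz_def)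
  then show "v + w \<in> Lz m" unfolding Lz_def
    by (intro CollectI exI[of _ "\<lambda>j. c j + d j"]) (auto simp: fs.scale_left_distrib sum.distrib Om_add)
qed

lemma Lz_fscale:
  assumes "v \<in> Lz m" "\<And>x. Om m x \<Longrightarrow> Om m' (a * x)"
  shows "fscale a v \<in> Lz m'"
proof -
  obtain c where "v = (\<Sum>j<n. fscale (c j) (einf j))" "\<forall>j<n. Om m (c j)"
    using assms by (auto simp: Lz_def)
  then show ?thesis unfolding Lz_def
    by (intro CollectI exI[of _ "\<lambda>j. a * c j"]) (auto simp: fs.scale_sum_right assms)
qed

lemma Lz_0: "0 \<in> Lz m"
  unfolding Lz_def by (intro CollectI exI[of _ "\<lambda>_. 0"]) (auto simp: Om_0)

lemma Lz_kscale: "v \<in> Lz m \<Longrightarrow> kscale c v \<in> Lz m"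
  unfolding kscale_fscale by (rule Lz_fscale) (use Om_const_mult in \<open>auto simp: const_rf_to_fract\<close>)

lemma Lz_mono: "v \<in> Lz m \<Longrightarrow> m \<le> m' \<Longrightarrow> v \<in> Lz m'"
  using Lz_fscale[of v m m' 1] Om_mono by auto

lemma Lz_tt: "fscale tt v \<in> Lz (m + 1) \<longleftrightarrow> v \<in> Lz m"
proof
  assume "fscale tt v \<in> Lz (m + 1)"
  then have "fscale (inverse tt) (fscale tt v) \<in> Lz m"
  proof (rule Lz_fscale)
    fix x :: "'k rf" assume "Om (m + 1) x"
    then show "Om m (inverse tt * x)" using Om_tt[of m "inverse tt * x"] by (simp add: mult.assoc[symmetric])
  qed
  then show "v \<in> Lz m" by simp
qed (rule Lz_fscale, auto simp: Om_tt)

lemma subspace_PP: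
  assumes "fs.subspace U"
  shows "ps.subspace (PP U m)"
proof (rule ps.subspaceI)
  show "0 \<in> PP U m"
    using fs.subspace_0[OF assms] Lz_0 pk.linear_0[OF linear_Psi] by (simp add: PP_def vec_apply)
  show "x + y \<in> PP U m" if "x \<in> PP U m" "y \<in> PP U m" for x y
    using that fs.subspace_add[OF assms] Lz_add pk.linear_add[OF linear_Psi] by (simp add: PP_def vec_apply)
  show "pscale c x \<in> PP U m" if "x \<in> PP U m" for c x
    using that fs.subspace_scale[OF assms] Lz_kscale pk.linear_scale[OF linear_Psi]
    by (simp add: PP_def vec_apply kscale_fscale)
qed

lemma PP_mono: "m \<le> m' \<Longrightarrow> PP U m \<subseteq> PP U m'"
  using Lz_mono by (auto simp: PP_def)

lemma PP_poly_mult: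
  assumes "fs.subspace U" "p \<in> PP U m" "degree g \<le> l"
  shows "(\<lambda>i. g * p i) \<in> PP U (m + int l)"
proof -
  have "fscale (to_fract g) (Psi p) \<in> Lz (m + int l)"
    using assms by (intro Lz_fscale[where m = m] Om_poly_mult) (auto simp: PP_def)
  then show ?thesis using assms fs.subspace_scale[OF assms(1)] by (simp add: PP_def Psi_mult)
qed

lemma PP_shift:
  assumes "fs.subspace U"
  shows "(\<lambda>i. monom 1 1 * p i) \<in> PP U (m + 1) \<longleftrightarrow> p \<in> PP U m"
proof -
  have "fscale tt (Psi p) \<in> U \<longleftrightarrow> Psi p \<in> U"
    using fs.subspace_scale[OF assms, of "fscale tt (Psi p)" "inverse tt"]
      fs.subspace_scale[OF assms, of "Psi p" tt] by auto
  moreover have "monom (1::'k) 1 \<noteq> 0" by (simp add: monom_eq_0_iff)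
  ultimately show ?thesis
    by (simp add: PP_def Psi_mult Lz_tt flip: tt_def del: One_nat_def)
qed

text \<open>Rewriting \<open>einf\<close> in terms of \<open>e0\<close> expresses a coordinate of a
  section as a sum of products c T with c in t^m k[1/t], so its degree exceeds m by at most a
  constant of the two frames. Finite-dimensionality of the section spaces rests on this.\<close>

lemma PP_degree_bound: "\<exists>D. \<forall>U m p i. p \<in> PP U m \<longrightarrow> p i = 0 \<or> int (degree (p i)) \<le> m + D"
proof -
  have "\<exists>c. einf j = (\<Sum>i<n. fscale (c i) (e0 i))" if "j < n" for j
    using frame_expand[OF frame0 einf_mem[OF that]] by metis
  then obtain T where T: "\<And>j. j < n \<Longrightarrow> einf j = (\<Sum>i<n. fscale (T j i) (e0 i))" by metis
  have "\<forall>j i. \<exists>d. degle (T j i) d" using degle_exists by blast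
  then obtain d where d: "\<And>j i. degle (T j i) (d j i)" by metis
  define D where "D = (\<Sum>j<n. \<Sum>i<n. \<bar>d j i\<bar>)"
  have dD: "degle (T j i) D" if "j < n" "i < n" for j i
  proof -
    have "\<bar>d j i\<bar> \<le> (\<Sum>i<n. \<bar>d j i\<bar>)" using that by (intro member_le_sum) auto
    also have "\<dots> \<le> D" unfolding D_def
      using that by (intro member_le_sum[of j "{..<n}" "\<lambda>j. \<Sum>i<n. \<bar>d j i\<bar>"]) (auto intro: sum_nonneg)
    finally show ?thesis by (intro degle_mono[OF d]) linarith
  qed
  have "p i = 0 \<or> int (degree (p i)) \<le> m + D" if p: "p \<in> PP U m" for U m p i
  proof (cases "i < n")
    case True
    obtain c where c: "Psi p = (\<Sum>j<n. fscale (c j) (einf j))" "\<And>j. j < n \<Longrightarrow> Om m (c j)"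
      using p by (auto simp: PP_def Lz_def)
    have "Psi p = (\<Sum>j<n. \<Sum>i<n. fscale (c j * T j i) (e0 i))"
      unfolding c(1) by (rule sum.cong) (auto simp: T fs.scale_sum_right)
    also have "\<dots> = (\<Sum>i<n. fscale (\<Sum>j<n. c j * T j i) (e0 i))"
      by (subst sum.swap) (simp add: fs.scale_sum_left)
    finally have "(\<Sum>i<n. fscale (to_fract (p i) - (\<Sum>j<n. c j * T j i)) (e0 i)) = 0"
      by (simp add: Psi_def fs.scale_left_diff_distrib sum_subtractf)
    then have "to_fract (p i) = (\<Sum>j<n. c j * T j i)"
      using fs.indep_famD[OF e0_indep _ True] by fastforce
    moreover have "degle (\<Sum>j<n. c j * T j i) (m + D)"
      using degle_mult[OF Om_degle[OF c(2)] dD[OF _ True]] by (intro degle_sum) auto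
    ultimately show ?thesis using degle_to_fract by metis
  next
    case False
    then show ?thesis using p by (simp add: PP_def)
  qed
  then show ?thesis by blast
qed

lemma fin_dim_PP: "ps.fin_dim (PP U m)"
proof -
  obtain D where D: "\<And>p i. p \<in> PP U m \<Longrightarrow> p i = 0 \<or> int (degree (p i)) \<le> m + D"
    using PP_degree_bound by blast
  have "degree (p i) \<le> nat (m + D)" if "p \<in> PP U m" for p i using D[OF that, of i] by auto
  then have "PP U m \<subseteq> PV n (nat (m + D))" by (auto simp: PV_def PP_def)
  then show ?thesis by (rule ps.fin_dim_subset[OF dim_PV(1)])
qed

lemma H0_eq: "H0 n e0 einf U m = Psi ` PP U (int m)"
proof -
  have inf: "latticeInf n einf m = Lz (int m)"
  proof (intro equalityI subsetI)
    fix v assume "v \<in> latticeInf n einf m"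
    then obtain c where c: "v = (\<lambda>i. tpow m * Kcomb n c einf i)" "\<forall>j<n. in_kinvt (c j)"
      by (auto simp: latticeInf_def)
    then have "v = fscale (tt ^ m) (\<Sum>j<n. fscale (c j) (einf j))"
      by (simp add: tpow_eq Kcomb_eq fscale_def)
    moreover have "(\<Sum>j<n. fscale (c j) (einf j)) \<in> Lz 0" using c by (auto simp: Lz_def Om_def)
    then have "fscale (tt ^ m) (\<Sum>j<n. fscale (c j) (einf j)) \<in> Lz (int m)"
    proof (rule Lz_fscale)
      show "Om (int m) (tt ^ m * x)" if "Om 0 x" for x :: "'k rf" using that Om_power[of 0 m x] by simp
    qed
    ultimately show "v \<in> Lz (int m)" by simp
  next
    fix v assume "v \<in> Lz (int m)"
    then obtain c where c: "v = (\<Sum>j<n. fscale (c j) (einf j))" "\<forall>j<n. Om (int m) (c j)"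
      by (auto simp: Lz_def)
    have "v = fscale (tt ^ m) (Kcomb n (\<lambda>j. c j / tt ^ m) einf)"
      by (simp add: c Kcomb_eq fs.scale_sum_right)
    moreover have "\<forall>j<n. in_kinvt (c j / tt ^ m)" using c by (simp add: Om_def)
    ultimately show "v \<in> latticeInf n einf m"
      unfolding latticeInf_def fscale_def tpow_eq by blast
  qed
  have l0: "lattice0 n e0 = {Psi p | p. \<forall>i\<ge>n. p i = 0}"
  proof (intro equalityI subsetI)
    fix v assume "v \<in> lattice0 n e0"
    then obtain c where c: "v = Kcomb n c e0" "\<forall>j<n. in_kt (c j)" by (auto simp: lattice0_def)
    then obtain p where p: "\<And>j. j < n \<Longrightarrow> c j = to_fract (p j)" unfolding in_kt_iff by metis
    have "v = Psi (\<lambda>i. if i < n then p i else 0)"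
      unfolding c Kcomb_eq Psi_def by (rule sum.cong) (auto simp: p)
    then show "v \<in> {Psi p | p. \<forall>i\<ge>n. p i = 0}" by fastforce
  next
    fix v assume "v \<in> {Psi p | p. \<forall>i\<ge>n. p i = 0}"
    then obtain p where "v = Psi p" by blast
    then show "v \<in> lattice0 n e0"
      unfolding lattice0_def Kcomb_eq Psi_def in_kt_iff
      by (intro CollectI exI[of _ "\<lambda>i. to_fract (p i)"]) auto
  qed
  show ?thesis unfolding H0_def inf l0 by (auto simp: PP_def)
qed

lemma
  assumes "ps.subspace S" "S \<subseteq> PP U m"
  shows dim_Psi_image: "ks.dim (Psi ` S) = ps.dim S"
    and fin_dim_Psi_image: "ks.fin_dim (Psi ` S)"
proof -
  have fd: "ps.fin_dim S" by (rule ps.fin_dim_subset[OF fin_dim_PP assms(2)])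
  have "p = 0" if "p \<in> S" "Psi p = 0" for p
  proof (rule Psi_eq_0[OF _ that(2)])
    show "p i = 0" if "i \<ge> n" for i using that \<open>p \<in> S\<close> assms(2) by (auto simp: PP_def)
  qed
  then show "ks.dim (Psi ` S) = ps.dim S" by (intro pk.dim_image_inj[OF linear_Psi assms(1) fd])
  show "ks.fin_dim (Psi ` S)" by (rule pk.fin_dim_image[OF linear_Psi fd])
qed

lemma kdim_Psi_image: "ps.subspace S \<Longrightarrow> S \<subseteq> PP U m \<Longrightarrow> kdim (Psi ` S) = ps.dim S"
  by (simp add: kdim_eq_dim dim_Psi_image fin_dim_Psi_image)

text \<open>The image of H^0(F(m)) in the fibre of E at t = 0.\<close>

definition CC :: "'k vecK set \<Rightarrow> int \<Rightarrow> (nat \<Rightarrow> 'k) set" where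
  "CC U m = ev0 ` PP U m"

lemma subspace_CC: "fs.subspace U \<Longrightarrow> fs.subspace (CC U m)"
  unfolding CC_def by (rule pf.linear_subspace_image[OF linear_ev0 subspace_PP])

lemma CC_FS: "CC U m \<subseteq> FS {..<n}"
  by (auto simp: CC_def PP_def FS_def ev0_def)

lemma fin_dim_CC: "fs.fin_dim (CC U m)"
  by (rule fs.fin_dim_subset[OF dim_FS(1) CC_FS]) simp

lemma CC_mono: "m \<le> m' \<Longrightarrow> CC U m \<subseteq> CC U m'"
  unfolding CC_def using PP_mono by blast

text \<open>As a section of O(1), t vanishes exactly at the point 0. Dividing by it keeps the
  coordinates polynomial and lowers the twist by one at infinity.\<close>

lemma ev0_eq_0:
  assumes U: "fs.subspace U" and p: "p \<in> PP U (m + 1)" "ev0 p = 0"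
  obtains q where "q \<in> PP U m" "p = (\<lambda>i. monom 1 1 * q i)"
proof -
  define q where "q i = poly_shift 1 (p i)" for i
  have c0: "coeff (p i) 0 = 0" for i using p(2) by (simp add: ev0_def fun_eq_iff vec_apply)
  have "p i = monom 1 1 * q i" for i
    by (rule poly_eqI) (auto simp: q_def coeff_monom_mult coeff_poly_shift c0 not_le)
  then have "p = (\<lambda>i. monom 1 1 * q i)" by blast
  moreover from this have "q \<in> PP U m" using p(1) PP_shift[OF U] by simp
  ultimately show thesis using that by blast
qed

text \<open>Multiplication by t identifies the sections of F(m) with those of F(m + 1) that vanish
  at t = 0; the rest is rank-nullity for evaluation there.\<close>

lemma dim_PP_step:
  assumes U: "fs.subspace U"
  shows "ps.dim (PP U (m + 1)) = ps.dim (PP U m) + fs.dim (CC U (m + 1))"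
proof -
  define X :: "(nat \<Rightarrow> 'k poly) \<Rightarrow> nat \<Rightarrow> 'k poly" where "X p = (\<lambda>i. monom 1 1 * p i)" for p
  have lin: "Vector_Spaces.linear pscale pscale X"
    by (rule pp.linear_intro) (auto simp: X_def fun_eq_iff vec_apply algebra_simps)
  have "{p \<in> PP U (m + 1). ev0 p = 0} = X ` PP U m"
  proof (intro equalityI subsetI)
    fix p assume "p \<in> {p \<in> PP U (m + 1). ev0 p = 0}"
    then obtain q where "q \<in> PP U m" "p = X q" using ev0_eq_0[OF U, of p m] unfolding X_def by blast
    then show "p \<in> X ` PP U m" by blast
  next
    fix p assume "p \<in> X ` PP U m"
    then obtain q where q: "q \<in> PP U m" "p = X q" by blast
    then have "p \<in> PP U (m + 1)" using PP_shift[OF U] by (simp add: X_def)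
    moreover have "ev0 p = 0" by (auto simp: q X_def ev0_def fun_eq_iff vec_apply coeff_monom_mult)
    ultimately show "p \<in> {p \<in> PP U (m + 1). ev0 p = 0}" by simp
  qed
  moreover have "ps.dim (X ` PP U m) = ps.dim (PP U m)"
  proof (rule pp.dim_image_inj[OF lin subspace_PP[OF U] fin_dim_PP])
    fix p assume "X p = 0"
    then show "p = 0" by (simp add: X_def fun_eq_iff vec_apply monom_eq_0_iff)
  qed
  ultimately show ?thesis
    using pf.rank_nullity[OF linear_ev0 subspace_PP[OF U] fin_dim_PP, of "m + 1"] by (simp add: CC_def)
qed

text \<open>Clearing denominators turns a K-linear relation between the sections into one with
  polynomial coefficients, and \<open>indep_constant_terms\<close> excludes it. Hence values at a
  single point detect generic rank, and \<open>CC U m\<close> has dimension at most the rank of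
  F.\<close>

lemma indep_Psi:
  assumes "\<And>j i. j < r \<Longrightarrow> i \<ge> n \<Longrightarrow> p j i = 0" "fs.indep_fam r (\<lambda>j. ev0 (p j))"
  shows "fs.indep_fam r (\<lambda>j. Psi (p j))"
  unfolding fs.indep_fam_def
proof (intro allI impI)
  fix c j assume s: "(\<Sum>j<r. fscale (c j) (Psi (p j))) = 0" and j: "j < r"
  obtain q g where q: "q \<noteq> 0" "\<And>j. j < r \<Longrightarrow> c j * to_fract q = to_fract (g j)"
    by (rule common_denominator[where f = c and r = r]) blast
  have "Psi (\<lambda>i. \<Sum>j<r. g j * p j i) = (\<Sum>j<r. fscale (to_fract (g j)) (Psi (p j)))"
    by (rule Psi_comb)
  also have "\<dots> = fscale (to_fract q) (\<Sum>j<r. fscale (c j) (Psi (p j)))"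
    unfolding fs.scale_sum_right by (rule sum.cong) (auto simp: q(2)[symmetric] mult.commute)
  also have "\<dots> = 0" by (simp add: s)
  finally have "(\<lambda>i. \<Sum>j<r. g j * p j i) = 0"
    using assms(1) by (intro Psi_eq_0) auto
  then have "(\<Sum>j<r. g j * p j i) = 0" for i by (simp add: fun_eq_iff vec_apply)
  then have "g j = 0" using indep_constant_terms[OF assms(2)] j by blast
  then show "c j = 0" using q(1) q(2)[OF j] by simp
qed

lemma dim_CC_le:
  assumes U: "fs.subspace U" "U \<subseteq> FS {..<n}"
  shows "fs.dim (CC U m) \<le> fs.dim U"
proof -
  obtain b where b: "fs.indep_fam (fs.dim (CC U m)) b" "\<And>j. j < fs.dim (CC U m) \<Longrightarrow> b j \<in> CC U m"
    using fs.basis_fam[OF fin_dim_CC] by metis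
  have "\<exists>p. p \<in> PP U m \<and> b j = ev0 p" if "j < fs.dim (CC U m)" for j
    using b(2)[OF that] unfolding CC_def by blast
  then obtain p where p: "\<And>j. j < fs.dim (CC U m) \<Longrightarrow> p j \<in> PP U m \<and> b j = ev0 (p j)"
    by metis
  have "fs.indep_fam (fs.dim (CC U m)) (\<lambda>j. ev0 (p j))"
    using b(1) p unfolding fs.indep_fam_def by simp
  then have "fs.indep_fam (fs.dim (CC U m)) (\<lambda>j. Psi (p j))"
    using p by (intro indep_Psi) (auto simp: PP_def)
  moreover have "Psi (p j) \<in> U" if "j < fs.dim (CC U m)" for j using p[OF that] by (simp add: PP_def)
  moreover have "fs.fin_dim U" by (rule fs.fin_dim_subset[OF dim_FS(1) U(2)]) simp
  ultimately show ?thesis using fs.indep_fam_dim_le[of U "fs.dim (CC U m)" "\<lambda>j. Psi (p j)"] by blast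
qed

text \<open>Independent sections of F(m) embed O(-m)^r in F, so F(m + l) receives all sections of
  O(l)^r.\<close>

lemma dim_PP_growth:
  assumes U: "fs.subspace U" and p: "\<And>j. j < r \<Longrightarrow> p j \<in> PP U m"
    and ind: "fs.indep_fam r (\<lambda>j. Psi (p j))"
  shows "r * (l + 1) \<le> ps.dim (PP U (m + int l))"
proof -
  define G :: "(nat \<Rightarrow> 'k poly) \<Rightarrow> nat \<Rightarrow> 'k poly" where "G g = (\<lambda>i. \<Sum>j<r. g j * p j i)" for g
  have lin: "Vector_Spaces.linear pscale pscale G"
    by (rule pp.linear_intro)
      (auto simp: G_def fun_eq_iff vec_apply algebra_simps sum.distrib smult_sum_right)
  have inj: "g = 0" if g: "g \<in> PV r l" "G g = 0" for g
  proof
    fix j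
    have "Psi (G g) = 0" using g(2) pk.linear_0[OF linear_Psi] by simp
    then have "(\<Sum>j<r. fscale (to_fract (g j)) (Psi (p j))) = 0" by (simp add: G_def Psi_comb)
    then show "g j = 0 j"
      using fs.indep_famD[OF ind, of "\<lambda>j. to_fract (g j)" j] g(1) by (cases "j < r") (auto simp: PV_def vec_apply)
  qed
  have "G g \<in> PP U (m + int l)" if g: "g \<in> PV r l" for g
  proof -
    have "(\<lambda>i. g j * p j i) \<in> PP U (m + int l)" if "j < r" for j
      using g by (intro PP_poly_mult[OF U p[OF that]]) (simp add: PV_def)
    then have "(\<Sum>j<r. (\<lambda>i. g j * p j i)) \<in> PP U (m + int l)"
      by (intro ps.subspace_sum[OF subspace_PP[OF U]]) auto
    moreover have "G g = (\<Sum>j<r. (\<lambda>i. g j * p j i))" by (auto simp: G_def fun_eq_iff sum_fun_apply)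
    ultimately show ?thesis by simp
  qed
  then have "G ` PV r l \<subseteq> PP U (m + int l)" by blast
  then have "ps.dim (G ` PV r l) \<le> ps.dim (PP U (m + int l))"
    by (rule ps.dim_subset_fin_dim[OF fin_dim_PP])
  moreover have "ps.dim (G ` PV r l) = r * (l + 1)"
    using pp.dim_image_inj[OF lin subspace_PV dim_PV(1) inj] by (simp add: dim_PV(2))
  ultimately show ?thesis by simp
qed

text \<open>Any rational vector of \<open>U\<close> becomes a section of some twist once its
  denominators in both frames are cleared.\<close>

lemma exists_PP_multiple:
  assumes U: "fs.subspace U" "u \<in> U" "U \<subseteq> FS {..<n}"
  obtains q p m where "q \<noteq> 0" "p \<in> PP U m" "Psi p = fscale (to_fract q) u"
proof -
  have uF: "u \<in> FS {..<n}" using U by blast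
  obtain c where c: "u = (\<Sum>j<n. fscale (c j) (e0 j))" by (rule frame_expand[OF frame0 uF])
  obtain d where d: "u = (\<Sum>j<n. fscale (d j) (einf j))" by (rule frame_expand[OF frame_inf uF])
  obtain q1 g1 where q1: "q1 \<noteq> 0" "\<And>j. j < n \<Longrightarrow> c j * to_fract q1 = to_fract (g1 j)"
    by (rule common_denominator[where f = c and r = n]) blast
  obtain q2 g2 where q2: "q2 \<noteq> 0" "\<And>j. j < n \<Longrightarrow> d j * to_fract q2 = to_fract (g2 j)"
    by (rule common_denominator[where f = d and r = n]) blast
  define p where "p i = (if i < n then g1 i * q2 else 0)" for i
  define l where "l = (\<Sum>j<n. degree (g2 j * q1))"
  have Pp: "Psi p = fscale (to_fract (q1 * q2)) u"
    unfolding c fs.scale_sum_right Psi_def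
  proof (rule sum.cong)
    fix j assume j: "j \<in> {..<n}"
    have "to_fract (p j) = c j * to_fract q1 * to_fract q2" using j q1(2) by (simp add: p_def)
    then show "fscale (to_fract (p j)) (e0 j) = fscale (to_fract (q1 * q2)) (fscale (c j) (e0 j))"
      by (simp add: mult_ac)
  qed simp
  have "Psi p \<in> Lz (int l)"
    unfolding Pp Lz_def
  proof (intro CollectI exI[of _ "\<lambda>j. to_fract (q1 * q2) * d j"] conjI allI impI)
    show "fscale (to_fract (q1 * q2)) u = (\<Sum>j<n. fscale (to_fract (q1 * q2) * d j) (einf j))"
      unfolding d fs.scale_sum_right by simp
    fix j assume j: "j < n"
    have "to_fract (q1 * q2) * d j = (d j * to_fract q2) * to_fract q1" by (simp add: mult_ac)
    also have "\<dots> = to_fract (g2 j * q1)" by (simp add: q2(2)[OF j])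
    finally have e: "to_fract (q1 * q2) * d j = to_fract (g2 j * q1)" .
    have "degree (g2 j * q1) \<le> l"
      unfolding l_def using j by (intro member_le_sum[of j "{..<n}" "\<lambda>j. degree (g2 j * q1)"]) auto
    then show "Om (int l) (to_fract (q1 * q2) * d j)" unfolding e by (rule Om_poly)
  qed
  moreover have "Psi p \<in> U" unfolding Pp by (rule fs.subspace_scale[OF U(1,2)])
  ultimately have "p \<in> PP U (int l)" by (simp add: PP_def p_def)
  then show thesis using that[of "q1 * q2" p "int l"] Pp q1(1) q2(1) by simp
qed

lemma exists_PP_basis:
  assumes U: "fs.subspace U" "U \<subseteq> FS {..<n}"
  obtains p m where "\<And>j. j < fs.dim U \<Longrightarrow> p j \<in> PP U m" "fs.indep_fam (fs.dim U) (\<lambda>j. Psi (p j))"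
proof -
  have fd: "fs.fin_dim U" by (rule fs.fin_dim_subset[OF dim_FS(1) U(2)]) simp
  obtain b where b: "fs.indep_fam (fs.dim U) b" "\<And>j. j < fs.dim U \<Longrightarrow> b j \<in> U"
    using fs.basis_fam[OF fd] by metis
  have "\<exists>q p m. q \<noteq> 0 \<and> p \<in> PP U m \<and> Psi p = fscale (to_fract q) (b j)" if "j < fs.dim U" for j
    using exists_PP_multiple[OF U(1) b(2)[OF that] U(2)] by metis
  then obtain q p m where qpm: "\<And>j. j < fs.dim U \<Longrightarrow>
      q j \<noteq> 0 \<and> p j \<in> PP U (m j) \<and> Psi (p j) = fscale (to_fract (q j)) (b j)" by metis
  define M where "M = (\<Sum>j<fs.dim U. \<bar>m j\<bar>)"
  have "p j \<in> PP U M" if "j < fs.dim U" for j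
  proof -
    have "\<bar>m j\<bar> \<le> M" unfolding M_def
      using that by (intro member_le_sum[of j "{..<fs.dim U}" "\<lambda>j. \<bar>m j\<bar>"]) auto
    then have "m j \<le> M" by linarith
    then show ?thesis using qpm[OF that] PP_mono by blast
  qed
  moreover have "fs.indep_fam (fs.dim U) (\<lambda>j. Psi (p j))"
    unfolding fs.indep_fam_def
  proof (intro allI impI)
    fix c j assume s: "(\<Sum>j<fs.dim U. fscale (c j) (Psi (p j))) = 0" and j: "j < fs.dim U"
    have "(\<Sum>j<fs.dim U. fscale (c j * to_fract (q j)) (b j)) = (\<Sum>j<fs.dim U. fscale (c j) (Psi (p j)))"
      by (rule sum.cong) (auto simp: qpm)
    then have "(\<Sum>j<fs.dim U. fscale (c j * to_fract (q j)) (b j)) = 0" using s by simp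
    then have "c j * to_fract (q j) = 0" using fs.indep_famD[OF b(1), of "\<lambda>j. c j * to_fract (q j)" j] j by blast
    then show "c j = 0" using qpm[OF j] by simp
  qed
  ultimately show thesis using that by blast
qed

lemma dim_PP_diff_le:
  assumes U: "fs.subspace U" "U \<subseteq> FS {..<n}"
  shows "ps.dim (PP U (m + int l)) \<le> ps.dim (PP U m) + fs.dim U * l"
proof (induction l)
  case (Suc l)
  have "ps.dim (PP U (m + int (Suc l))) = ps.dim (PP U (m + int l)) + fs.dim (CC U (m + int l + 1))"
    using dim_PP_step[OF U(1), of "m + int l"] by (simp add: algebra_simps)
  also have "\<dots> \<le> ps.dim (PP U m) + fs.dim U * l + fs.dim U"
    using Suc dim_CC_le[OF U] by (intro add_mono) auto
  finally show ?case by simp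
qed simp

text \<open>The increments dim \<open>CC U m\<close> are monotone in m and at most r. If they stayed
  below r, the Hilbert function would grow too slowly for \<open>dim_PP_growth\<close>; so they
  become equal to r and the function becomes linear. Going back from there, increments of at most r
  leave every earlier value on or above the line: Riemann's inequality.\<close>

lemma hilbert_polynomial:
  assumes U: "fs.subspace U" "U \<subseteq> FS {..<n}"
  obtains d M where "\<And>m. d + int (fs.dim U) * (m + 1) \<le> int (ps.dim (PP U m))"
    "\<And>m. m \<ge> M \<Longrightarrow> int (ps.dim (PP U m)) = d + int (fs.dim U) * (m + 1)"
proof -
  let ?r = "fs.dim U"
  obtain p m1 where p: "\<And>j. j < ?r \<Longrightarrow> p j \<in> PP U m1" "fs.indep_fam ?r (\<lambda>j. Psi (p j))"
    by (rule exists_PP_basis[OF U]) blast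
  have "\<exists>M. fs.dim (CC U M) \<ge> ?r"
  proof (rule ccontr)
    assume "\<not> ?thesis"
    then have lt: "fs.dim (CC U m) + 1 \<le> ?r" for m by (simp add: not_le Suc_le_eq)
    let ?h = "ps.dim (PP U m1)"
    have "ps.dim (PP U (m1 + int l)) + l \<le> ?h + ?r * l" for l
    proof (induction l)
      case (Suc l)
      have "ps.dim (PP U (m1 + int (Suc l))) = ps.dim (PP U (m1 + int l)) + fs.dim (CC U (m1 + int l + 1))"
        using dim_PP_step[OF U(1), of "m1 + int l"] by (simp add: algebra_simps)
      then show ?case using Suc lt[of "m1 + int l + 1"] by simp
    qed simp
    \<comment> \<open>Increments of at most r - 1 give h + (r - 1)l, while growth demands r(l + 1);
      l = h is already large enough for a contradiction.\<close>
    from this[of ?h] have "ps.dim (PP U (m1 + int ?h)) \<le> ?r * ?h" by simp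
    moreover have "?r * (?h + 1) \<le> ps.dim (PP U (m1 + int ?h))"
      by (rule dim_PP_growth[OF U(1) p])
    ultimately have "?r = 0" by simp
    then show False using lt[of 0] by simp
  qed
  then obtain M where M: "fs.dim (CC U M) \<ge> ?r" by blast
  have eq: "fs.dim (CC U m) = ?r" if "m \<ge> M" for m
    using dim_CC_le[OF U, of m] M fs.dim_subset_fin_dim[OF fin_dim_CC CC_mono[OF that]] by (metis le_antisym le_trans)
  define d where "d = int (ps.dim (PP U M)) - int ?r * (M + 1)"
  have up: "int (ps.dim (PP U (M + int l))) = d + int ?r * (M + int l + 1)" for l
  proof (induction l)
    case (Suc l)
    have "ps.dim (PP U (M + int (Suc l))) = ps.dim (PP U (M + int l)) + ?r"
      using dim_PP_step[OF U(1), of "M + int l"] eq[of "M + int l + 1"] by (simp add: algebra_simps)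
    then show ?case using Suc by (simp add: algebra_simps)
  qed (simp add: d_def)
  have 1: "int (ps.dim (PP U m)) = d + int ?r * (m + 1)" if "m \<ge> M" for m
    using up[of "nat (m - M)"] that by simp
  have 2: "d + int ?r * (m + 1) \<le> int (ps.dim (PP U m))" for m
  proof (cases "m \<ge> M")
    case False
    have "ps.dim (PP U M) \<le> ps.dim (PP U m) + ?r * nat (M - m)"
      using dim_PP_diff_le[OF U, of m "nat (M - m)"] False by simp
    then have "int (ps.dim (PP U M)) \<le> int (ps.dim (PP U m) + ?r * nat (M - m))"
      by (simp only: of_nat_le_iff)
    then have "int (ps.dim (PP U M)) \<le> int (ps.dim (PP U m)) + int ?r * (M - m)"
      using False by simp
    then show ?thesis by (simp add: d_def algebra_simps)
  qed (simp add: 1)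
  show thesis using that[OF 2 1] by blast
qed

text \<open>\<open>bdeg\<close> is a definite description. It is well defined because two lines of
  the same slope r that agree for large m coincide.\<close>

lemma bdeg_properties:
  assumes U: "fs.subspace U" "U \<subseteq> FS {..<n}" and r: "r = fs.dim U"
  shows bdeg_lower: "bdeg n e0 einf r U + int r * (m + 1) \<le> int (ps.dim (PP U m))"
    and bdeg_eventually: "\<exists>M. \<forall>m\<ge>M. int (ps.dim (PP U m)) = bdeg n e0 einf r U + int r * (m + 1)"
proof -
  obtain d M where d: "\<And>m. d + int r * (m + 1) \<le> int (ps.dim (PP U m))"
    "\<And>m. m \<ge> M \<Longrightarrow> int (ps.dim (PP U m)) = d + int r * (m + 1)"
    using hilbert_polynomial[OF U] unfolding r by metis
  have kd: "kdim (H0 n e0 einf U m) = ps.dim (PP U (int m))" for m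
    unfolding H0_eq by (rule kdim_Psi_image[OF subspace_PP[OF U(1)] subset_refl])
  have hd: "has_degree n e0 einf r U d"
    unfolding has_degree_def kd using d(2) by (intro exI[of _ "nat M"]) auto
  have "bdeg n e0 einf r U = d"
    unfolding bdeg_def
  proof (rule the_equality)
    show "has_degree n e0 einf r U d" by (rule hd)
    fix d' assume "has_degree n e0 einf r U d'"
    then obtain M' where M': "\<And>m. m \<ge> M' \<Longrightarrow> int (ps.dim (PP U (int m))) = d' + int r * (int m + 1)"
      unfolding has_degree_def kd by blast
    then show "d' = d" using M'[of "max M' (nat M)"] d(2)[of "int (max M' (nat M))"] by simp
  qed
  then show "bdeg n e0 einf r U + int r * (m + 1) \<le> int (ps.dim (PP U m))"
    "\<exists>M. \<forall>m\<ge>M. int (ps.dim (PP U m)) = bdeg n e0 einf r U + int r * (m + 1)" using d by auto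
qed

text \<open>A subsheaf O(-m)^r of full rank forces degree at least -rm.\<close>

lemma bdeg_ge:
  assumes U: "fs.subspace U" "U \<subseteq> FS {..<n}" and r: "r = fs.dim U"
    and p: "\<And>j. j < r \<Longrightarrow> p j \<in> PP U m" "fs.indep_fam r (\<lambda>j. Psi (p j))"
  shows "- int r * m \<le> bdeg n e0 einf r U"
proof -
  obtain M where M: "\<And>m. m \<ge> M \<Longrightarrow> int (ps.dim (PP U m)) = bdeg n e0 einf r U + int r * (m + 1)"
    using bdeg_eventually[OF U r] by blast
  let ?l = "nat (M - m)"
  have "int (r * (?l + 1)) \<le> int (ps.dim (PP U (m + int ?l)))"
    using dim_PP_growth[OF U(1) p] by (simp only: of_nat_le_iff)
  also have "\<dots> = bdeg n e0 einf r U + int r * (m + int ?l + 1)" by (rule M) simp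
  finally show ?thesis by (simp add: algebra_simps)
qed

end

section \<open>Stable coherent systems\<close>

lemma sum_unitv: "(\<Sum>j<n. fscale (c j) (unitv j)) i = (if i < n then c i else 0)" for i n :: nat
proof -
  have "(\<Sum>j<n. fscale (c j) (unitv j)) i = (\<Sum>j<n. if i = j then c j else 0)"
    unfolding sum_fun_apply by (rule sum.cong) (auto simp: vec_apply unitv_def)
  then show ?thesis by simp
qed

lemma indep_unitv: "fs.indep_fam n (unitv :: nat \<Rightarrow> nat \<Rightarrow> 'k::field)"
  unfolding fs.indep_fam_def
proof (intro allI impI)
  fix c :: "nat \<Rightarrow> 'k" and j assume s: "(\<Sum>j<n. fscale (c j) (unitv j)) = 0" and j: "j < n"
  have "(\<Sum>j<n. fscale (c j) (unitv j)) j = 0" unfolding s by (simp add: vec_apply)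
  then show "c j = 0" using j unfolding sum_unitv by simp
qed

lemma alpha_slope_less_iff:
  assumes "0 < r" "0 < n"
  shows "alpha_slope \<alpha> d r w < alpha_slope \<alpha> d' n k \<longleftrightarrow>
    (real_of_int d + \<alpha> * real w) * real n < (real_of_int d' + \<alpha> * real k) * real r"
  using assms by (simp add: alpha_slope_def divide_less_eq less_divide_eq flip: add_divide_distrib)

lemma Om_to_fract_iff: "Om m (to_fract p) \<longleftrightarrow> p = 0 \<or> int (degree p) \<le> m"
proof
  assume "p = 0 \<or> int (degree p) \<le> m"
  then show "Om m (to_fract p)"
    using Om_mono[OF Om_poly[of p "degree p"]] by (auto simp: Om_0)
qed (rule Om_to_fract)

section \<open>Stable systems on O(a)^n\<close>

lemma trivial_bundle_vec_bundle:
  "vec_bundle n (unitv :: nat \<Rightarrow> 'k::field vecK) (\<lambda>j. fscale (tt ^ a) (unitv j))"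
proof
  show "frame n n (unitv :: nat \<Rightarrow> 'k vecK)"
    by (auto simp: frame_iff indep_unitv intro: unitv_in_FS)
  have "fs.indep_fam n (\<lambda>j. fscale (tt ^ a) (unitv j) :: 'k vecK)"
    unfolding fs.indep_fam_def
  proof (intro allI impI)
    fix c :: "nat \<Rightarrow> 'k rf" and j
    assume s: "(\<Sum>j<n. fscale (c j) (fscale (tt ^ a) (unitv j))) = 0" and j: "j < n"
    then have "(\<Sum>j<n. fscale (c j * tt ^ a) (unitv j)) = 0" by simp
    then have "c j * tt ^ a = 0"
      using fs.indep_famD[OF indep_unitv, of "\<lambda>j. c j * tt ^ a" n j] j by blast
    then show "c j = 0" by simp
  qed
  then show "frame n n (\<lambda>j. fscale (tt ^ a) (unitv j) :: 'k vecK)"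
    by (auto simp: frame_iff intro: unitv_in_FS fs.subspace_scale[OF subspace_FS])
qed

text \<open>The frames e_j and t^a e_j glue to O(a)^n: sections of its twist by m are the polynomial
  vectors of degree at most m + a.\<close>

locale trivial_bundle =
  fixes n a :: nat and e0 einf :: "nat \<Rightarrow> 'k::field vecK"
  assumes e0_def: "e0 = unitv" and einf_def: "einf = (\<lambda>j. fscale (tt ^ a) (unitv j))"
begin

sublocale vec_bundle n e0 einf
  unfolding e0_def einf_def by (rule trivial_bundle_vec_bundle)

lemma Psi_apply: "Psi p i = (if i < n then to_fract (p i) else 0)"
  unfolding Psi_def unfolding e0_def by (rule sum_unitv)

lemma Lz_iff: "v \<in> Lz m \<longleftrightarrow> v \<in> FS {..<n} \<and> (\<forall>i<n. Om (m + int a) (v i))"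
proof
  assume "v \<in> Lz m"
  then obtain c where c': "v = (\<Sum>j<n. fscale (c j) (einf j))" "\<forall>j<n. Om m (c j)"
    unfolding Lz_def by blast
  then have c: "v = (\<Sum>j<n. fscale (c j * tt ^ a) (unitv j))" by (simp add: einf_def)
  have v: "v i = (if i < n then c i * tt ^ a else 0)" for i unfolding c by (rule sum_unitv)
  then show "v \<in> FS {..<n} \<and> (\<forall>i<n. Om (m + int a) (v i))"
    using c'(2) Om_power[of m a] by (auto simp: FS_def v mult.commute)
next
  assume v: "v \<in> FS {..<n} \<and> (\<forall>i<n. Om (m + int a) (v i))"
  have "v = (\<Sum>j<n. fscale (v j) (unitv j))"
    using v FS_expand[of "{..<n}" v] by simp
  also have "\<dots> = (\<Sum>j<n. fscale (v j / tt ^ a) (einf j))"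
    by (rule sum.cong) (auto simp: einf_def)
  finally have "v = (\<Sum>j<n. fscale (v j / tt ^ a) (einf j))" .
  moreover have "Om m (v j / tt ^ a)" if "j < n" for j
    using v that Om_power[of m a "v j / tt ^ a"] by simp
  ultimately show "v \<in> Lz m"
    unfolding Lz_def by (intro CollectI exI[of _ "\<lambda>j. v j / tt ^ a"]) blast
qed

lemma PP_iff: "p \<in> PP U m \<longleftrightarrow>
    (\<forall>i\<ge>n. p i = 0) \<and> Psi p \<in> U \<and> (\<forall>i. p i = 0 \<or> int (degree (p i)) \<le> m + int a)"
proof -
  have "(\<forall>i<n. Om (m + int a) (Psi p i)) \<longleftrightarrow> (\<forall>i<n. p i = 0 \<or> int (degree (p i)) \<le> m + int a)"
    by (simp add: Psi_apply Om_to_fract_iff)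
  then show ?thesis unfolding PP_def Lz_iff using Psi_mem by (auto simp: not_less) (metis not_less)
qed

lemma PP_degree_0:
  assumes "p \<in> PP U (- int a)"
  shows "degree (p i) = 0"
proof -
  have "p i = 0 \<or> int (degree (p i)) \<le> - int a + int a" using assms unfolding PP_iff by blast
  then show ?thesis by auto
qed

lemma dim_PP_below:
  assumes "fs.subspace U"
  shows "ps.dim (PP U (- int a - 1)) = 0"
proof -
  have "PP U (- int a - 1) \<subseteq> {0}" by (auto simp: PP_iff fun_eq_iff vec_apply)
  then have "PP U (- int a - 1) = {0}" using ps.subspace_0[OF subspace_PP[OF assms]] by blast
  then show ?thesis by (simp add: ps.dim_zero_set)
qed

text \<open>Semistability of O(a)^n: E(-a - 1) = O(-1)^n has no sections, and Riemann's inequality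
  at this twist reads d - ra <= 0.\<close>

lemma bdeg_le:
  assumes U: "fs.subspace U" "U \<subseteq> FS {..<n}" and r: "r = fs.dim U"
  shows "bdeg n e0 einf r U \<le> int r * int a"
  using bdeg_lower[OF U r, of "- int a - 1"] by (simp add: dim_PP_below[OF U(1)] algebra_simps)

lemma bdeg_full: "bdeg n e0 einf n (FS {..<n}) = int n * int a"
proof (rule antisym)
  have d: "n = fs.dim (FS {..<n} :: 'k vecK set)" by (simp add: dim_FS)
  show "bdeg n e0 einf n (FS {..<n}) \<le> int n * int a" by (rule bdeg_le[OF subspace_FS subset_refl d])
  define p :: "nat \<Rightarrow> nat \<Rightarrow> 'k poly" where "p j i = (if i = j then 1 else 0)" for i j
  have "ev0 (p j) = unitv j" for j by (auto simp: ev0_def p_def unitv_def fun_eq_iff)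
  then have ind: "fs.indep_fam n (\<lambda>j. Psi (p j))"
    by (intro indep_Psi) (auto simp: p_def indep_unitv)
  have "p j \<in> PP (FS {..<n}) (- int a)" if "j < n" for j
    using that Psi_mem by (auto simp: PP_iff p_def)
  then have "- int n * (- int a) \<le> bdeg n e0 einf n (FS {..<n})"
    by (rule bdeg_ge[OF subspace_FS subset_refl d _ ind])
  then show "int n * int a \<le> bdeg n e0 einf n (FS {..<n})" by simp
qed

text \<open>The hypothesis on dimensions says that F has maximal degree; the conclusion is then F =
  U0 tensor O(a) at the level of sections, with U0 = \<open>CC U (- int a)\<close>. As U0 already
  has the largest possible dimension, higher twists give no new values at t = 0. So one may subtract
  a constant section with the same value, divide by t and repeat.\<close>

lemma coeff_in_CC:
  assumes U: "fs.subspace U" "U \<subseteq> FS {..<n}" and d: "fs.dim U \<le> fs.dim (CC U (- int a))"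
    and p: "p \<in> PP U (- int a + int l)"
  shows "(\<lambda>i. coeff (p i) s) \<in> CC U (- int a)"
  using p
proof (induction l arbitrary: p s)
  case 0
  show ?case
  proof (cases s)
    case 0
    then show ?thesis using \<open>p \<in> PP U (- int a + int 0)\<close> by (auto simp: CC_def ev0_def)
  next
    case (Suc s')
    have "degree (p i) < s" for i using \<open>p \<in> PP U (- int a + int 0)\<close> Suc PP_degree_0[of p U i] by simp
    then have "(\<lambda>i. coeff (p i) s) = 0" by (auto simp: fun_eq_iff vec_apply coeff_eq_0)
    then show ?thesis using fs.subspace_0[OF subspace_CC[OF U(1)]] by simp
  qed
next
  case (Suc l)
  let ?m = "- int a + int l"
  have p: "p \<in> PP U (?m + 1)" using Suc.prems by (simp add: algebra_simps)
  have "CC U (- int a) = CC U (?m + 1)"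
    using dim_CC_le[OF U, of "?m + 1"] d
    by (intro fs.subspace_eq_fin_dim[OF fin_dim_CC subspace_CC[OF U(1)]] CC_mono) auto
  then have e: "ev0 p \<in> CC U (- int a)" using p by (auto simp: CC_def)
  then obtain p0 where p0: "p0 \<in> PP U (- int a)" "ev0 p0 = ev0 p" by (auto simp: CC_def)
  have p0': "p0 \<in> PP U (?m + 1)" using p0(1) PP_mono[of "- int a" "?m + 1"] by auto
  have diff: "p - p0 \<in> PP U (?m + 1)" by (rule ps.subspace_diff[OF subspace_PP[OF U(1)] p p0'])
  have "ev0 (p - p0) = 0" using p0(2) by (simp add: pf.linear_diff[OF linear_ev0])
  then obtain q where q: "q \<in> PP U ?m" "p - p0 = (\<lambda>i. monom 1 1 * q i)"
    by (rule ev0_eq_0[OF U(1) diff])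
  show ?case
  proof (cases s)
    case 0
    then show ?thesis using e by (simp add: ev0_def)
  next
    case (Suc s')
    have "coeff (p i) s = coeff (q i) s'" for i
    proof -
      have "degree (p0 i) < s" using PP_degree_0[OF p0(1)] Suc by simp
      then have "coeff (p0 i) s = 0" by (simp add: coeff_eq_0)
      moreover have "p i = p0 i + monom 1 1 * q i" using fun_cong[OF q(2), of i] by (simp add: algebra_simps)
      ultimately show ?thesis using Suc by (simp add: coeff_monom_mult)
    qed
    then show ?thesis using Suc.IH[OF q(1)] by simp
  qed
qed

text \<open>\<open>V\<close> consists of the polynomial vectors whose coefficient of t^s is
  \<open>A s c\<close>. For \<open>\<alpha>\<close> < 1/k a subbundle of degree below ra cannot make
  up the missing unit of degree by its sections. One of degree ra is U0 tensor O(a), and its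
  sections in \<open>V\<close> come from the preimage of U0, so stability of \<open>A\<close>
  applies.\<close>

lemma exists_stable_system:
  fixes A :: "nat \<Rightarrow> (nat \<Rightarrow> 'k) \<Rightarrow> nat \<Rightarrow> 'k"
  assumes A: "kron_stable (a + 1) k n A" and k: "0 < k" "0 < n"
  shows "\<exists>V. coherent_system n (int n * int a) k e0 einf V \<and> zero_plus_stable n e0 einf V"
proof -
  have linA: "Vector_Spaces.linear fscale fscale (A s)" for s
    using A by (simp add: kron_stable_def)
  have memA: "A s c \<in> FS {..<n}" if "s \<le> a" "c \<in> FS {..<k}" for s c
    using A that by (simp add: kron_stable_def)
  have injA: "c = 0" if "c \<in> FS {..<k}" "\<And>s. s \<le> a \<Longrightarrow> A s c = 0" for c
    using A that by (simp add: kron_stable_def)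
  have stA: "n * fs.dim {c \<in> FS {..<k}. \<forall>s<a + 1. A s c \<in> U} < k * fs.dim U"
    if "fs.subspace U" "U \<subseteq> FS {..<n}" "U \<noteq> {0}" "U \<noteq> FS {..<n}" for U
    using A that unfolding kron_stable_def by blast
  define G :: "(nat \<Rightarrow> 'k) \<Rightarrow> nat \<Rightarrow> 'k poly" where "G c = (\<lambda>i. \<Sum>s\<le>a. monom (A s c i) s)" for c
  have cG: "coeff (G c i) s = (if s \<le> a then A s c i else 0)" for c i s
  proof -
    have "coeff (G c i) s = (\<Sum>s'\<le>a. if s = s' then A s' c i else 0)"
      unfolding G_def coeff_sum by (rule sum.cong) auto
    then show ?thesis by simp
  qed
  have linG: "Vector_Spaces.linear fscale pscale G"
    by (rule fp.linear_intro)
      (auto simp: fun_eq_iff vec_apply poly_eq_iff cG ff.linear_add[OF linA] ff.linear_scale[OF linA])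
  have GP: "G c \<in> PP (FS {..<n}) 0" if c: "c \<in> FS {..<k}" for c
  proof -
    have "G c i = 0" if "i \<ge> n" for i
      using memA[OF _ c] that by (auto simp: poly_eq_iff cG FS_def)
    moreover have "degree (G c i) \<le> a" for i by (rule degree_le) (auto simp: cG)
    ultimately show ?thesis using Psi_mem by (auto simp: PP_iff)
  qed
  have injG: "c = 0" if c: "c \<in> FS {..<k}" "G c = 0" for c
  proof (rule injA[OF c(1)])
    fix s assume s: "s \<le> a"
    have "A s c i = 0" for i
    proof -
      have "coeff (G c i) s = 0" by (simp add: c(2) vec_apply)
      then show ?thesis using s by (simp add: cG)
    qed
    then show "A s c = 0" by (simp add: fun_eq_iff vec_apply)
  qed
  have fdk: "fs.fin_dim (FS {..<k} :: (nat \<Rightarrow> 'k) set)" by (simp add: dim_FS)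
  define S where "S = G ` FS {..<k}"
  have S: "ps.subspace S" "S \<subseteq> PP (FS {..<n}) 0" "ps.dim S = k"
  proof -
    show "ps.subspace S" unfolding S_def by (rule fp.linear_subspace_image[OF linG subspace_FS])
    show "S \<subseteq> PP (FS {..<n}) 0" using GP by (auto simp: S_def)
    show "ps.dim S = k"
      unfolding S_def using fp.dim_image_inj[OF linG subspace_FS fdk injG] by (simp add: dim_FS)
  qed
  define V where "V = Psi ` S"
  have V: "ks.subspace V" "V \<subseteq> H0 n e0 einf (FS {..<n}) 0" "kdim V = k" "ks.fin_dim V" "ks.dim V = k"
    unfolding V_def using S H0_eq[of "FS {..<n}" 0]
    by (auto simp: kdim_Psi_image[OF S(1,2)] dim_Psi_image[OF S(1,2)] fin_dim_Psi_image[OF S(1,2)]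
        pk.linear_subspace_image[OF linear_Psi S(1)])
  have "coherent_system n (int n * int a) k e0 einf V"
    unfolding coherent_system_def fullspace_eq ksubspace_iff
    using frame0 frame_inf bdeg_full V by simp
  moreover have "alpha_stable \<alpha> n e0 einf V" if \<alpha>: "0 < \<alpha>" "\<alpha> < 1 / real k" for \<alpha>
    unfolding alpha_stable_def fullspace_eq bdeg_full V(3) ksubspace_iff
  proof (intro allI impI)
    fix r u W
    assume h: "1 \<le> r \<and> r \<le> n \<and> frame n r u \<and> ks.subspace W \<and> W \<subseteq> V \<inter> Kspan r u \<and> (r < n \<or> W \<noteq> V)"
    define U where "U = Kspan r u"
    define d where "d = bdeg n e0 einf r U"
    define w where "w = kdim W"
    have U: "fs.subspace U" "U \<subseteq> FS {..<n}" and r: "r = fs.dim U"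
      using frame_Kspan[of n r u] h by (simp_all add: U_def)
    have r1: "1 \<le> r" "r \<le> n" using h by auto
    have dle: "d \<le> int r * int a" unfolding d_def by (rule bdeg_le[OF U r])
    have WV: "W \<subseteq> V" "W \<subseteq> U" "ks.subspace W" using h by (auto simp: U_def)
    have Wfd: "ks.fin_dim W" by (rule ks.fin_dim_subset[OF V(4) WV(1)])
    have w: "w = ks.dim W" by (simp add: w_def kdim_eq_dim[OF Wfd])
    have wk: "w \<le> k" unfolding w using ks.dim_subset_fin_dim[OF V(4) WV(1)] V(5) by simp
    have "(real_of_int d + \<alpha> * real w) * real n < (real_of_int (int n * int a) + \<alpha> * real k) * real r"
    proof (cases "d = int r * int a")
      case False
      then have "real_of_int d \<le> real_of_int (int r * int a - 1)"
        using dle by (simp only: of_int_le_iff)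
      then have "real_of_int d \<le> real r * real a - 1" by simp
      moreover have "\<alpha> * real w \<le> \<alpha> * real k" using wk \<alpha> by simp
      moreover have "\<alpha> * real k < 1" using \<alpha> k by (simp add: field_simps)
      ultimately have "real_of_int d + \<alpha> * real w < real r * real a" by linarith
      then have "(real_of_int d + \<alpha> * real w) * real n < real r * real a * real n" using k by simp
      moreover have "0 \<le> \<alpha> * real k * real r" using \<alpha> by simp
      ultimately show ?thesis by (simp add: algebra_simps)
    next
      case True
      \<comment> \<open>With maximal degree the degree terms cancel and \<open>\<alpha>\<close> can
        be divided out. For r = n, properness of the subsystem means that \<open>W\<close> is
        smaller than \<open>V\<close>.\<close>
      have "n * w < k * r"
      proof (cases "r = n")
        case True
        then have "W \<noteq> V" using h by simp
        then have "w < k"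
          using ks.subspace_eq_fin_dim[OF V(4) WV(3,1)] V(5) unfolding w by linarith
        then show ?thesis using True k by simp
      next
        case False
        then have rn: "r < n" using r1 by simp
        define U0 where "U0 = CC U (- int a)"
        \<comment> \<open>Riemann's inequality at twist -a gives r sections. They are determined by
          their values at 0, because there are none at twist -a - 1.\<close>
        have "bdeg n e0 einf r U + int r * (- int a + 1) \<le> int (ps.dim (PP U (- int a)))"
          by (rule bdeg_lower[OF U r])
        then have "r \<le> ps.dim (PP U (- int a))"
          using True unfolding d_def by (simp add: algebra_simps)
        also have "ps.dim (PP U (- int a)) = fs.dim U0"
          using dim_PP_step[OF U(1), of "- int a - 1"] dim_PP_below[OF U(1)] by (simp add: U0_def)
        finally have d1: "r \<le> fs.dim U0" .
        then have d0: "fs.dim U0 = r" using dim_CC_le[OF U, of "- int a"] r by (simp add: U0_def)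
        have sU0: "fs.subspace U0" "U0 \<subseteq> FS {..<n}" using subspace_CC[OF U(1)] CC_FS by (auto simp: U0_def)
        have ne: "U0 \<noteq> {0}" "U0 \<noteq> FS {..<n}"
        proof -
          show "U0 \<noteq> {0}" using d0 r1 fs.dim_zero_set by (metis not_one_le_zero)
          show "U0 \<noteq> FS {..<n}"
          proof
            assume "U0 = FS {..<n}"
            then have "fs.dim U0 = n" by (simp add: dim_FS)
            then show False using d0 rn by simp
          qed
        qed
        let ?C = "{c \<in> FS {..<k}. \<forall>s<a + 1. A s c \<in> U0}"
        have Cs: "fs.subspace ?C" by (rule subspace_kron_preimage[OF linA sU0(1)])
        have Cfd: "fs.fin_dim ?C" by (rule fs.fin_dim_subset[OF fdk]) auto
        have "W \<subseteq> Psi ` G ` ?C"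
        proof
          fix v assume v: "v \<in> W"
          then obtain c where c: "c \<in> FS {..<k}" "v = Psi (G c)" using WV by (auto simp: V_def S_def)
          have "G c \<in> PP U 0" using GP[OF c(1)] v WV(2) c(2) by (auto simp: PP_def)
          then have Gc: "G c \<in> PP U (- int a + int a)" by simp
          have "fs.dim U \<le> fs.dim (CC U (- int a))" using d1 r by (simp add: U0_def)
          from coeff_in_CC[OF U this Gc] have cf: "(\<lambda>i. coeff (G c i) s) \<in> U0" for s
            unfolding U0_def .
          have "A s c \<in> U0" if "s < a + 1" for s using cf[of s] that by (simp add: cG)
          then show "v \<in> Psi ` G ` ?C" using c by blast
        qed
        moreover have fd1: "ps.fin_dim (G ` ?C)" by (rule fp.fin_dim_image[OF linG Cfd])
        ultimately have "w \<le> ks.dim (Psi ` G ` ?C)"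
          unfolding w by (intro ks.dim_subset_fin_dim pk.fin_dim_image[OF linear_Psi])
        also have "\<dots> \<le> ps.dim (G ` ?C)"
          by (rule pk.dim_image_le_fin_dim[OF linear_Psi fp.linear_subspace_image[OF linG Cs] fd1])
        also have "\<dots> \<le> fs.dim ?C" by (rule fp.dim_image_le_fin_dim[OF linG Cs Cfd])
        finally have "n * w \<le> n * fs.dim ?C" by simp
        also have "\<dots> < k * r" using stA[OF sU0 ne] d0 by simp
        finally show ?thesis .
      qed
      then have "real (n * w) < real (k * r)" by (simp only: of_nat_less_iff)
      then have "\<alpha> * (real n * real w) < \<alpha> * (real k * real r)" using \<alpha> by simp
      then show ?thesis using True by (simp add: algebra_simps)
    qed
    then show "alpha_slope \<alpha> (bdeg n e0 einf r (Kspan r u)) r (kdim W) < alpha_slope \<alpha> (int n * int a) n k"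
      using alpha_slope_less_iff[of r n \<alpha> d w "int n * int a" k] r1 k by (simp add: d_def U_def w_def)
  qed
  then have "zero_plus_stable n e0 einf V"
    unfolding zero_plus_stable_def using k by (intro exI[of _ "1 / real k"]) auto
  ultimately show ?thesis by blast
qed

end

section \<open>From stable systems to stable Kronecker modules\<close>

context vec_bundle
begin

text \<open>A nonzero section of E(-a - 1) would span a line subbundle of degree at least a + 1.
  Already with no sections selected, it would violate stability as soon as \<open>\<alpha>\<close> k
  < 1.\<close>

lemma stable_no_sections_below:
  assumes cs: "coherent_system n (int n * a) k e0 einf V" and st: "zero_plus_stable n e0 einf V"
    and k: "0 < k" "1 < n"
  shows "PP (FS {..<n}) (- a - 1) \<subseteq> {0}"
proof (rule ccontr)
  assume "\<not> ?thesis"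
  then obtain p where p: "p \<in> PP (FS {..<n}) (- a - 1)" "p \<noteq> 0" by blast
  have full: "bdeg n e0 einf n (fullspace n) = int n * a" "kdim V = k" "ksubspace V"
    using cs by (auto simp: coherent_system_def)
  define u :: "nat \<Rightarrow> 'k vecK" where "u = (\<lambda>_. Psi p)"
  have P0: "Psi p \<noteq> 0"
  proof
    assume "Psi p = 0"
    then have "p = 0" by (intro Psi_eq_0) (use p in \<open>auto simp: PP_def\<close>)
    then show False using p(2) by simp
  qed
  have ind: "fs.indep_fam 1 u" using P0 by (simp add: fs.indep_fam_def u_def)
  have fr: "frame n 1 u" using ind Psi_mem by (simp add: frame_iff u_def)
  define U where "U = Kspan 1 u"
  have U: "fs.subspace U" "U \<subseteq> FS {..<n}" "1 = fs.dim U"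
    using frame_Kspan[OF fr] by (simp_all add: U_def)
  have "Psi p \<in> U" using in_Kspan[of 0 1 u] by (simp add: U_def u_def)
  then have pU: "p \<in> PP U (- a - 1)" using p by (simp add: PP_def)
  have "- int 1 * (- a - 1) \<le> bdeg n e0 einf 1 U"
    by (rule bdeg_ge[OF U, of "\<lambda>_. p"]) (use pU ind in \<open>auto simp: u_def\<close>)
  then have deg: "a + 1 \<le> bdeg n e0 einf 1 U" by simp
  obtain \<alpha>0 where \<alpha>0: "\<alpha>0 > 0" "\<And>\<alpha>. 0 < \<alpha> \<Longrightarrow> \<alpha> < \<alpha>0 \<Longrightarrow> alpha_stable \<alpha> n e0 einf V"
    using st by (auto simp: zero_plus_stable_def)
  \<comment> \<open>Halving makes both bounds strict: \<open>\<alpha>\<close> must be admissible for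
    stability and satisfy \<open>\<alpha>\<close> k < 1.\<close>
  define \<alpha> where "\<alpha> = min \<alpha>0 (1 / real k) / 2"
  have \<alpha>: "0 < \<alpha>" "\<alpha> < \<alpha>0" "\<alpha> * real k < 1"
  proof -
    show "0 < \<alpha>" "\<alpha> < \<alpha>0" using \<alpha>0 k by (auto simp: \<alpha>_def)
    have "\<alpha> \<le> (1 / real k) / 2" unfolding \<alpha>_def by (rule divide_right_mono) auto
    then show "\<alpha> * real k < 1" using k by (simp add: field_simps)
  qed
  have z: "kdim {0 :: 'k vecK} = 0" by (simp add: kdim_eq_dim[OF ks.fin_dim_zero] ks.dim_zero_set)
  have "{0} \<subseteq> V \<inter> Kspan 1 u"
    using full(3) U(1) ks.subspace_0 fs.subspace_0 by (auto simp: ksubspace_iff U_def)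
  moreover have "ksubspace {0 :: 'k vecK}" by (simp add: ksubspace_iff ks.subspace_single_0)
  ultimately have "alpha_slope \<alpha> (bdeg n e0 einf 1 U) 1 0 < alpha_slope \<alpha> (int n * a) n k"
    using \<alpha>0(2)[OF \<alpha>(1,2)] fr k unfolding alpha_stable_def full(1,2) U_def z[symmetric]
    by (elim allE[of _ 1] allE[of _ u] allE[of _ "{0}"]) auto
  then have "real_of_int (bdeg n e0 einf 1 U) * real n < real n * real_of_int a + \<alpha> * real k"
    using alpha_slope_less_iff[of 1 n] k by simp
  moreover have "(real_of_int a + 1) * real n \<le> real_of_int (bdeg n e0 einf 1 U) * real n"
  proof (rule mult_right_mono)
    have "real_of_int (a + 1) \<le> real_of_int (bdeg n e0 einf 1 U)" using deg by (simp only: of_int_le_iff)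
    then show "real_of_int a + 1 \<le> real_of_int (bdeg n e0 einf 1 U)" by simp
  qed simp
  ultimately have "real n < \<alpha> * real k" by (simp add: algebra_simps)
  then show False using \<alpha>(3) k by simp
qed

text \<open>The sections \<open>q i\<close> of E(-a) with the unit vectors as values at 0 identify E
  with O(a)^n. In these coordinates \<open>V\<close> is a space of polynomial vectors of degree at
  most a, and the arrows read off coefficients. A subspace \<open>U'\<close> of k^n spans a
  subbundle of degree at least ra, for which stability yields the required inequality.\<close>

lemma stable_imp_kron_stable:
  assumes cs: "coherent_system n (int n * a) k e0 einf V" and st: "zero_plus_stable n e0 einf V"
    and k: "0 < k" "1 < n"
  shows "0 \<le> a" and "\<exists>A :: nat \<Rightarrow> (nat \<Rightarrow> 'k) \<Rightarrow> nat \<Rightarrow> 'k. kron_stable (nat a + 1) k n A"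
proof -
  define F :: "'k vecK set" where "F = FS {..<n}"
  have F: "fs.subspace F" "F \<subseteq> FS {..<n}" "n = fs.dim F"
    by (auto simp: F_def subspace_FS dim_FS)
  have full: "bdeg n e0 einf n (fullspace n) = int n * a" "kdim V = k" "ks.subspace V"
    "V \<subseteq> Psi ` PP F 0"
    using cs H0_eq[of F 0] by (auto simp: coherent_system_def ksubspace_iff fullspace_eq F_def)
  have Vfd: "ks.fin_dim V"
    by (rule ks.fin_dim_subset[OF pk.fin_dim_image[OF linear_Psi fin_dim_PP] full(4)])
  have Vdim: "ks.dim V = k" using kdim_eq_dim[OF Vfd] full(2) by simp
  have below: "PP F (- a - 1) = {0}"
    using stable_no_sections_below[OF cs st k] ps.subspace_0[OF subspace_PP[OF F(1)]]
    unfolding F_def by blast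
  \<comment> \<open>For negative a the sections of E lie among those of E(-a - 1), which vanish,
    although \<open>V\<close> has positive dimension.\<close>
  show a: "0 \<le> a"
  proof (rule ccontr)
    assume "\<not> 0 \<le> a"
    then have "PP F 0 \<subseteq> PP F (- a - 1)" by (intro PP_mono) simp
    then have "V \<subseteq> {0}" using full(4) below pk.linear_0[OF linear_Psi] by auto
    then have "ks.dim V \<le> ks.dim {0 :: 'k vecK}" by (rule ks.dim_subset_fin_dim[OF ks.fin_dim_zero])
    then show False using Vdim k by (simp add: ks.dim_zero_set)
  qed
  define b where "b = nat a"
  have ab: "a = int b" using a by (simp add: b_def)
  \<comment> \<open>Riemann's inequality provides n sections of E(-a), and none of them vanishes at
    0 because E(-a - 1) has no sections.\<close>
  have CCfull: "CC F (- a) = FS {..<n}"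
  proof (rule fs.subspace_eq_fin_dim[OF _ subspace_CC[OF F(1)] CC_FS])
    have "bdeg n e0 einf n F + int n * (- a + 1) \<le> int (ps.dim (PP F (- a)))"
      by (rule bdeg_lower[OF F])
    moreover have "bdeg n e0 einf n F = int n * a" using full(1) by (simp add: F_def fullspace_eq)
    moreover have "ps.dim (PP F (- a)) = fs.dim (CC F (- a))"
      using dim_PP_step[OF F(1), of "- a - 1"] by (simp add: below ps.dim_zero_set)
    ultimately show "fs.dim (FS {..<n} :: (nat \<Rightarrow> 'k) set) \<le> fs.dim (CC F (- a))"
      by (simp add: dim_FS algebra_simps)
  qed (simp add: dim_FS)
  have "\<exists>q. q \<in> PP F (- a) \<and> ev0 q = unitv i" if "i < n" for i
  proof -
    have "unitv i \<in> CC F (- a)" unfolding CCfull using that by (intro unitv_in_FS) simp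
    then show ?thesis by (auto simp: CC_def)
  qed
  then obtain q where q: "\<And>i. i < n \<Longrightarrow> q i \<in> PP F (- a)" "\<And>i. i < n \<Longrightarrow> ev0 (q i) = unitv i"
    by metis
  define Om' :: "(nat \<Rightarrow> 'k poly) \<Rightarrow> nat \<Rightarrow> 'k poly" where "Om' g = (\<lambda>i. \<Sum>j<n. g j * q j i)" for g
  have linO: "Vector_Spaces.linear pscale pscale Om'"
    by (rule pp.linear_intro)
      (auto simp: Om'_def fun_eq_iff vec_apply algebra_simps sum.distrib smult_sum_right)
  \<comment> \<open>Subtract the constant combination of the \<open>q j\<close> with the same value
    at t = 0; the difference is t times a section of the next lower twist. The recursion ends at -a
    - 1, where only zero is left. This is the identification of E with O(a)^n.\<close>
  have gen: "\<exists>g. (\<forall>j s. l \<le> s \<longrightarrow> coeff (g j) s = 0) \<and> p = Om' g" if "p \<in> PP F (- a - 1 + int l)" for l p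
    using that
  proof (induction l arbitrary: p)
    case 0
    then have "p = 0" using below by simp
    then show ?case by (intro exI[of _ "\<lambda>_. 0"]) (simp add: Om'_def zero_fun_def)
  next
    case (Suc l)
    let ?m = "- a - 1 + int l"
    have p: "p \<in> PP F (?m + 1)" using Suc.prems by (simp add: algebra_simps)
    define p' where "p' = Om' (\<lambda>j. [:ev0 p j:])"
    have "pscale (ev0 p j) (q j) \<in> PP F (?m + 1)" if "j < n" for j
    proof -
      have "q j \<in> PP F (?m + 1)" using q(1)[OF that] PP_mono[of "- a" "?m + 1"] by auto
      then show ?thesis by (rule ps.subspace_scale[OF subspace_PP[OF F(1)]])
    qed
    then have "(\<Sum>j<n. pscale (ev0 p j) (q j)) \<in> PP F (?m + 1)"
      by (intro ps.subspace_sum[OF subspace_PP[OF F(1)]]) auto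
    moreover have p'_eq: "p' = (\<Sum>j<n. pscale (ev0 p j) (q j))"
      by (auto simp: p'_def Om'_def fun_eq_iff sum_fun_apply vec_apply)
    ultimately have p': "p' \<in> PP F (?m + 1)" by simp
    have "ev0 p' = (\<Sum>j<n. fscale (ev0 p j) (unitv j))"
      unfolding p'_eq by (simp add: pf.linear_sum[OF linear_ev0] pf.linear_scale[OF linear_ev0] q(2))
    also have "\<dots> = ev0 p"
      using CC_FS[of F "?m + 1"] p by (intro FS_expand[symmetric]) (auto simp: CC_def)
    finally have "ev0 (p - p') = 0" by (simp add: pf.linear_diff[OF linear_ev0])
    moreover have "p - p' \<in> PP F (?m + 1)" by (rule ps.subspace_diff[OF subspace_PP[OF F(1)] p p'])
    ultimately obtain p2 where p2: "p2 \<in> PP F ?m" "p - p' = (\<lambda>i. monom 1 1 * p2 i)"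
      using ev0_eq_0[OF F(1), of "p - p'" ?m] by blast
    obtain g where g: "\<forall>j s. l \<le> s \<longrightarrow> coeff (g j) s = 0" "p2 = Om' g" using Suc.IH[OF p2(1)] by blast
    have "p i = Om' (\<lambda>j. pCons (ev0 p j) (g j)) i" for i
    proof -
      have "p i = p' i + monom 1 1 * p2 i" using fun_cong[OF p2(2), of i] by (simp add: algebra_simps)
      also have "\<dots> = (\<Sum>j<n. [:ev0 p j:] * q j i + monom 1 1 * (g j * q j i))"
        unfolding g(2) p'_def Om'_def by (simp only: sum.distrib sum_distrib_left)
      also have "\<dots> = (\<Sum>j<n. pCons (ev0 p j) (g j) * q j i)"
      proof (rule sum.cong)
        fix j
        have "pCons (ev0 p j) (g j) = [:ev0 p j:] + monom 1 1 * g j"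
          by (rule poly_eqI) (auto simp: coeff_pCons coeff_monom_mult split: nat.splits)
        then show "[:ev0 p j:] * q j i + monom 1 1 * (g j * q j i) = pCons (ev0 p j) (g j) * q j i"
          by (simp only: distrib_right mult.assoc)
      qed simp
      finally show ?thesis by (simp add: Om'_def)
    qed
    then have "p = Om' (\<lambda>j. pCons (ev0 p j) (g j))" by blast
    moreover have "\<forall>j s. Suc l \<le> s \<longrightarrow> coeff (pCons (ev0 p j) (g j)) s = 0"
      using g(1) by (auto simp: coeff_pCons split: nat.splits)
    ultimately show ?case by (intro exI[of _ "\<lambda>j. pCons (ev0 p j) (g j)"]) blast
  qed
  have qind: "fs.indep_fam n (\<lambda>j. Psi (q j))"
  proof (rule indep_Psi)
    show "q j i = 0" if "j < n" "i \<ge> n" for i j using q(1)[OF that(1)] that by (simp add: PP_def)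
    show "fs.indep_fam n (\<lambda>j. ev0 (q j))"
      using indep_unitv[of n, where ?'k = 'k] q(2) unfolding fs.indep_fam_def by simp
  qed
  define Th where "Th g = Psi (Om' g)" for g
  have linT: "Vector_Spaces.linear pscale kscale Th"
    unfolding Th_def
    by (rule pk.linear_intro) (simp_all add: pp.linear_add[OF linO] pk.linear_add[OF linear_Psi]
        pp.linear_scale[OF linO] pk.linear_scale[OF linear_Psi])
  have injT: "g = 0" if g: "g \<in> PV n b" "Th g = 0" for g
  proof
    fix j
    have "(\<Sum>j<n. fscale (to_fract (g j)) (Psi (q j))) = 0"
      using g(2) by (simp add: Th_def Om'_def Psi_comb)
    then show "g j = 0 j"
      using fs.indep_famD[OF qind, of "\<lambda>j. to_fract (g j)" j] g(1) by (cases "j < n") (auto simp: PV_def vec_apply)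
  qed
  \<comment> \<open>\<open>V\<close> transported to polynomial coordinates with respect to the
    \<open>q j\<close>; the degree bound \<open>b\<close> comes from \<open>gen\<close> at twist
    0.\<close>
  define Vs where "Vs = {g \<in> PV n b. Th g \<in> V}"
  have Vs_sub: "ps.subspace Vs"
    using ps.subspace_inter[OF subspace_PV pk.linear_subspace_vimage[OF linT full(3)]]
    by (simp add: Vs_def vimage_def Int_def)
  have Vs_PV: "Vs \<subseteq> PV n b" by (auto simp: Vs_def)
  have Vs_fd: "ps.fin_dim Vs" by (rule ps.fin_dim_subset[OF dim_PV(1) Vs_PV])
  have ThVs: "Th ` Vs = V"
  proof (intro equalityI subsetI)
    fix v assume v: "v \<in> V"
    then obtain p where p: "p \<in> PP F 0" "v = Psi p" using full(4) by blast
    then have "p \<in> PP F (- a - 1 + int (b + 1))" using ab by simp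
    then obtain g where g: "\<forall>j s. b + 1 \<le> s \<longrightarrow> coeff (g j) s = 0" "p = Om' g" using gen by blast
    define g' where "g' j = (if j < n then g j else 0)" for j
    have "degree (g' j) \<le> b" for j by (rule degree_le) (use g(1) in \<open>auto simp: g'_def\<close>)
    then have "g' \<in> PV n b" by (auto simp: PV_def g'_def)
    moreover have "Om' g' = p" unfolding g(2) by (auto simp: Om'_def g'_def fun_eq_iff intro!: sum.cong)
    then have "Th g' = v" using p by (simp add: Th_def)
    ultimately show "v \<in> Th ` Vs" using v by (auto simp: Vs_def)
  qed (auto simp: Vs_def)
  have Vs_dim: "ps.dim Vs = k"
  proof -
    have "ks.dim (Th ` Vs) = ps.dim Vs"
      by (rule pk.dim_image_inj[OF linT Vs_sub Vs_fd]) (use injT Vs_PV in blast)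
    then show ?thesis using ThVs Vdim by simp
  qed
  obtain v where v: "ps.indep_fam k v" "\<And>j. j < k \<Longrightarrow> v j \<in> Vs"
    using ps.basis_fam[OF Vs_fd] unfolding Vs_dim by metis
  define be where "be c = (\<Sum>j<k. pscale (c j) (v j))" for c
  have linb: "Vector_Spaces.linear fscale pscale be"
    by (rule fp.linear_intro)
      (simp_all add: be_def vec_apply ps.scale_left_distrib sum.distrib ps.scale_sum_right)
  have be_mem: "be c \<in> Vs" for c
    unfolding be_def using v(2)
    by (intro ps.subspace_sum[OF Vs_sub] ps.subspace_scale[OF Vs_sub]) auto
  have be_inj: "c = 0" if c: "c \<in> FS {..<k}" "be c = 0" for c
  proof
    fix j show "c j = 0 j"
      using ps.indep_famD[OF v(1), of c j] c by (cases "j < k") (auto simp: be_def FS_def vec_apply)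
  qed
  \<comment> \<open>A basis of \<open>Vs\<close> identifies k^k with \<open>V\<close>, and the s-th
    arrow takes the coefficient of t^s.\<close>
  define A :: "nat \<Rightarrow> (nat \<Rightarrow> 'k) \<Rightarrow> nat \<Rightarrow> 'k" where "A s c = (\<lambda>i. coeff (be c i) s)" for s c
  have linA: "Vector_Spaces.linear fscale fscale (A s)" for s
    by (rule ff.linear_intro)
      (auto simp: A_def fp.linear_add[OF linb] fp.linear_scale[OF linb] fun_eq_iff vec_apply)
  have memA: "A s c \<in> FS {..<n}" for s c
    using be_mem[of c] Vs_PV by (auto simp: A_def FS_def PV_def)
  have coeff_big: "coeff (be c i) s = 0" if "\<not> s < b + 1" for c i s
  proof -
    have "degree (be c i) \<le> b" using be_mem[of c] Vs_PV by (auto simp: PV_def)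
    then show ?thesis using that by (intro coeff_eq_0) simp
  qed
  have injA: "c = 0" if c: "c \<in> FS {..<k}" "\<forall>s<b + 1. A s c = 0" for c
  proof (rule be_inj[OF c(1)])
    have "coeff (be c i) s = 0" for i s
    proof (cases "s < b + 1")
      case True
      then have "A s c i = 0" using c(2) by (simp add: vec_apply)
      then show ?thesis by (simp add: A_def)
    qed (rule coeff_big)
    then show "be c = 0" by (simp add: fun_eq_iff vec_apply poly_eq_iff)
  qed
  obtain \<alpha>0 where \<alpha>0: "\<alpha>0 > 0" "\<And>\<alpha>. 0 < \<alpha> \<Longrightarrow> \<alpha> < \<alpha>0 \<Longrightarrow> alpha_stable \<alpha> n e0 einf V"
    using st by (auto simp: zero_plus_stable_def)
  have stA: "n * fs.dim {c \<in> FS {..<k}. \<forall>s<b + 1. A s c \<in> U'} < k * fs.dim U'"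
    if U': "fs.subspace U'" "U' \<subseteq> FS {..<n}" "U' \<noteq> {0}" "U' \<noteq> FS {..<n}" for U'
  proof -
    define r where "r = fs.dim U'"
    have fdn: "fs.fin_dim (FS {..<n} :: (nat \<Rightarrow> 'k) set)" by (simp add: dim_FS)
    have U'fd: "fs.fin_dim U'" by (rule fs.fin_dim_subset[OF fdn U'(2)])
    have "r \<noteq> 0" using fs.fin_dim_dim_0[OF U'fd] U'(3) fs.subspace_0[OF U'(1)] by (auto simp: r_def)
    then have r1: "1 \<le> r" by simp
    have "fs.dim (FS {..<n} :: (nat \<Rightarrow> 'k) set) = n" by (simp add: dim_FS)
    then have rn: "r < n" using fs.subspace_eq_fin_dim[OF fdn U'(1,2)] U'(4) unfolding r_def by linarith
    obtain w where w: "fs.indep_fam r w" "\<And>j. j < r \<Longrightarrow> w j \<in> U'"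
      "\<And>y. y \<in> U' \<Longrightarrow> \<exists>c. y = (\<Sum>j<r. fscale (c j) (w j))"
      using fs.basis_fam[OF U'fd] unfolding r_def by metis
    \<comment> \<open>A basis vector of \<open>U'\<close> becomes the section of E(-a) with these
      constant coordinates. These sections span U' tensor O(a) inside E.\<close>
    define p where "p j = Om' (\<lambda>i. [:w j i:])" for j
    have p_eq: "p j = (\<Sum>i<n. pscale (w j i) (q i))" for j
      by (auto simp: p_def Om'_def fun_eq_iff sum_fun_apply vec_apply)
    have pP: "p j \<in> PP F (- a)" for j
      unfolding p_eq using q(1)
      by (intro ps.subspace_sum[OF subspace_PP[OF F(1)]] ps.subspace_scale[OF subspace_PP[OF F(1)]]) auto
    have ev: "ev0 (p j) = w j" if "j < r" for j
    proof -
      have "ev0 (p j) = (\<Sum>i<n. fscale (w j i) (unitv i))"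
        unfolding p_eq by (simp add: pf.linear_sum[OF linear_ev0] pf.linear_scale[OF linear_ev0] q(2))
      also have "\<dots> = w j" using w(2)[OF that] U'(2) by (intro FS_expand[symmetric]) auto
      finally show ?thesis .
    qed
    define u where "u j = Psi (p j)" for j
    have uind: "fs.indep_fam r u"
      unfolding u_def
    proof (rule indep_Psi)
      show "p j i = 0" if "i \<ge> n" for i j using pP[of j] that by (simp add: PP_def)
      show "fs.indep_fam r (\<lambda>j. ev0 (p j))" using w(1) ev unfolding fs.indep_fam_def by simp
    qed
    have fr: "frame n r u" using uind Psi_mem by (simp add: frame_iff u_def)
    define U where "U = Kspan r u"
    have U: "fs.subspace U" "U \<subseteq> FS {..<n}" "r = fs.dim U"
      using frame_Kspan[OF fr] by (simp_all add: U_def)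
    have "p j \<in> PP U (- a)" if "j < r" for j
      using pP[of j] in_Kspan[OF that, of u] by (auto simp: PP_def U_def u_def)
    then have "- int r * (- a) \<le> bdeg n e0 einf r U"
      using uind unfolding u_def by (intro bdeg_ge[OF U]) auto
    then have deg: "int r * a \<le> bdeg n e0 einf r U" by simp
    define C where "C = {c \<in> FS {..<k}. \<forall>s<b + 1. A s c \<in> U'}"
    have Cs: "fs.subspace C" unfolding C_def by (rule subspace_kron_preimage[OF linA U'(1)])
    have fdk: "fs.fin_dim (FS {..<k} :: (nat \<Rightarrow> 'k) set)" by (simp add: dim_FS)
    have Cfd: "fs.fin_dim C" by (rule fs.fin_dim_subset[OF fdk]) (auto simp: C_def)
    have bC: "ps.subspace (be ` C)" "ps.fin_dim (be ` C)" "ps.dim (be ` C) = fs.dim C"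
      using fp.linear_subspace_image[OF linb Cs] fp.fin_dim_image[OF linb Cfd]
        fp.dim_image_inj[OF linb Cs Cfd] be_inj by (auto simp: C_def)
    define W where "W = Th ` be ` C"
    have Wfd: "ks.fin_dim W" unfolding W_def by (rule pk.fin_dim_image[OF linT bC(2)])
    have "ks.dim W = ps.dim (be ` C)"
      unfolding W_def
      by (rule pk.dim_image_inj[OF linT bC(1,2)]) (use injT be_mem Vs_PV in blast)
    then have Wdim: "kdim W = fs.dim C" using bC(3) kdim_eq_dim[OF Wfd] by simp
    have Ws: "ksubspace W"
      unfolding W_def ksubspace_iff by (rule pk.linear_subspace_image[OF linT bC(1)])
    have "W \<subseteq> V" using ThVs be_mem by (auto simp: W_def)
    moreover have "W \<subseteq> U"
    proof
      fix y assume "y \<in> W"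
      then obtain c where c: "c \<in> C" "y = Th (be c)" by (auto simp: W_def)
      have "\<exists>x. A s c = (\<Sum>j<r. fscale (x j) (w j))" if "s < b + 1" for s
        using c(1) w(3) that by (auto simp: C_def)
      then obtain x where x: "\<And>s. s < b + 1 \<Longrightarrow> A s c = (\<Sum>j<r. fscale (x s j) (w j))" by metis
      \<comment> \<open>All coefficient vectors of \<open>be c\<close> lie in \<open>U'\<close>.
        Collecting their coordinates in the basis \<open>w\<close> over all powers of t gives the
        polynomials that express y through \<open>u\<close>.\<close>
      define h where "h j = (\<Sum>s<b + 1. monom (x s j) s)" for j
      have ch: "coeff (h j) s = (if s < b + 1 then x s j else 0)" for j s
      proof -
        have "coeff (h j) s = (\<Sum>s'<b + 1. if s = s' then x s' j else 0)"
          unfolding h_def coeff_sum by (rule sum.cong) auto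
        then show ?thesis by simp
      qed
      have be_h: "be c i = (\<Sum>j<r. h j * [:w j i:])" for i
      proof (rule poly_eqI)
        fix s
        have "coeff (\<Sum>j<r. h j * [:w j i:]) s = (\<Sum>j<r. coeff (h j) s * w j i)"
          unfolding coeff_sum by (rule sum.cong) (auto simp: mult.commute)
        also have "\<dots> = coeff (be c i) s"
        proof (cases "s < b + 1")
          case True
          have "coeff (be c i) s = A s c i" by (simp add: A_def)
          also have "\<dots> = (\<Sum>j<r. x s j * w j i)" using x[OF True] by (simp add: sum_fun_apply vec_apply)
          finally show ?thesis using True by (simp add: ch)
        qed (simp add: ch coeff_big)
        finally show "coeff (be c i) s = coeff (\<Sum>j<r. h j * [:w j i:]) s" by simp
      qed
      have "Om' (be c) = (\<lambda>i. \<Sum>j<r. h j * p j i)"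
      proof
        fix i
        have "Om' (be c) i = (\<Sum>l<n. \<Sum>j<r. h j * ([:w j l:] * q l i))"
          unfolding Om'_def be_h by (simp only: sum_distrib_right mult.assoc)
        also have "\<dots> = (\<Sum>j<r. h j * p j i)"
          unfolding p_def Om'_def sum_distrib_left by (rule sum.swap)
        finally show "Om' (be c) i = (\<Sum>j<r. h j * p j i)" .
      qed
      then have "y = (\<Sum>j<r. fscale (to_fract (h j)) (u j))"
        using c(2) by (simp add: Th_def Psi_comb u_def)
      then show "y \<in> U"
        unfolding U_def Kspan_def Kcomb_eq by (intro CollectI exI[of _ "\<lambda>j. to_fract (h j)"]) simp
    qed
    ultimately have W: "W \<subseteq> V \<inter> Kspan r u" by (simp add: U_def)
    define \<alpha> where "\<alpha> = \<alpha>0 / 2"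
    have \<alpha>: "0 < \<alpha>" "\<alpha> < \<alpha>0" using \<alpha>0 by (auto simp: \<alpha>_def)
    have "alpha_slope \<alpha> (bdeg n e0 einf r U) r (fs.dim C) < alpha_slope \<alpha> (int n * a) n k"
      using \<alpha>0(2)[OF \<alpha>] fr Ws W r1 rn unfolding alpha_stable_def full(1,2) U_def Wdim[symmetric]
      by (elim allE[of _ r] allE[of _ u] allE[of _ W]) auto
    then have "(real_of_int (bdeg n e0 einf r U) + \<alpha> * real (fs.dim C)) * real n
        < (real_of_int (int n * a) + \<alpha> * real k) * real r"
      using alpha_slope_less_iff[of r n] r1 k by simp
    moreover have "real r * real_of_int a * real n \<le> real_of_int (bdeg n e0 einf r U) * real n"
    proof (rule mult_right_mono)
      have "real_of_int (int r * a) \<le> real_of_int (bdeg n e0 einf r U)" using deg by (simp only: of_int_le_iff)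
      then show "real r * real_of_int a \<le> real_of_int (bdeg n e0 einf r U)" by simp
    qed simp
    ultimately have "\<alpha> * (real n * real (fs.dim C)) < \<alpha> * (real k * real r)"
      by (simp add: algebra_simps)
    then have "real n * real (fs.dim C) < real k * real r" using \<alpha> by simp
    then have "real (n * fs.dim C) < real (k * r)" by simp
    then have "n * fs.dim C < k * r" by (simp only: of_nat_less_iff)
    then show ?thesis by (simp add: C_def r_def)
  qed
  have "kron_stable (b + 1) k n A"
    unfolding kron_stable_def using linA memA injA stA by blast
  then show "\<exists>A :: nat \<Rightarrow> (nat \<Rightarrow> 'k) \<Rightarrow> nat \<Rightarrow> 'k. kron_stable (nat a + 1) k n A"
    unfolding b_def by blast
qed

end

text \<open>Multiplication by n clears the denominator, and collecting the terms gives the Tits form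
  of the dimension vector (k, n) with a + 1 arrows.\<close>

lemma numerical_condition_iff:
  fixes n k :: nat and a :: int
  assumes "0 < n"
  shows "real k * real_of_int a \<ge> real n - real k + (real k ^ 2 - 1) / real n \<longleftrightarrow>
    (int k)\<^sup>2 + (int n)\<^sup>2 \<le> (a + 1) * int k * int n + 1"
proof -
  have "real k * real_of_int a \<ge> real n - real k + (real k ^ 2 - 1) / real n \<longleftrightarrow>
      (real n - real k) * real n + (real k ^ 2 - 1) \<le> real k * real_of_int a * real n"
    using assms by (simp add: field_simps)
  also have "\<dots> \<longleftrightarrow> real_of_int ((int k)\<^sup>2 + (int n)\<^sup>2) \<le> real_of_int ((a + 1) * int k * int n + 1)"
    by (simp add: power2_eq_square algebra_simps)
  finally show ?thesis by (simp only: of_int_le_iff)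
qed

theorem theorem4p5:
  fixes n kk :: nat and a :: int
  assumes "alg_closed TYPE('k::field)"
    and "0 < kk" and "kk < n"
  shows "(\<exists>(e0 :: nat \<Rightarrow> 'k vecK) einf V.
            coherent_system n (int n * a) kk e0 einf V \<and> zero_plus_stable n e0 einf V)
         \<longleftrightarrow> real kk * real_of_int a \<ge> real n - real kk + (real kk ^ 2 - 1) / real n"
proof -
  have n: "0 < n" "1 < n" using assms by auto
  show ?thesis
    unfolding numerical_condition_iff[OF n(1)]
  proof
    assume "\<exists>(e0 :: nat \<Rightarrow> 'k vecK) einf V.
            coherent_system n (int n * a) kk e0 einf V \<and> zero_plus_stable n e0 einf V"
    then obtain e0 einf :: "nat \<Rightarrow> 'k vecK" and V where
      cs: "coherent_system n (int n * a) kk e0 einf V" and st: "zero_plus_stable n e0 einf V" by blast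
    interpret vec_bundle n e0 einf
      using cs by unfold_locales (auto simp: coherent_system_def)
    have a: "0 \<le> a" by (rule stable_imp_kron_stable(1)[OF cs st assms(2) n(2)])
    obtain A :: "nat \<Rightarrow> (nat \<Rightarrow> 'k) \<Rightarrow> nat \<Rightarrow> 'k" where "kron_stable (nat a + 1) kk n A"
      using stable_imp_kron_stable(2)[OF cs st assms(2) n(2)] by blast
    then have "kk\<^sup>2 + n\<^sup>2 \<le> (nat a + 1) * kk * n + 1"
      by (rule kron_stable_dimension_bound[OF assms(1) _ assms(2)])
    then have "int (kk\<^sup>2 + n\<^sup>2) \<le> int ((nat a + 1) * kk * n + 1)" by (simp only: of_nat_le_iff)
    then show "(int kk)\<^sup>2 + (int n)\<^sup>2 \<le> (a + 1) * int kk * int n + 1" using a by (simp add: algebra_simps)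
  next
    assume q: "(int kk)\<^sup>2 + (int n)\<^sup>2 \<le> (a + 1) * int kk * int n + 1"
    \<comment> \<open>For a <= 0 the condition gives k^2 + n^2 <= kn + 1, whereas n >= k + 1 gives
      n^2 >= kn + n; together k^2 + n <= 1, which is impossible. Hence \<open>nat a\<close> loses
      nothing.\<close>
    have a1: "1 \<le> a"
    proof (rule ccontr)
      assume "\<not> 1 \<le> a"
      then have "(a + 1) * (int kk * int n) \<le> 1 * (int kk * int n)" by (intro mult_right_mono) auto
      then have "(int kk)\<^sup>2 + (int n)\<^sup>2 \<le> int kk * int n + 1" using q by (simp add: algebra_simps)
      moreover have "int n * (int kk + 1) \<le> int n * int n" using assms(3) by (intro mult_left_mono) auto
      moreover have "1 \<le> (int kk)\<^sup>2" using assms(2) by simp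
      ultimately show False using n by (simp add: power2_eq_square algebra_simps)
    qed
    have "int (kk\<^sup>2 + n\<^sup>2) \<le> int ((nat a + 1) * kk * n + 1)" using q a1 by (simp add: algebra_simps)
    then have "kk\<^sup>2 + n\<^sup>2 \<le> (nat a + 1) * kk * n + 1" by (simp only: of_nat_le_iff)
    then have "\<exists>A :: nat \<Rightarrow> (nat \<Rightarrow> 'k) \<Rightarrow> nat \<Rightarrow> 'k. kron_stable (nat a + 1) kk n A"
      using a1 assms by (intro kron_stable_exists) auto
    then obtain A :: "nat \<Rightarrow> (nat \<Rightarrow> 'k) \<Rightarrow> nat \<Rightarrow> 'k" where A: "kron_stable (nat a + 1) kk n A" ..
    \<comment> \<open>The stable system is realised on E = O(a)^n.\<close>
    interpret trivial_bundle n "nat a" "unitv :: nat \<Rightarrow> 'k vecK" "\<lambda>j. fscale (tt ^ nat a) (unitv j)"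
      by unfold_locales auto
    show "\<exists>(e0 :: nat \<Rightarrow> 'k vecK) einf V.
            coherent_system n (int n * a) kk e0 einf V \<and> zero_plus_stable n e0 einf V"
      using exists_stable_system[OF A assms(2) n(1)] a1 by auto
  qed
qed

end
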